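(* In the context of the Hamiltonian formalism, consider the first order Hamiltonian action $\int dt\,d^{n-1}x\,(\dot z^Aa_A-h-\lambda^a\gamma_a)$ with first class constraints $\gamma_a$, and let $k_f=k_f^{[\mu\nu]}(d^{n-2}x)_{\mu\nu}$ be its $(n-2,1)$-form $k_f=I^{n-1}_{d_V\phi}S_f$. The surface charge $1$-forms at constant time, $\delta\!\!\!/\,Q_f=\int_Sk_f^{[0i]}d\sigma_i$ with $S$ a closed surface inside the hyperplane $\Sigma_t$ of constant $t$, do not depend on the Lagrange multipliers ($k_f^{[0i]}$ involves neither $\lambda^a$ nor $d_V\lambda^a$), and they are given by the boundary terms that arise when converting the variation of minus the constraints smeared with gauge parameters into an Euler-Lagrange derivative contracted with the undifferentiated variation of the canonical variables: $$-d_V^z(\gamma_af^a)=-d_Vz^A\frac{\delta(\gamma_af^a)}{\delta z^A}+\partial_ik_f^{[0i]}[d_Vz,z].$$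
   Context: Jet-space conventions. $x^\mu=(t=x^0,x^i)$ are coordinates of the $n$-dimensional base space; fields $\phi^i$ have jet coordinates $\phi^i_{\mu_1\dots\mu_k}$, symmetric in the indices. $(p,s)$-forms have degree $p$ in the $dx^\mu$ and degree $s$ in the vertical generators $d_V\phi^i_{(\mu)}$, all odd and mutually anticommuting. $\partial^S/\partial\phi^i_{\mu_1\dots\mu_k}$ is defined by $\frac{\partial^S\phi^j_{\nu_1\dots\nu_k}}{\partial\phi^i_{\mu_1\dots\mu_k}}=\delta^j_i\delta^{\mu_1}_{(\nu_1}\cdots\delta^{\mu_k}_{\nu_k)}$, and zero on jet coordinates of a different order, on $x^\mu,dx^\mu$ and on vertical generators. Repeated multi-indices $(\mu)$, of length $|\mu|\ge0$, are summed over all tuples; $\partial_\nu$ is the total derivative, with $\partial_\nu d_V\phi^i_{(\mu)}=d_V\phi^i_{(\mu)\nu}$; $(-\partial)_{(\mu)}=(-1)^{|\mu|}\partial_{(\mu)}$; $(d^{n-p}x)_{\mu_1\dots\mu_p}=\frac1{p!(n-p)!}\epsilon_{\mu_1\dots\mu_n}dx^{\mu_{p+1}}\cdots dx^{\mu_n}$ with $\epsilon_{0\dots(n-1)}=1$; $d\sigma_i=2(d^{n-2}x)_{0i}$. Higher Euler-Lagrange derivatives: $\frac{\delta f}{\delta\phi^i_{(\mu)}}=\binom{|\mu|+|\nu|}{|\mu|}(-\partial)_{(\nu)}\frac{\partial^Sf}{\partial\phi^i_{((\mu)(\nu))}}$ ($\delta/\delta\phi^i$ for $|\mu|=0$). Homotopy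 operator on $(p,s)$-forms: $I^p_{d_V\phi}\omega=\frac{|\mu|+1}{n-p+|\mu|+1}\partial_{(\mu)}\Big(d_V\phi^i\frac{\delta}{\delta\phi^i_{((\mu)\nu)}}\frac{\partial\omega}{\partial dx^\nu}\Big)$. Here $\phi^i=\{z^A,\lambda^a\}$ is the full set of fields, and $d_V^z$ is the vertical differential acting only on $z^A$ and its derivatives. Hamiltonian setting. $z^A=(\phi^\alpha,\pi_\alpha)$ are Darboux coordinates, $\dot z^Aa_A=\dot\phi^\alpha\pi_\alpha$, $\sigma_{AB}=\partial_Aa_B-\partial_Ba_A$ is the constant symplectic matrix with inverse $\sigma^{AB}$ ($\sigma^{AB}\sigma_{BC}=\delta^A_C$). $h$ and $\gamma_a$ depend on $z^A$ and their spatial derivatives; the constraints $\gamma_a$ are first class, irreducible and time independent. With $\hat g=g\,d^{n-1}x$ put $\{\cdot,\hat g\}_{alt}=\frac{\partial^S(\cdot)}{\partial z^A_{(i)}}\sigma^{AB}\partial_{(i)}\frac{\delta g}{\delta z^B}$ ($(i)$ spatial multi-indices). The structure operators are defined by $\{\gamma_a,\hat\gamma_b\lambda^b\}_{alt}=\mathcal C^{+c}_{ab}(\gamma_c,\lambda^b)$ and $\{\gamma_a,\hat h\}_{alt}=-\mathcal V^{+b}_a(\gamma_b)$, where ${}^+$ denotes the adjoint of the spatial differential operators $\mathcal C^c_{ab}(f^a,\lambda^b)$ (with respect to the first argument) and $\mathcal V^b_a(f^a)$. An irreducible generating set of gauge transformations is, for independent jet variables $f^a$ as gauge parameters (not transformed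 by $d_V^z$), $\delta_fz^A=\{z^A,\hat\gamma_af^a\}_{alt}$, $\delta_f\lambda^a=\partial_0f^a+\mathcal C^a_{bc}(f^b,\lambda^c)-\mathcal V^a_b(f^b)$. With $V^i_A(Q^A,g)=\partial_{(j)}\big(Q^A\frac{\delta g}{\delta z^A_{(j)i}}\big)$ ($(j)$ spatial multi-indices), so that $\partial_{(k)}Q^A\frac{\partial^S g}{\partial z^A_{(k)}}=Q^A\frac{\delta g}{\delta z^A}+\partial_iV^i_A(Q^A,g)$ when $g$ involves no time derivatives of $z^A$ (this is the boundary term referred to in the claim), the weakly vanishing Noether current $S_f=S_f^\mu(d^{n-1}x)_\mu$, satisfying $R_f^i\frac{\delta\mathcal L_H}{\delta\phi^i}=d_HS_f$ for $\mathcal L_H$ the Lagrangian $n$-form of the action, is $$S^0_f=-\gamma_af^a,\qquad S^k_f=V^k_B\Big[\dot z^B-\sigma^{BA}\frac{\delta h_E}{\delta z^A},\gamma_af^a\Big]+j^{ka}_b(\gamma_a,f^b),$$ where $h_E=h+\lambda^a\gamma_a$ and $j^{ka}_b$, a bidifferential operator involving only spatial derivatives, satisfies $\partial_kj^{ka}_b(\gamma_a,f^b)=\gamma_a\mathcal V^a_b(f^b)-f^b\mathcal V^{+a}_b(\gamma_a)-\gamma_c\mathcal C^c_{ab}(f^a,\lambda^b)+f^a\mathcal C^{+c}_{ab}(\gamma_c,\lambda^b)$. *)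

theory Defs
  imports
    "HOL-Analysis.Analysis"
    "HOL-Homology.Homology"
    "HOL-Library.Function_Algebras"
    "HOL-Library.Groups_Big_Fun"
    "HOL-Combinatorics.Permutations"
begin

section \<open>Smooth functions of finitely many coordinates\<close>

text \<open>
  Functions are added and multiplied pointwise (\<^theory>\<open>HOL-Library.Function_Algebras\<close>).
  A coordinate space is a type \<^typ>\<open>'c \<Rightarrow> real\<close>, where \<^typ>\<open>'c\<close> names the coordinates; it is
  used both for the base space and for the infinite jet space.
\<close>

definition pd :: "'c \<Rightarrow> (('c \<Rightarrow> real) \<Rightarrow> real) \<Rightarrow> ('c \<Rightarrow> real) \<Rightarrow> real" where
  "pd c F = (\<lambda>p. deriv (\<lambda>s. F (p(c := s))) (p c))"

definition pds :: "'c list \<Rightarrow> (('c \<Rightarrow> real) \<Rightarrow> real) \<Rightarrow> ('c \<Rightarrow> real) \<Rightarrow> real" where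
  "pds cs F = foldr pd cs F"

definition smooth :: "(('c \<Rightarrow> real) \<Rightarrow> real) \<Rightarrow> bool" where
  "smooth F \<longleftrightarrow> (\<forall>cs. continuous_on UNIV (pds cs F) \<and>
     (\<forall>c p. (\<lambda>s. pds cs F (p(c := s))) differentiable at (p c)))"

definition depends_on :: "'c set \<Rightarrow> (('c \<Rightarrow> real) \<Rightarrow> real) \<Rightarrow> bool" where
  "depends_on D F \<longleftrightarrow> (\<forall>p q. (\<forall>c\<in>D. p c = q c) \<longrightarrow> F p = F q)"

definition local_in :: "'c set \<Rightarrow> (('c \<Rightarrow> real) \<Rightarrow> real) \<Rightarrow> bool" where
  "local_in D F \<longleftrightarrow> smooth F \<and> (\<exists>C\<subseteq>D. finite C \<and> depends_on C F)"

text \<open>Sum over an infinite index set of a family with finite support.\<close>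

abbreviation sum_over :: "'b set \<Rightarrow> ('b \<Rightarrow> 'x::comm_monoid_add) \<Rightarrow> 'x" where
  "sum_over B g \<equiv> Sum_any (\<lambda>b. if b \<in> B then g b else 0)"

section \<open>Jet space\<close>

text \<open>
  The base space of dimension \<open>n\<close> has the coordinates \<open>X \<mu>\<close> with \<open>\<mu> < n\<close>, and \<open>X 0\<close> is the time.
  Since jet coordinates are symmetric in their indices, \<open>U i M\<close> is indexed by a multiset \<open>M\<close>.
\<close>

datatype 'i coord = X nat | U 'i "nat multiset"

type_synonym 'i local_fn = "('i coord \<Rightarrow> real) \<Rightarrow> real"

definition coordf :: "'i coord \<Rightarrow> 'i local_fn" where
  "coordf c = (\<lambda>p. p c)"

definition jet_coords :: "nat \<Rightarrow> 'i set \<Rightarrow> nat set \<Rightarrow> 'i coord set" where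
  "jet_coords n I D = X ` {..<n} \<union> {U i M | i M. i \<in> I \<and> set_mset M \<subseteq> D}"

text \<open>
  In the total derivative the sum over all tuples of the symmetrised derivatives is written as the
  equal sum over multisets of the ordinary partial derivatives.
\<close>

definition td :: "nat \<Rightarrow> 'i local_fn \<Rightarrow> 'i local_fn" where
  "td \<nu> F = pd (X \<nu>) F + Sum_any (\<lambda>(i, M). coordf (U i (add_mset \<nu> M)) * pd (U i M) F)"

definition tds :: "nat list \<Rightarrow> 'i local_fn \<Rightarrow> 'i local_fn" where
  "tds \<mu>s F = foldr td \<mu>s F"

text \<open>
  The symmetrised delta \<open>\<delta>\<^sup>\<mu>\<^sup>1\<^bsub>(\<nu>1\<^esub> \<dots> \<delta>\<^sup>\<mu>\<^sup>k\<^bsub>\<nu>k)\<^esub>\<close> vanishes unless \<open>\<nu>s\<close> is a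
  rearrangement of \<open>\<mu>s\<close>, in which case \<open>\<nu>s\<close> may be replaced by \<open>\<mu>s\<close>.  Hence by the chain rule the
  symmetrised derivative is a multiple of one ordinary partial derivative.
\<close>

definition symdelta :: "nat list \<Rightarrow> real" where
  "symdelta \<mu>s = of_nat (card {\<pi>. \<pi> permutes {..<length \<mu>s} \<and> (\<forall>j<length \<mu>s. \<mu>s ! (\<pi> j) = \<mu>s ! j)})
     / fact (length \<mu>s)"

definition pS :: "'i \<Rightarrow> nat list \<Rightarrow> 'i local_fn \<Rightarrow> 'i local_fn" where
  "pS i \<mu>s F = (\<lambda>_. symdelta \<mu>s) * pd (U i (mset \<mu>s)) F"

text \<open>Repeated multi-indices run over all tuples, not over multisets.\<close>

definition euler :: "nat \<Rightarrow> 'i \<Rightarrow> nat list \<Rightarrow> 'i local_fn \<Rightarrow> 'i local_fn" where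
  "euler n i \<mu>s F = sum_over (lists {..<n}) (\<lambda>\<nu>s.
     (\<lambda>_. of_nat ((length \<mu>s + length \<nu>s) choose length \<mu>s) * (- 1) ^ length \<nu>s) *
     tds \<nu>s (pS i (\<mu>s @ \<nu>s) F))"

section \<open>Local forms\<close>

datatype 'i gen = is_Dx: Dx (dx_index: nat) | DV 'i "nat multiset"

text \<open>
  A form is given by its antisymmetric components: \<open>\<omega>\<close> stands for the sum over \<open>k\<close> and over all
  generators of \<open>1/k! \<omega> [g\<^sub>1, \<dots>, g\<^sub>k] g\<^sub>1 \<dots> g\<^sub>k\<close>, where all generators \<open>Dx \<mu>\<close> and
  \<open>DV i M\<close> (the vertical differential of the coordinate \<open>U i M\<close>) anticommute.
\<close>

type_synonym 'i form = "'i gen list \<Rightarrow> 'i local_fn"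

definition gens :: "nat \<Rightarrow> 'i gen set" where
  "gens n = Dx ` {..<n} \<union> {DV i M | i M. set_mset M \<subseteq> {..<n}}"

definition is_form :: "nat \<Rightarrow> nat \<Rightarrow> nat \<Rightarrow> 'i form \<Rightarrow> bool" where
  "is_form n p s \<omega> \<longleftrightarrow>
     (\<forall>gs. local_in (jet_coords n UNIV {..<n}) (\<omega> gs)) \<and>
     finite {gs. \<omega> gs \<noteq> 0} \<and>
     (\<forall>gs. \<omega> gs \<noteq> 0 \<longrightarrow> set gs \<subseteq> gens n \<and>
        length (filter is_Dx gs) = p \<and> length (filter (\<lambda>g. \<not> is_Dx g) gs) = s) \<and>
     (\<forall>gs i j. i < j \<and> j < length gs \<longrightarrow> \<omega> (gs[i := gs ! j, j := gs ! i]) = - \<omega> gs)"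

definition fscale :: "'i local_fn \<Rightarrow> 'i form \<Rightarrow> 'i form" where
  "fscale F \<omega> = (\<lambda>gs. F * \<omega> gs)"

definition zero_form :: "'i local_fn \<Rightarrow> 'i form" where
  "zero_form F = (\<lambda>gs. if gs = [] then F else 0)"

definition gen_form :: "'i gen \<Rightarrow> 'i form" where
  "gen_form g = (\<lambda>gs. if gs = [g] then 1 else 0)"

text \<open>Exterior product of a 1-form \<open>\<alpha>\<close> (on the left) with an arbitrary form.\<close>

definition wedge1 :: "'i form \<Rightarrow> 'i form \<Rightarrow> 'i form" where
  "wedge1 \<alpha> \<omega> = (\<lambda>gs. \<Sum>k<length gs.
     (\<lambda>_. (- 1) ^ k) * \<alpha> [gs ! k] * \<omega> (take k gs @ drop (Suc k) gs))"

text \<open>In components, the left derivative with respect to the odd generator \<open>g\<close>.\<close>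

definition dgen :: "'i gen \<Rightarrow> 'i form \<Rightarrow> 'i form" where
  "dgen g \<omega> = (\<lambda>gs. \<omega> (g # gs))"

text \<open>
  Total derivative on forms: it acts on the coefficients and is extended as an even derivation that
  annihilates \<open>Dx \<mu>\<close> and sends \<open>DV i M\<close> to \<open>DV i (add_mset \<nu> M)\<close>.
\<close>

definition ftd :: "nat \<Rightarrow> 'i form \<Rightarrow> 'i form" where
  "ftd \<nu> \<omega> = (\<lambda>gs. td \<nu> (\<omega> gs) + (\<Sum>k<length gs. case gs ! k of
       Dx \<mu> \<Rightarrow> 0
     | DV i M \<Rightarrow> if \<nu> \<in># M then \<omega> (gs[k := DV i (M - {#\<nu>#})]) else 0))"

definition ftds :: "nat list \<Rightarrow> 'i form \<Rightarrow> 'i form" where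
  "ftds \<mu>s \<omega> = foldr ftd \<mu>s \<omega>"

definition feuler :: "nat \<Rightarrow> 'i \<Rightarrow> nat list \<Rightarrow> 'i form \<Rightarrow> 'i form" where
  "feuler n i \<mu>s \<omega> = sum_over (lists {..<n}) (\<lambda>\<nu>s.
     fscale (\<lambda>_. of_nat ((length \<mu>s + length \<nu>s) choose length \<mu>s) * (- 1) ^ length \<nu>s)
       (ftds \<nu>s (\<lambda>gs. pS i (\<mu>s @ \<nu>s) (\<omega> gs))))"

definition d_H :: "nat \<Rightarrow> 'i form \<Rightarrow> 'i form" where
  "d_H n \<omega> = (\<Sum>\<nu><n. wedge1 (gen_form (Dx \<nu>)) (ftd \<nu> \<omega>))"

text \<open>\<open>p\<close> is the horizontal degree of \<open>\<omega>\<close>, and \<open>I\<close> is the set of fields that are varied.\<close>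

definition homotopy :: "nat \<Rightarrow> 'i set \<Rightarrow> nat \<Rightarrow> 'i form \<Rightarrow> 'i form" where
  "homotopy n I p \<omega> = sum_over (lists {..<n}) (\<lambda>\<mu>s.
     fscale (\<lambda>_. (of_nat (length \<mu>s) + 1) / (of_nat n - of_nat p + of_nat (length \<mu>s) + 1))
       (ftds \<mu>s (\<Sum>i\<in>I. \<Sum>\<nu><n.
          wedge1 (gen_form (DV i {#})) (feuler n i (\<mu>s @ [\<nu>]) (dgen (Dx \<nu>) \<omega>)))))"

definition levi_civita :: "nat \<Rightarrow> nat list \<Rightarrow> real" where
  "levi_civita n \<mu>s = (if length \<mu>s = n \<and> set \<mu>s = {..<n}
     then of_int (sign (\<lambda>i. if i < n then \<mu>s ! i else i)) else 0)"

text \<open>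
  \<open>(d\<^bsup>n-p\<^esup>x)\<close> with lower indices \<open>\<mu>s\<close>, where \<open>p = length \<mu>s\<close>.  The factor \<open>1/(n-p)!\<close> of the usual
  formula is absorbed in the component convention for forms.
\<close>

definition dxf :: "nat \<Rightarrow> nat list \<Rightarrow> 'i form" where
  "dxf n \<mu>s = (\<lambda>gs. if list_all is_Dx gs
     then (\<lambda>_. levi_civita n (\<mu>s @ map dx_index gs) / fact (length \<mu>s)) else 0)"

definition dsigma :: "nat \<Rightarrow> nat \<Rightarrow> 'i form" where
  "dsigma n i = fscale (\<lambda>_. 2) (dxf n [0, i])"

text \<open>\<open>k\<close> is the family of components \<open>k\<^bsup>[\<mu>\<nu>]\<^esup>\<close> of an \<open>(n-2,1)\<close>-form.\<close>

definition components2 :: "nat \<Rightarrow> 'i form \<Rightarrow> (nat \<Rightarrow> nat \<Rightarrow> 'i form) \<Rightarrow> bool" where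
  "components2 n \<omega> k \<longleftrightarrow>
     (\<forall>\<mu> \<nu>. is_form n 0 1 (k \<mu> \<nu>) \<and> k \<mu> \<nu> = - k \<nu> \<mu>) \<and>
     (\<forall>\<mu> \<nu>. n \<le> \<mu> \<longrightarrow> k \<mu> \<nu> = 0) \<and>
     \<omega> = (\<Sum>\<mu><n. \<Sum>\<nu><n. wedge1 (k \<mu> \<nu>) (dxf n [\<mu>, \<nu>]))"

section \<open>Spatial differential operators\<close>

text \<open>
  Operators are given by finitely supported families of coefficients indexed by tuples of spatial
  indices; adjoints are taken with respect to the first argument.
\<close>

definition diff_op :: "nat \<Rightarrow> (nat list \<Rightarrow> 'i local_fn) \<Rightarrow> 'i local_fn \<Rightarrow> 'i local_fn" where
  "diff_op n P u = sum_over (lists {1..<n}) (\<lambda>ms. P ms * tds ms u)"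

definition diff_adj :: "nat \<Rightarrow> (nat list \<Rightarrow> 'i local_fn) \<Rightarrow> 'i local_fn \<Rightarrow> 'i local_fn" where
  "diff_adj n P w = sum_over (lists {1..<n}) (\<lambda>ms. (\<lambda>_. (- 1) ^ length ms) * tds ms (P ms * w))"

definition bidiff_op ::
    "nat \<Rightarrow> (nat list \<Rightarrow> nat list \<Rightarrow> 'i local_fn) \<Rightarrow> 'i local_fn \<Rightarrow> 'i local_fn \<Rightarrow> 'i local_fn" where
  "bidiff_op n P u v = sum_over (lists {1..<n} \<times> lists {1..<n})
     (\<lambda>(ms, ks). P ms ks * tds ms u * tds ks v)"

definition bidiff_adj ::
    "nat \<Rightarrow> (nat list \<Rightarrow> nat list \<Rightarrow> 'i local_fn) \<Rightarrow> 'i local_fn \<Rightarrow> 'i local_fn \<Rightarrow> 'i local_fn" where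
  "bidiff_adj n P w v = sum_over (lists {1..<n} \<times> lists {1..<n})
     (\<lambda>(ms, ks). (\<lambda>_. (- 1) ^ length ms) * tds ms (P ms ks * tds ks v * w))"

section \<open>Hamiltonian systems\<close>

text \<open>
  \<open>Z (Inl \<alpha>)\<close> and \<open>Z (Inr \<alpha>)\<close> are the Darboux coordinates \<open>\<phi>\<^sup>\<alpha>\<close> and \<open>\<pi>\<^sub>\<alpha>\<close>, \<open>Lam a\<close> is the Lagrange
  multiplier \<open>\<lambda>\<^sup>a\<close>, and \<open>Par a\<close> is the gauge parameter \<open>f\<^sup>a\<close>, an independent jet variable.
\<close>

datatype ('a, 'c) fld = Z "'a + 'a" | Lam 'c | Par 'c

type_synonym ('a, 'c) lfun = "('a, 'c) fld local_fn"

type_synonym ('a, 'c) lform = "('a, 'c) fld form"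

definition fields :: "('a, 'c) fld set" where
  "fields = range Z \<union> range Lam"

definition lam :: "'c \<Rightarrow> ('a, 'c) lfun" where
  "lam a = coordf (U (Lam a) {#})"

definition par :: "'c \<Rightarrow> ('a, 'c) lfun" where
  "par a = coordf (U (Par a) {#})"

definition zdot :: "'a + 'a \<Rightarrow> ('a, 'c) lfun" where
  "zdot A = coordf (U (Z A) {#0#})"

definition z_spatial :: "nat \<Rightarrow> ('a, 'c) fld coord set" where
  "z_spatial n = jet_coords n (range Z) {1..<n}"

definition sympl_pot :: "'a + 'a \<Rightarrow> ('a, 'c) lfun" where
  "sympl_pot A = (case A of Inl \<alpha> \<Rightarrow> coordf (U (Z (Inr \<alpha>)) {#}) | Inr \<alpha> \<Rightarrow> 0)"

definition sigma_lo :: "'a + 'a \<Rightarrow> 'a + 'a \<Rightarrow> ('a, 'c) lfun" where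
  "sigma_lo A B = pd (U (Z A) {#}) (sympl_pot B) - pd (U (Z B) {#}) (sympl_pot A)"

definition sigma_up :: "'a::finite + 'a \<Rightarrow> 'a + 'a \<Rightarrow> ('a, 'c) lfun" where
  "sigma_up A B = (\<lambda>p. matrix_inv (\<chi> D E. sigma_lo D E p) $ A $ B)"

definition bracket_alt :: "nat \<Rightarrow> ('a::finite, 'c) lfun \<Rightarrow> ('a, 'c) lfun \<Rightarrow> ('a, 'c) lfun" where
  "bracket_alt n F g = (\<Sum>A\<in>UNIV. \<Sum>B\<in>UNIV. sum_over (lists {1..<n})
     (\<lambda>ms. pS (Z A) ms F * sigma_up A B * tds ms (euler n (Z B) [] g)))"

text \<open>
  \<open>N\<close> is indexed by multisets of spatial indices so that the operator \<open>N\<close> determines its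
  coefficients.
\<close>

definition irreducible_constraints :: "nat \<Rightarrow> ('c \<Rightarrow> ('a, 'c) lfun) \<Rightarrow> bool" where
  "irreducible_constraints n \<gamma> \<longleftrightarrow>
     (\<forall>N. (\<forall>a M. local_in (z_spatial n) (N a M)) \<and>
          finite {(a, M). N a M \<noteq> 0} \<and> (\<forall>a M. N a M \<noteq> 0 \<longrightarrow> set_mset M \<subseteq> {1..<n}) \<and>
          Sum_any (\<lambda>(a, M). N a M * tds (sorted_list_of_multiset M) (\<gamma> a)) = 0 \<longrightarrow>
          (\<forall>p. (\<forall>b. \<forall>ms\<in>lists {1..<n}. tds ms (\<gamma> b) p = 0) \<longrightarrow> (\<forall>a M. N a M p = 0)))"

text \<open>
  First class constraints: \<open>C c a b\<close> and \<open>V b a\<close> are the coefficients of the structure operators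
  \<open>\<C>\<^sup>c\<^sub>a\<^sub>b\<close> and \<open>\<V>\<^sup>b\<^sub>a\<close>.
\<close>

definition first_class :: "nat \<Rightarrow> ('a::finite, 'c::finite) lfun \<Rightarrow> ('c \<Rightarrow> ('a, 'c) lfun) \<Rightarrow>
    ('c \<Rightarrow> 'c \<Rightarrow> 'c \<Rightarrow> nat list \<Rightarrow> nat list \<Rightarrow> ('a, 'c) lfun) \<Rightarrow>
    ('c \<Rightarrow> 'c \<Rightarrow> nat list \<Rightarrow> ('a, 'c) lfun) \<Rightarrow> bool" where
  "first_class n h \<gamma> C V \<longleftrightarrow>
     (\<forall>c a b ms ks. local_in (z_spatial n) (C c a b ms ks)) \<and>
     (\<forall>c a b. finite {(ms, ks). C c a b ms ks \<noteq> 0}) \<and>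
     (\<forall>b a ms. local_in (z_spatial n) (V b a ms)) \<and>
     (\<forall>b a. finite {ms. V b a ms \<noteq> 0}) \<and>
     (\<forall>a. bracket_alt n (\<gamma> a) (\<Sum>b\<in>UNIV. \<gamma> b * lam b) =
        (\<Sum>b\<in>UNIV. \<Sum>c\<in>UNIV. bidiff_adj n (C c a b) (\<gamma> c) (lam b))) \<and>
     (\<forall>a. bracket_alt n (\<gamma> a) h = - (\<Sum>b\<in>UNIV. diff_adj n (V b a) (\<gamma> b)))"

definition smeared :: "('c::finite \<Rightarrow> ('a, 'c) lfun) \<Rightarrow> ('a, 'c) lfun" where
  "smeared \<gamma> = (\<Sum>a\<in>UNIV. \<gamma> a * par a)"

definition h_ext :: "('a, 'c::finite) lfun \<Rightarrow> ('c \<Rightarrow> ('a, 'c) lfun) \<Rightarrow> ('a, 'c) lfun" where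
  "h_ext h \<gamma> = h + (\<Sum>a\<in>UNIV. lam a * \<gamma> a)"

definition lagrangian_form :: "nat \<Rightarrow> ('a::finite, 'c::finite) lfun \<Rightarrow> ('c \<Rightarrow> ('a, 'c) lfun) \<Rightarrow>
    ('a, 'c) lform" where
  "lagrangian_form n h \<gamma> =
     fscale ((\<Sum>A\<in>UNIV. zdot A * sympl_pot A) - h - (\<Sum>a\<in>UNIV. lam a * \<gamma> a)) (dxf n [])"

fun gauge_transf :: "nat \<Rightarrow> ('c::finite \<Rightarrow> ('a::finite, 'c) lfun) \<Rightarrow>
    ('c \<Rightarrow> 'c \<Rightarrow> 'c \<Rightarrow> nat list \<Rightarrow> nat list \<Rightarrow> ('a, 'c) lfun) \<Rightarrow>
    ('c \<Rightarrow> 'c \<Rightarrow> nat list \<Rightarrow> ('a, 'c) lfun) \<Rightarrow> ('a, 'c) fld \<Rightarrow> ('a, 'c) lfun" where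
  "gauge_transf n \<gamma> C V (Z A) = bracket_alt n (coordf (U (Z A) {#})) (smeared \<gamma>)"
| "gauge_transf n \<gamma> C V (Lam a) = td 0 (par a)
     + (\<Sum>b\<in>UNIV. \<Sum>c\<in>UNIV. bidiff_op n (C a b c) (par b) (lam c))
     - (\<Sum>b\<in>UNIV. diff_op n (V a b) (par b))"
| "gauge_transf n \<gamma> C V (Par a) = 0"

text \<open>The boundary term \<open>V\<^sup>i\<^sub>A(Q\<^sup>A,g)\<close>, for a family of forms \<open>Q\<close>.\<close>

definition bdry :: "nat \<Rightarrow> nat \<Rightarrow> ('a::finite + 'a \<Rightarrow> ('a, 'c) lform) \<Rightarrow> ('a, 'c) lfun \<Rightarrow>
    ('a, 'c) lform" where
  "bdry n i Q g = (\<Sum>A\<in>UNIV. sum_over (lists {1..<n})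
     (\<lambda>ms. ftds ms (fscale (euler n (Z A) (ms @ [i]) g) (Q A))))"

definition current_form :: "nat \<Rightarrow> (nat \<Rightarrow> ('a, 'c) lfun) \<Rightarrow> ('a, 'c) lform" where
  "current_form n S = (\<Sum>\<mu><n. fscale (S \<mu>) (dxf n [\<mu>]))"

text \<open>\<open>J k a b\<close> are the coefficients of the operator \<open>j\<^sup>k\<^sup>a\<^sub>b\<close>.\<close>

definition current_operator :: "nat \<Rightarrow> ('c::finite \<Rightarrow> ('a::finite, 'c) lfun) \<Rightarrow>
    ('c \<Rightarrow> 'c \<Rightarrow> 'c \<Rightarrow> nat list \<Rightarrow> nat list \<Rightarrow> ('a, 'c) lfun) \<Rightarrow>
    ('c \<Rightarrow> 'c \<Rightarrow> nat list \<Rightarrow> ('a, 'c) lfun) \<Rightarrow>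
    (nat \<Rightarrow> 'c \<Rightarrow> 'c \<Rightarrow> nat list \<Rightarrow> nat list \<Rightarrow> ('a, 'c) lfun) \<Rightarrow> bool" where
  "current_operator n \<gamma> C V J \<longleftrightarrow>
     (\<forall>k a b ms ks. local_in (jet_coords n fields {1..<n}) (J k a b ms ks)) \<and>
     (\<forall>k a b. finite {(ms, ks). J k a b ms ks \<noteq> 0}) \<and>
     (\<Sum>k=1..<n. td k (\<Sum>a\<in>UNIV. \<Sum>b\<in>UNIV. bidiff_op n (J k a b) (\<gamma> a) (par b))) =
       (\<Sum>a\<in>UNIV. \<Sum>b\<in>UNIV. \<gamma> a * diff_op n (V a b) (par b) - par b * diff_adj n (V a b) (\<gamma> a))
       - (\<Sum>a\<in>UNIV. \<Sum>b\<in>UNIV. \<Sum>c\<in>UNIV. \<gamma> c * bidiff_op n (C c a b) (par a) (lam b))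
       + (\<Sum>a\<in>UNIV. \<Sum>b\<in>UNIV. \<Sum>c\<in>UNIV. par a * bidiff_adj n (C c a b) (\<gamma> c) (lam b))"

text \<open>
  The first conjunct is the Noether identity for the action; for the components given by the other
  two conjuncts it follows from \<^const>\<open>first_class\<close>, \<^const>\<open>current_operator\<close> and the time
  independence of the constraints.
\<close>

definition weakly_vanishing_current :: "nat \<Rightarrow> ('a::finite, 'c::finite) lfun \<Rightarrow>
    ('c \<Rightarrow> ('a, 'c) lfun) \<Rightarrow>
    ('c \<Rightarrow> 'c \<Rightarrow> 'c \<Rightarrow> nat list \<Rightarrow> nat list \<Rightarrow> ('a, 'c) lfun) \<Rightarrow>
    ('c \<Rightarrow> 'c \<Rightarrow> nat list \<Rightarrow> ('a, 'c) lfun) \<Rightarrow>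
    (nat \<Rightarrow> 'c \<Rightarrow> 'c \<Rightarrow> nat list \<Rightarrow> nat list \<Rightarrow> ('a, 'c) lfun) \<Rightarrow>
    (nat \<Rightarrow> ('a, 'c) lfun) \<Rightarrow> bool" where
  "weakly_vanishing_current n h \<gamma> C V J S \<longleftrightarrow>
     (\<Sum>i\<in>fields. fscale (gauge_transf n \<gamma> C V i) (feuler n i [] (lagrangian_form n h \<gamma>)))
       = d_H n (current_form n S) \<and>
     S 0 = - smeared \<gamma> \<and>
     (\<forall>k\<in>{1..<n}. S k =
        bdry n k (\<lambda>B. zero_form (zdot B - (\<Sum>A\<in>UNIV. sigma_up B A * euler n (Z A) [] (h_ext h \<gamma>))))
          (smeared \<gamma>) []
        + (\<Sum>a\<in>UNIV. \<Sum>b\<in>UNIV. bidiff_op n (J k a b) (\<gamma> a) (par b)))"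

definition charge_form :: "nat \<Rightarrow> (nat \<Rightarrow> ('a::finite, 'c::finite) lfun) \<Rightarrow> ('a, 'c) lform" where
  "charge_form n S = homotopy n fields (n - 1) (current_form n S)"

definition d_V_z :: "('a, 'c) lfun \<Rightarrow> ('a, 'c) lform" where
  "d_V_z F = Sum_any (\<lambda>(A, M). fscale (pd (U (Z A) M) F) (gen_form (DV (Z A) M)))"

abbreviation dz :: "'a + 'a \<Rightarrow> ('a, 'c) lform" where
  "dz A \<equiv> gen_form (DV (Z A) {#})"

definition multiplier_free :: "('a, 'c) lform \<Rightarrow> bool" where
  "multiplier_free \<omega> \<longleftrightarrow> (\<forall>gs.
     depends_on (- {U (Lam a) M | a M. True}) (\<omega> gs) \<and>
     ((\<exists>a M. DV (Lam a) M \<in> set gs) \<longrightarrow> \<omega> gs = 0))"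

section \<open>Surface charges\<close>

definition smooth_section :: "nat \<Rightarrow> ('i \<Rightarrow> (nat \<Rightarrow> real) \<Rightarrow> real) \<Rightarrow> bool" where
  "smooth_section n \<phi> \<longleftrightarrow> (\<forall>i. local_in {..<n} (\<phi> i))"

fun jet :: "('i \<Rightarrow> (nat \<Rightarrow> real) \<Rightarrow> real) \<Rightarrow> (nat \<Rightarrow> real) \<Rightarrow> 'i coord \<Rightarrow> real" where
  "jet \<phi> x (X \<mu>) = x \<mu>"
| "jet \<phi> x (U i M) = pds (sorted_list_of_multiset M) (\<phi> i) x"

text \<open>Value at \<open>x\<close> of a vertical 1-form at the section \<open>\<phi>\<close> on the variation \<open>\<psi>\<close>.\<close>

definition eval_vertical :: "'i form \<Rightarrow> ('i \<Rightarrow> (nat \<Rightarrow> real) \<Rightarrow> real) \<Rightarrow>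
    ('i \<Rightarrow> (nat \<Rightarrow> real) \<Rightarrow> real) \<Rightarrow> (nat \<Rightarrow> real) \<Rightarrow> real" where
  "eval_vertical \<omega> \<phi> \<psi> x = Sum_any (\<lambda>(i, M). \<omega> [DV i M] (jet \<phi> x) * jet \<psi> x (U i M))"

text \<open>
  Closed surfaces of dimension \<open>n - 2\<close> in the hyperplane of constant time are smooth singular cycles.
  Points of the base space are extended by \<open>0\<close> beyond the first \<open>n\<close> components.
\<close>

definition hyperplane :: "nat \<Rightarrow> real \<Rightarrow> (nat \<Rightarrow> real) set" where
  "hyperplane n t = {x. x 0 = t \<and> (\<forall>\<mu>\<ge>n. x \<mu> = 0)}"

definition closed_surface :: "nat \<Rightarrow> real \<Rightarrow> (nat \<Rightarrow> real) chain \<Rightarrow> bool" where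
  "closed_surface n t S \<longleftrightarrow>
     singular_relcycle (n - 2) (top_of_set (hyperplane n t)) {} S \<and>
     (\<forall>s\<in>Poly_Mapping.keys S. \<exists>r. (\<forall>\<mu>. local_in {..n - 2} (\<lambda>u. r u \<mu>)) \<and>
        (\<forall>u\<in>standard_simplex (n - 2). s u = r u))"

text \<open>The standard simplex is parametrised by its barycentric coordinates \<open>1, \<dots>, p\<close>.\<close>

definition bary :: "nat \<Rightarrow> (nat \<Rightarrow> real) \<Rightarrow> nat \<Rightarrow> real" where
  "bary p u = (\<lambda>j. if j = 0 then 1 - (\<Sum>i=1..p. u i) else if j \<le> p then u j else 0)"

text \<open>
  The integral of \<open>\<Sum>\<^sub>i k\<^bsup>[0i]\<^esup> d\<sigma>\<^sub>i\<close> over a chain \<open>S\<close> of dimension \<open>n - 2\<close>.  In the component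
  convention for forms the pullback along \<open>s\<close> is the sum over all tuples \<open>\<alpha>s\<close>.
\<close>

definition surface_charge :: "nat \<Rightarrow> (nat \<Rightarrow> nat \<Rightarrow> 'i form) \<Rightarrow> (nat \<Rightarrow> real) chain \<Rightarrow>
    ('i \<Rightarrow> (nat \<Rightarrow> real) \<Rightarrow> real) \<Rightarrow> ('i \<Rightarrow> (nat \<Rightarrow> real) \<Rightarrow> real) \<Rightarrow> real" where
  "surface_charge n k S \<phi> \<psi> = (\<Sum>s\<in>Poly_Mapping.keys S. of_int (Poly_Mapping.lookup S s) *
     set_lebesgue_integral (Pi\<^sub>M {1..n - 2} (\<lambda>_. lborel))
       {u \<in> {1..n - 2} \<rightarrow>\<^sub>E {0..}. (\<Sum>i=1..n - 2. u i) \<le> 1}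
       (\<lambda>u. \<Sum>i=1..<n. eval_vertical (k 0 i) \<phi> \<psi> (s (bary (n - 2) u)) *
          (\<Sum>\<alpha>s\<in>{\<alpha>s \<in> lists {..<n}. length \<alpha>s = n - 2}.
             dsigma n i (map Dx \<alpha>s) (jet \<phi> (s (bary (n - 2) u))) *
             (\<Prod>j<n - 2. pd (Suc j) (\<lambda>v. s (bary (n - 2) v) (\<alpha>s ! j)) u))))"

end

(*
  For g = gamma_a f^a, which involves only spatial derivatives, the higher Euler-Lagrange
  derivatives and the symmetrised derivatives of g are related by a pair of mutually inverse binomial
  transforms built from total derivatives.  Together with the Leibniz rule this turns
  d_V^z g into the sum over all tuples ms of D_ms (dz^A delta g / delta z^A_ms); splitting off the
  empty tuple and the first index of the others gives the Euler-Lagrange term and the divergence of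
  the boundary term.

  With T^{mu nu} the sum over ms of (|ms|+1)/(|ms|+2) D_ms (d_V phi^j delta S^mu / delta phi^j_{ms nu}),
  the components of the charge are k^{[mu nu]} = T^{mu nu} - T^{nu mu}.  T^{0i} only sees S^0 = - g.
  T^{i0} only sees the part of S^i that is linear in the velocities, and by the inverse transform
  delta S^i / delta z^A_{ms 0} = 1/(|ms|+1) delta g / delta z^A_{ms i}, where 1/(|ms|+1) is the weight
  of the single time index in the symmetrised derivative.  The weights of T^{0i} and T^{i0} therefore
  add up to one and k^{[0i]} is minus the boundary term of g, which involves no multiplier.
*)

theory Submission
  imports Defs "HOL-Combinatorics.Multiset_Permutations"
begin

section \<open>Calculus of local functions\<close>

text \<open>What makes S^i tractable is a round trip. Moving all derivatives in its boundary term
  onto the velocities turns the family delta g / delta z^A_{ms i} into its binomial transform with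
  +1, and these are the coefficients of the velocities. The Euler-Lagrange derivatives in the
  homotopy operator then apply the transform with -1 to these coefficients, so the family comes
  back. The time index fits in because (a+m+1 choose a+1) / (a+m+1) = (a+m choose a) / (a+1): the
  weight of the symmetrised derivative is exactly what changes the binomial coefficients of the
  longer tuple into those of the shorter one. Two obstacles shape the formal side. Sums over tuples
  are finite only up to a bound on the jet order, and since the currents are given by formulas,
  their locality has to be derived before such a bound exists for them. Moreover k_f^{[mu nu]} is
  specified by a relation, so its uniqueness is part of the claim.\<close>

lemma sum_fun_apply: "(\<Sum>a\<in>A. f a) x = (\<Sum>a\<in>A. f a x)"
  by (induction A rule: infinite_finite_induct) auto

text \<open>Weaker than \<open>smooth\<close> and still enough for the sum and product rules, so
  that these are available while smoothness of products is being established.\<close>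

definition partially_differentiable :: "(('c \<Rightarrow> real) \<Rightarrow> real) \<Rightarrow> bool" where
  "partially_differentiable F \<longleftrightarrow> (\<forall>c p. (\<lambda>s. F (p(c := s))) differentiable at (p c))"

lemma smooth_iff: "smooth F \<longleftrightarrow> (\<forall>cs. continuous_on UNIV (pds cs F) \<and> partially_differentiable (pds cs F))"
  by (simp only: smooth_def partially_differentiable_def)

text \<open>Turns smoothness into the choice of an invariant class: iterated derivatives never leave
  \<open>S\<close>, so Leibniz expansions of higher order are avoided.\<close>

lemma smooth_coinduct:
  assumes "F \<in> S"
    and "\<And>F. F \<in> S \<Longrightarrow> continuous_on UNIV F"
    and "\<And>F. F \<in> S \<Longrightarrow> partially_differentiable F"
    and "\<And>F c. F \<in> S \<Longrightarrow> pd c F \<in> S"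
  shows "smooth F"
proof -
  have "pds cs F \<in> S" for cs
    by (induction cs) (simp_all add: pds_def assms(1,4))
  then show ?thesis
    unfolding smooth_iff using assms(2,3) by blast
qed

lemma smooth_continuous: "smooth F \<Longrightarrow> continuous_on UNIV F"
  and smooth_partially_differentiable: "smooth F \<Longrightarrow> partially_differentiable F"
proof -
  assume "smooth F"
  then have "continuous_on UNIV (pds [] F)" "partially_differentiable (pds [] F)"
    unfolding smooth_iff by blast+
  then show "continuous_on UNIV F" "partially_differentiable F"
    by (simp_all add: pds_def)
qed

lemma smooth_pd: "smooth F \<Longrightarrow> smooth (pd c F)"
proof -
  assume "smooth F"
  moreover have "pds cs (pd c F) = pds (cs @ [c]) F" for cs
    by (simp add: pds_def)
  ultimately show ?thesis
    by (simp add: smooth_iff)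
qed

lemma has_field_derivative_pd:
  assumes "partially_differentiable F"
  shows "((\<lambda>s. F (p(c := s))) has_field_derivative pd c F p) (at (p c))"
  using assms unfolding pd_def partially_differentiable_def DERIV_deriv_iff_real_differentiable by blast

lemma pd_eqI: "(\<And>p. ((\<lambda>s. F (p(c := s))) has_field_derivative G p) (at (p c))) \<Longrightarrow> pd c F = G"
  unfolding pd_def by (rule ext, rule DERIV_imp_deriv)

lemma partially_differentiableI:
  "(\<And>c p. ((\<lambda>s. F (p(c := s))) has_field_derivative G c p) (at (p c))) \<Longrightarrow> partially_differentiable F"
  unfolding partially_differentiable_def real_differentiable_def by blast

lemma
  assumes "partially_differentiable F" "partially_differentiable G"
  shows pd_add_differentiable: "pd c (F + G) = pd c F + pd c G"
    and pd_mult_differentiable: "pd c (F * G) = pd c F * G + F * pd c G"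
    and partially_differentiable_add: "partially_differentiable (F + G)"
    and partially_differentiable_mult: "partially_differentiable (F * G)"
proof -
  note F = has_field_derivative_pd[OF assms(1)] and G = has_field_derivative_pd[OF assms(2)]
  have add: "((\<lambda>s. (F + G) (p(c := s))) has_field_derivative (pd c F + pd c G) p) (at (p c))" for c p
    using DERIV_add[OF F[of p c] G[of p c]] by (simp only: plus_fun_apply)
  have mult: "((\<lambda>s. (F * G) (p(c := s))) has_field_derivative (pd c F * G + F * pd c G) p) (at (p c))" for c p
    using DERIV_mult[OF F[of p c] G[of p c]]
    by (simp only: plus_fun_apply times_fun_apply fun_upd_triv mult.commute add.commute)
  show "pd c (F + G) = pd c F + pd c G" "pd c (F * G) = pd c F * G + F * pd c G"
    by (rule pd_eqI, rule add, rule pd_eqI, rule mult)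
  show "partially_differentiable (F + G)"
    by (rule partially_differentiableI, rule add)
  show "partially_differentiable (F * G)"
    by (rule partially_differentiableI, rule mult)
qed

text \<open>A class for \<open>smooth_coinduct\<close>: the derivative of a product is again a sum
  of products of members, because the derivatives of the factors are members by induction.\<close>

inductive smooth_algebra :: "(('c \<Rightarrow> real) \<Rightarrow> real) \<Rightarrow> bool" where
  base: "smooth F \<Longrightarrow> smooth_algebra F"
| add: "smooth_algebra F \<Longrightarrow> smooth_algebra G \<Longrightarrow> smooth_algebra (F + G)"
| mult: "smooth_algebra F \<Longrightarrow> smooth_algebra G \<Longrightarrow> smooth_algebra (F * G)"

lemma smooth_algebra_smooth:
  assumes "smooth_algebra F"
  shows "smooth F"
proof (rule smooth_coinduct)
  show "F \<in> Collect smooth_algebra"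
    using assms by simp
  have *: "continuous_on UNIV F \<and> partially_differentiable F \<and> (\<forall>c. smooth_algebra (pd c F))"
    if "smooth_algebra F" for F :: "('c \<Rightarrow> real) \<Rightarrow> real"
    using that
  proof induction
    case (base F)
    then show ?case
      by (simp add: smooth_continuous smooth_partially_differentiable smooth_pd smooth_algebra.base)
  next
    case (add F G)
    then have "continuous_on UNIV (F + G)"
      unfolding plus_fun_def by (intro continuous_on_add) auto
    moreover have "pd c (F + G) = pd c F + pd c G" for c
      using add by (intro pd_add_differentiable) auto
    ultimately show ?case
      using add by (metis partially_differentiable_add smooth_algebra.add)
  next
    case (mult F G)
    then have "continuous_on UNIV (F * G)"
      unfolding times_fun_def by (intro continuous_on_mult) auto
    moreover have "pd c (F * G) = pd c F * G + F * pd c G" for c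
      using mult by (intro pd_mult_differentiable) auto
    ultimately show ?case
      using mult by (metis partially_differentiable_mult smooth_algebra.add smooth_algebra.mult)
  qed
  fix F :: "('c \<Rightarrow> real) \<Rightarrow> real" and c
  assume "F \<in> Collect smooth_algebra"
  then show "continuous_on UNIV F" "partially_differentiable F" "pd c F \<in> Collect smooth_algebra"
    using * by blast+
qed

lemma smooth_add: "smooth F \<Longrightarrow> smooth G \<Longrightarrow> smooth (F + G)"
  and smooth_mult: "smooth F \<Longrightarrow> smooth G \<Longrightarrow> smooth (F * G)"
  by (auto intro: smooth_algebra_smooth smooth_algebra.intros)

lemma pd_const: "pd c (\<lambda>_. x) = 0"
  by (simp add: pd_def fun_eq_iff)

lemma partially_differentiable_const: "partially_differentiable (\<lambda>_. x)"
  by (simp add: partially_differentiable_def)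

lemma smooth_const: "smooth (\<lambda>_. x)"
proof (rule smooth_coinduct)
  show "(\<lambda>_. x) \<in> range (\<lambda>x _. x)" by simp
qed (auto simp: pd_const zero_fun_def partially_differentiable_const)

lemma coordf_has_field_derivative:
  "((\<lambda>s. coordf d (p(c := s))) has_field_derivative of_bool (c = d)) (at (p c))"
  by (cases "c = d") (simp_all add: coordf_def)

lemma pd_coordf: "pd c (coordf d) = (\<lambda>_. of_bool (c = d))"
  by (rule pd_eqI, rule coordf_has_field_derivative)

lemma smooth_coordf: "smooth (coordf d)"
proof (rule smooth_coinduct)
  \<comment> \<open>The derivatives of a coordinate are constants, so adjoining the constants closes
    the class.\<close>
  show "coordf d \<in> insert (coordf d) (range (\<lambda>x _. x))" by simp
  have *: "partially_differentiable (coordf d)"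
    by (rule partially_differentiableI, rule coordf_has_field_derivative)
  have **: "continuous_on UNIV (coordf d)"
    unfolding coordf_def by simp
  fix F :: "'a local_fn" and c
  assume F: "F \<in> insert (coordf d) (range (\<lambda>x _. x))"
  show "continuous_on UNIV F" "partially_differentiable F"
    using F * ** by (auto simp: partially_differentiable_const)
  show "pd c F \<in> insert (coordf d) (range (\<lambda>x _. x))"
    using F by (auto simp: pd_coordf pd_const zero_fun_def)
qed

section \<open>Locality: smooth dependence on finitely many coordinates\<close>

lemma depends_on_mono: "depends_on C F \<Longrightarrow> C \<subseteq> D \<Longrightarrow> depends_on D F"
  unfolding depends_on_def by blast

lemma depends_on_pd:
  assumes "depends_on D F"
  shows "depends_on D (pd c F)"
  unfolding depends_on_def
proof (intro allI impI)
  fix p q :: "'a \<Rightarrow> real"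
  assume pq: "\<forall>c\<in>D. p c = q c"
  show "pd c F p = pd c F q"
  proof (cases "c \<in> D")
    case True
    with pq have "(\<lambda>s. F (p(c := s))) = (\<lambda>s. F (q(c := s)))" "p c = q c"
      using assms by (auto simp: depends_on_def)
    then show ?thesis by (simp add: pd_def)
  next
    case False
    then have "F (r(c := s)) = F r" for r s
      using assms unfolding depends_on_def by (metis fun_upd_apply)
    then show ?thesis by (simp add: pd_def)
  qed
qed

lemma pd_not_depends:
  assumes "depends_on D F" "c \<notin> D"
  shows "pd c F = 0"
proof -
  have "F (r(c := s)) = F r" for r s
    using assms unfolding depends_on_def by (metis fun_upd_apply)
  then show ?thesis by (simp add: pd_def fun_eq_iff)
qed

lemma local_in_mono: "local_in C F \<Longrightarrow> C \<subseteq> D \<Longrightarrow> local_in D F"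
  unfolding local_in_def by blast

lemma local_in_UNIV: "local_in D F \<Longrightarrow> local_in UNIV F"
  by (erule local_in_mono) simp

lemma local_in_smooth: "local_in D F \<Longrightarrow> smooth F"
  unfolding local_in_def by blast

lemma local_in_depends_on: "local_in D F \<Longrightarrow> depends_on D F"
  unfolding local_in_def using depends_on_mono by blast

lemma local_in_const: "local_in D (\<lambda>_. x)"
  unfolding local_in_def by (auto simp: smooth_const depends_on_def intro!: exI[of _ "{}"])

lemma local_in_0: "local_in D 0" and local_in_1: "local_in D 1"
  using local_in_const[of D 0] local_in_const[of D 1] by (simp_all add: zero_fun_def one_fun_def)

lemma local_in_coordf: "c \<in> D \<Longrightarrow> local_in D (coordf c)"
  unfolding local_in_def by (auto intro: smooth_coordf intro!: exI[of _ "{c}"])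
    (simp add: depends_on_def coordf_def)

lemma
  assumes "local_in D F" "local_in D G"
  shows local_in_add: "local_in D (F + G)" and local_in_mult: "local_in D (F * G)"
proof -
  from assms obtain A B where "A \<subseteq> D" "finite A" "depends_on A F" "B \<subseteq> D" "finite B" "depends_on B G"
    unfolding local_in_def by blast
  then have "A \<union> B \<subseteq> D" "finite (A \<union> B)" "depends_on (A \<union> B) F" "depends_on (A \<union> B) G"
    by (auto intro: depends_on_mono)
  moreover from this have "depends_on (A \<union> B) (F + G)" "depends_on (A \<union> B) (F * G)"
    unfolding depends_on_def plus_fun_apply times_fun_apply by metis+
  ultimately show "local_in D (F + G)" "local_in D (F * G)"
    unfolding local_in_def using assms[THEN local_in_smooth] smooth_add smooth_mult by blast+
qed

lemma local_in_uminus: "local_in D F \<Longrightarrow> local_in D (- F)"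
  using local_in_mult[OF local_in_const[of D "-1"], of F] by (simp add: times_fun_def fun_Compl_def)

lemma local_in_diff: "local_in D F \<Longrightarrow> local_in D G \<Longrightarrow> local_in D (F - G)"
  using local_in_add[OF _ local_in_uminus] by (metis add_uminus_conv_diff)

lemma local_in_sum: "(\<And>a. a \<in> A \<Longrightarrow> local_in D (F a)) \<Longrightarrow> local_in D (\<Sum>a\<in>A. F a)"
  by (induction A rule: infinite_finite_induct) (auto intro: local_in_0 local_in_add)

lemma local_in_Sum_any: "(\<And>a. local_in D (F a)) \<Longrightarrow> local_in D (Sum_any F)"
  by (auto simp: Sum_any.expand_set intro: local_in_sum)

lemma local_in_pd: "local_in D F \<Longrightarrow> local_in D (pd c F)"
  unfolding local_in_def by (auto simp: smooth_pd intro: depends_on_pd)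

lemmas local_in_intros = local_in_const local_in_0 local_in_1 local_in_add local_in_mult
  local_in_uminus local_in_diff local_in_sum local_in_pd

lemma
  assumes "smooth F" "smooth G"
  shows pd_add: "pd c (F + G) = pd c F + pd c G"
    and pd_mult: "pd c (F * G) = pd c F * G + F * pd c G"
  by (intro pd_add_differentiable pd_mult_differentiable smooth_partially_differentiable assms)+

section \<open>Total derivatives of functions\<close>

lemma finite_pd_support:
  assumes "local_in D F"
  shows "finite {c. pd c F \<noteq> 0}"
proof -
  from assms obtain A where "finite A" "depends_on A F"
    unfolding local_in_def by blast
  have "{c. pd c F \<noteq> 0} \<subseteq> A"
    using pd_not_depends[OF \<open>depends_on A F\<close>] by (auto intro: ccontr)
  with \<open>finite A\<close> show ?thesis
    by (rule rev_finite_subset)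
qed

lemma finite_pd_U_support:
  assumes "local_in D F"
  shows "finite {(i, M). pd (U i M) F \<noteq> 0}"
proof -
  have "finite ((\<lambda>(i, M). U i M) -` {c. pd c F \<noteq> 0})"
    by (rule finite_vimageI[OF finite_pd_support[OF assms]]) (auto simp: inj_on_def)
  then show ?thesis
    by (rule rev_finite_subset) auto
qed

text \<open>The index set may be larger than the support: functions that are added or multiplied can
  then be expanded over one common set.\<close>

lemma td_eq_sum:
  assumes "finite A" "{(i, M). pd (U i M) F \<noteq> 0} \<subseteq> A"
  shows "td \<nu> F = pd (X \<nu>) F + (\<Sum>(i, M)\<in>A. coordf (U i (add_mset \<nu> M)) * pd (U i M) F)"
proof -
  have "pd (U i M) F = 0" if "(i, M) \<notin> A" for i M
    using assms(2) that by blast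
  then have "(\<lambda>(i, M). coordf (U i (add_mset \<nu> M)) * pd (U i M) F) x = 0" if "x \<notin> A" for x
    using that by (cases x) simp
  then have "{x. (\<lambda>(i, M). coordf (U i (add_mset \<nu> M)) * pd (U i M) F) x \<noteq> 0} \<subseteq> A"
    by blast
  from Sum_any.expand_superset[OF assms(1) this] show ?thesis
    unfolding td_def by simp
qed

lemma
  assumes "local_in UNIV F" "local_in UNIV G"
  shows td_add: "td \<nu> (F + G) = td \<nu> F + td \<nu> G"
    and td_mult: "td \<nu> (F * G) = td \<nu> F * G + F * td \<nu> G"
proof -
  let ?A = "{(i, M). pd (U i M) F \<noteq> 0} \<union> {(i, M). pd (U i M) G \<noteq> 0}"
  have A: "finite ?A"
    using assms finite_pd_U_support by blast
  note sm = assms[THEN local_in_smooth]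
  have F: "td \<nu> F = pd (X \<nu>) F + (\<Sum>(i, M)\<in>?A. coordf (U i (add_mset \<nu> M)) * pd (U i M) F)"
    and G: "td \<nu> G = pd (X \<nu>) G + (\<Sum>(i, M)\<in>?A. coordf (U i (add_mset \<nu> M)) * pd (U i M) G)"
    by (rule td_eq_sum[OF A]; auto)+
  have subset: "{(i, M). pd (U i M) (F + G) \<noteq> 0} \<subseteq> ?A" "{(i, M). pd (U i M) (F * G) \<noteq> 0} \<subseteq> ?A"
    unfolding pd_add[OF sm] pd_mult[OF sm] by auto
  have add: "td \<nu> (F + G) = pd (X \<nu>) (F + G) +
      (\<Sum>(i, M)\<in>?A. coordf (U i (add_mset \<nu> M)) * pd (U i M) (F + G))"
    and mult: "td \<nu> (F * G) = pd (X \<nu>) (F * G) +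
      (\<Sum>(i, M)\<in>?A. coordf (U i (add_mset \<nu> M)) * pd (U i M) (F * G))"
    by (rule td_eq_sum[OF A], rule subset)+
  show "td \<nu> (F + G) = td \<nu> F + td \<nu> G"
    unfolding F G add
    by (simp add: pd_add[OF sm] ring_distribs sum.distrib case_prod_unfold)
  show "td \<nu> (F * G) = td \<nu> F * G + F * td \<nu> G"
    unfolding F G mult pd_mult[OF sm] distrib_left distrib_right sum_distrib_left sum_distrib_right
    by (simp add: distrib_left sum.distrib case_prod_unfold mult_ac add_ac)
qed

lemma td_const: "td \<nu> (\<lambda>_. x) = 0"
  by (simp add: td_def pd_const case_prod_unfold)

lemma td_0: "td \<nu> 0 = 0"
  using td_const[of \<nu> 0] by (simp add: zero_fun_def)

lemma td_1: "td \<nu> 1 = 0"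
  using td_const[of \<nu> 1] by (simp add: one_fun_def)

lemma td_cmult: "local_in UNIV F \<Longrightarrow> td \<nu> ((\<lambda>_. x) * F) = (\<lambda>_. x) * td \<nu> F"
  by (simp add: td_mult local_in_const td_const)

lemma td_sum: "(\<And>a. a \<in> A \<Longrightarrow> local_in UNIV (F a)) \<Longrightarrow> td \<nu> (\<Sum>a\<in>A. F a) = (\<Sum>a\<in>A. td \<nu> (F a))"
  by (induction A rule: infinite_finite_induct) (auto simp: td_0 td_add local_in_sum)

lemma td_coordf: "td \<nu> (coordf (U i M)) = coordf (U i (add_mset \<nu> M))"
proof -
  have "td \<nu> (coordf (U i M)) = (\<Sum>(j, N)\<in>{(i, M)}. coordf (U j (add_mset \<nu> N)) * (\<lambda>_. 1))"
    by (subst td_eq_sum[of "{(i, M)}"]) (auto simp: pd_coordf zero_fun_def fun_eq_iff)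
  then show ?thesis by (simp add: times_fun_def)
qed

text \<open>Coordinate sets that are stable under total derivatives in the directions
  \<open>A\<close>. Keeping \<open>A\<close> explicit records that spatial derivatives create no
  time derivatives, on which the separation of the velocities rests.\<close>

definition prolonged :: "nat set \<Rightarrow> 'i coord set \<Rightarrow> bool" where
  "prolonged A D \<longleftrightarrow> (\<forall>\<nu>\<in>A. \<forall>i M. U i M \<in> D \<longrightarrow> U i (add_mset \<nu> M) \<in> D)"

lemma prolonged_UNIV: "prolonged A UNIV"
  by (simp add: prolonged_def)

lemma prolonged_jet_coords: "prolonged A (jet_coords n I A)"
  by (auto simp: prolonged_def jet_coords_def)

lemma local_in_td:
  assumes "local_in D F" "prolonged A D" "\<nu> \<in> A"
  shows "local_in D (td \<nu> F)"
proof -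
  have "local_in D (coordf (U i (add_mset \<nu> M)) * pd (U i M) F)" for i M
  proof (cases "U i M \<in> D")
    case True
    with assms show ?thesis
      by (intro local_in_intros local_in_coordf) (auto simp: prolonged_def)
  next
    case False
    then have "pd (U i M) F = 0"
      using pd_not_depends[OF local_in_depends_on[OF assms(1)]] by simp
    then show ?thesis by (simp add: local_in_0)
  qed
  then show ?thesis
    unfolding td_def by (intro local_in_intros assms local_in_Sum_any) (auto split: prod.split)
qed

lemma local_in_UNIV_td: "local_in UNIV F \<Longrightarrow> local_in UNIV (td \<nu> F)"
  by (rule local_in_td[OF _ prolonged_UNIV[of UNIV]]) auto

lemma local_in_tds:
  assumes "local_in D F" "prolonged A D" "\<nu>s \<in> lists A"
  shows "local_in D (tds \<nu>s F)"
  using assms(3) by (induction \<nu>s) (auto simp: tds_def assms intro: local_in_td[of _ _ A])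

lemma local_in_UNIV_tds: "local_in UNIV F \<Longrightarrow> local_in UNIV (tds \<nu>s F)"
  by (rule local_in_tds[OF _ prolonged_UNIV[of UNIV]]) auto

lemma tds_Nil: "tds [] F = F" and tds_Cons: "tds (\<nu> # \<nu>s) F = td \<nu> (tds \<nu>s F)"
  by (simp_all add: tds_def)

lemma tds_0: "tds \<nu>s 0 = 0"
proof (induction \<nu>s)
  case (Cons \<nu> \<nu>s)
  show ?case
    unfolding tds_Cons Cons td_0 ..
qed (rule tds_Nil)

lemma tds_cmult: "local_in UNIV F \<Longrightarrow> tds \<nu>s ((\<lambda>_. x) * F) = (\<lambda>_. x) * tds \<nu>s F"
  by (induction \<nu>s) (auto simp: tds_Nil tds_Cons td_cmult local_in_UNIV_tds)

lemma tds_coordf: "tds \<nu>s (coordf (U i M)) = coordf (U i (M + mset \<nu>s))"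
  by (induction \<nu>s) (auto simp: tds_Nil tds_Cons td_coordf)

lemma local_in_pS: "local_in D F \<Longrightarrow> local_in D (pS i \<mu>s F)"
  by (auto simp: pS_def intro: local_in_intros)

lemma pd_cmult: "smooth F \<Longrightarrow> pd c ((\<lambda>_. x) * F) = (\<lambda>_. x) * pd c F"
  by (simp add: pd_mult smooth_const pd_const)

lemma pS_cmult: "local_in UNIV F \<Longrightarrow> pS i \<mu>s ((\<lambda>_. x) * F) = (\<lambda>_. x) * pS i \<mu>s F"
  unfolding pS_def by (subst pd_cmult) (auto intro: local_in_smooth mult.left_commute)

section \<open>Total derivatives of forms and binomial transforms\<close>

text \<open>
  Resolution eta-expands function-valued terms; with these rules the simplifier would then move the
  pointwise operations inside the abstraction.
\<close>

declare plus_fun_apply [simp del] zero_fun_apply [simp del] times_fun_apply [simp del]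
  one_fun_apply [simp del] uminus_apply [simp del] minus_apply [simp del]

lemmas fun_apply = plus_fun_apply zero_fun_apply times_fun_apply one_fun_apply uminus_apply minus_apply

section \<open>Forms with local coefficients and their total derivatives\<close>

definition local_form :: "'i form \<Rightarrow> bool" where
  "local_form w \<longleftrightarrow> (\<forall>gs. local_in UNIV (w gs))"

lemma local_formD: "local_form w \<Longrightarrow> local_in UNIV (w gs)"
  by (simp add: local_form_def)

lemma local_form_0: "local_form 0"
  by (simp add: local_form_def fun_apply local_in_0)

lemma local_form_add: "local_form v \<Longrightarrow> local_form w \<Longrightarrow> local_form (v + w)"
  by (simp add: local_form_def fun_apply local_in_add)

lemma local_form_sum: "(\<And>a. a \<in> A \<Longrightarrow> local_form (f a)) \<Longrightarrow> local_form (\<Sum>a\<in>A. f a)"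
  by (induction A rule: infinite_finite_induct) (simp_all add: local_form_0 local_form_add)

lemma local_form_fscale: "local_in UNIV F \<Longrightarrow> local_form w \<Longrightarrow> local_form (fscale F w)"
  unfolding local_form_def fscale_def by (blast intro: local_in_mult)

lemma local_form_zero_form: "local_in UNIV F \<Longrightarrow> local_form (zero_form F)"
  by (simp add: local_form_def zero_form_def local_in_0)

lemma local_form_gen_form: "local_form (gen_form g)"
  by (simp add: local_form_def gen_form_def local_in_0 local_in_1)

lemma local_form_ftd:
  assumes "local_form w"
  shows "local_form (ftd \<nu> w)"
  unfolding local_form_def ftd_def
proof (intro allI local_in_add local_in_sum local_in_UNIV_td local_formD[OF assms])
  fix gs k
  show "local_in UNIV (case gs ! k of Dx \<mu> \<Rightarrow> 0
     | DV i M \<Rightarrow> if \<nu> \<in># M then w (gs[k := DV i (M - {#\<nu>#})]) else 0)"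
    by (cases "gs ! k") (simp_all add: local_in_0 local_formD[OF assms])
qed

lemma ftds_Nil: "ftds [] w = w" and ftds_Cons: "ftds (\<nu> # \<nu>s) w = ftd \<nu> (ftds \<nu>s w)"
  by (simp_all add: ftds_def)

lemma local_form_ftds: "local_form w \<Longrightarrow> local_form (ftds \<nu>s w)"
  by (induction \<nu>s) (simp_all add: ftds_Nil ftds_Cons local_form_ftd)

lemma ftd_0: "ftd \<nu> 0 = 0"
proof
  fix gs
  have "(\<Sum>k<length gs. case gs ! k of Dx \<mu> \<Rightarrow> 0
     | DV i M \<Rightarrow> if \<nu> \<in># M then (0 :: 'a form) (gs[k := DV i (M - {#\<nu>#})]) else 0) = 0"
    by (intro sum.neutral ballI) (simp split: gen.split add: fun_apply)
  then show "ftd \<nu> (0 :: 'a form) gs = (0 :: 'a form) gs"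
    by (simp only: ftd_def zero_fun_apply td_0 add_0)
qed

lemma ftd_add:
  assumes "local_form v" "local_form w"
  shows "ftd \<nu> (v + w) = ftd \<nu> v + ftd \<nu> w"
proof
  fix gs
  define d where "d u k = (case gs ! k of Dx \<mu> \<Rightarrow> 0
     | DV i M \<Rightarrow> if \<nu> \<in># M then u (gs[k := DV i (M - {#\<nu>#})]) else 0)" for u :: "'a form" and k
  have "d (v + w) k = d v k + d w k" for k
    unfolding d_def by (cases "gs ! k") (simp_all add: fun_apply)
  then have "(\<Sum>k<length gs. d (v + w) k) = (\<Sum>k<length gs. d v k) + (\<Sum>k<length gs. d w k)"
    by (simp only: sum.distrib)
  moreover have "ftd \<nu> u gs = td \<nu> (u gs) + (\<Sum>k<length gs. d u k)" for u
    unfolding ftd_def d_def ..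
  moreover have "td \<nu> ((v + w) gs) = td \<nu> (v gs) + td \<nu> (w gs)"
    using td_add[OF assms[THEN local_formD]] by (simp only: plus_fun_apply)
  ultimately show "ftd \<nu> (v + w) gs = (ftd \<nu> v + ftd \<nu> w) gs"
    by (simp only: plus_fun_apply add_ac)
qed

lemma ftd_fscale:
  assumes "local_in UNIV F" "local_form w"
  shows "ftd \<nu> (fscale F w) = fscale (td \<nu> F) w + fscale F (ftd \<nu> w)"
proof
  fix gs
  \<comment> \<open>The action of \<open>ftd\<close> on the generators. It is linear over functions,
    so the term with \<open>td \<nu> F\<close> comes from the coefficients alone.\<close>
  define d where "d u k = (case gs ! k of Dx \<mu> \<Rightarrow> 0
     | DV i M \<Rightarrow> if \<nu> \<in># M then u (gs[k := DV i (M - {#\<nu>#})]) else 0)" for u :: "'a form" and k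
  have "d (fscale F w) k = F * d w k" for k
    unfolding d_def fscale_def by (cases "gs ! k") simp_all
  then have "(\<Sum>k<length gs. d (fscale F w) k) = F * (\<Sum>k<length gs. d w k)"
    by (simp only: sum_distrib_left)
  moreover have "ftd \<nu> u gs = td \<nu> (u gs) + (\<Sum>k<length gs. d u k)" for u
    unfolding ftd_def d_def ..
  moreover have "td \<nu> (fscale F w gs) = td \<nu> F * w gs + F * td \<nu> (w gs)"
    unfolding fscale_def by (intro td_mult local_formD assms)
  ultimately show "ftd \<nu> (fscale F w) gs = (fscale (td \<nu> F) w + fscale F (ftd \<nu> w)) gs"
    by (simp only: fscale_def plus_fun_apply distrib_left add_ac)
qed

lemma fscale_0_left: "fscale 0 w = 0" and fscale_0_right: "fscale F 0 = 0"
  and fscale_1: "fscale 1 w = w"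
  by (simp_all add: fscale_def fun_eq_iff fun_apply)

lemma fscale_add_left: "fscale (F + G) w = fscale F w + fscale G w"
  and fscale_add_right: "fscale F (v + w) = fscale F v + fscale F w"
  and fscale_fscale: "fscale F (fscale G w) = fscale (F * G) w"
  by (simp_all add: fscale_def fun_eq_iff fun_apply algebra_simps)

lemma fscale_sum_left: "fscale (\<Sum>a\<in>A. f a) w = (\<Sum>a\<in>A. fscale (f a) w)"
  by (induction A rule: infinite_finite_induct) (simp_all add: fscale_0_left fscale_add_left)

lemma fscale_sum_right: "fscale F (\<Sum>a\<in>A. f a) = (\<Sum>a\<in>A. fscale F (f a))"
  by (induction A rule: infinite_finite_induct) (simp_all add: fscale_0_right fscale_add_right)

lemma fscale_const_0: "fscale (\<lambda>_. 0) w = 0"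
  using fscale_0_left[of w] by (simp only: zero_fun_def)

lemma fscale_const_add: "fscale (\<lambda>_. x + y) w = fscale (\<lambda>_. x) w + fscale (\<lambda>_. y) w"
  using fscale_add_left[of "\<lambda>_. x" "\<lambda>_. y" w] by (simp only: plus_fun_def)

lemma ftd_cscale: "local_form w \<Longrightarrow> ftd \<nu> (fscale (\<lambda>_. c) w) = fscale (\<lambda>_. c) (ftd \<nu> w)"
  by (simp add: ftd_fscale local_in_const td_const fscale_0_left)

lemma ftd_sum: "(\<And>a. a \<in> A \<Longrightarrow> local_form (f a)) \<Longrightarrow> ftd \<nu> (\<Sum>a\<in>A. f a) = (\<Sum>a\<in>A. ftd \<nu> (f a))"
  by (induction A rule: infinite_finite_induct) (simp_all add: ftd_0 ftd_add local_form_sum)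

lemma ftds_0: "ftds \<nu>s 0 = 0"
  by (induction \<nu>s) (simp_all add: ftds_Nil ftds_Cons ftd_0)

lemma ftds_add: "local_form v \<Longrightarrow> local_form w \<Longrightarrow> ftds \<nu>s (v + w) = ftds \<nu>s v + ftds \<nu>s w"
  by (induction \<nu>s) (simp_all add: ftds_Nil ftds_Cons ftd_add local_form_ftds)

lemma ftds_cscale: "local_form w \<Longrightarrow> ftds \<nu>s (fscale (\<lambda>_. c) w) = fscale (\<lambda>_. c) (ftds \<nu>s w)"
  by (induction \<nu>s) (simp_all add: ftds_Nil ftds_Cons ftd_cscale local_form_ftds)

lemma ftds_sum: "(\<And>a. a \<in> A \<Longrightarrow> local_form (f a)) \<Longrightarrow> ftds \<nu>s (\<Sum>a\<in>A. f a) = (\<Sum>a\<in>A. ftds \<nu>s (f a))"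
  by (induction A rule: infinite_finite_induct) (simp_all add: ftds_0 ftds_add local_form_sum)

lemma ftd_zero_form: "ftd \<nu> (zero_form F) = zero_form (td \<nu> F)"
proof
  fix gs :: "'a gen list"
  show "ftd \<nu> (zero_form F) gs = zero_form (td \<nu> F) gs"
  proof (cases "gs = []")
    case False
    then have "(\<Sum>k<length gs. case gs ! k of Dx \<mu> \<Rightarrow> 0
       | DV i M \<Rightarrow> if \<nu> \<in># M then zero_form F (gs[k := DV i (M - {#\<nu>#})]) else 0) = 0"
      by (intro sum.neutral ballI) (simp split: gen.split add: zero_form_def)
    with False show ?thesis
      unfolding ftd_def by (simp add: zero_form_def td_0)
  qed (simp add: ftd_def zero_form_def)
qed

lemma ftds_zero_form: "ftds \<nu>s (zero_form F) = zero_form (tds \<nu>s F)"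
  by (induction \<nu>s) (simp_all add: ftds_Nil ftds_Cons tds_Nil tds_Cons ftd_zero_form)

lemma ftd_gen_form: "ftd \<nu> (gen_form (DV i M)) = gen_form (DV i (add_mset \<nu> M))"
proof
  fix gs :: "'a gen list"
  have td: "td \<nu> (gen_form (DV i M) gs) = 0"
    by (simp add: gen_form_def td_0 td_1)
  show "ftd \<nu> (gen_form (DV i M)) gs = gen_form (DV i (add_mset \<nu> M)) gs"
  proof (cases "\<exists>g. gs = [g]")
    case True
    then obtain g where g: "gs = [g]" by blast
    define d where "d k = (case gs ! k of Dx \<mu> \<Rightarrow> 0
       | DV j N \<Rightarrow> if \<nu> \<in># N then gen_form (DV i M) (gs[k := DV j (N - {#\<nu>#})]) else 0)" for k
    have "ftd \<nu> (gen_form (DV i M)) gs = (\<Sum>k<length gs. d k)"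
      unfolding ftd_def td d_def by simp
    also have "\<dots> = d 0"
      by (simp add: g)
    also have "\<dots> = gen_form (DV i (add_mset \<nu> M)) gs"
      unfolding d_def g by (cases g) (auto simp: gen_form_def)
    finally show ?thesis .
  next
    case False
    then have "gs[k := h] \<noteq> [g]" for k h g
      by (metis length_Suc_conv length_list_update list.size(3) length_0_conv)
    then have "(\<Sum>k<length gs. case gs ! k of Dx \<mu> \<Rightarrow> 0
       | DV j N \<Rightarrow> if \<nu> \<in># N then gen_form (DV i M) (gs[k := DV j (N - {#\<nu>#})]) else 0) = 0"
      by (intro sum.neutral ballI) (simp split: gen.split add: gen_form_def)
    with False show ?thesis
      unfolding ftd_def td by (simp add: gen_form_def)
  qed
qed

lemma ftds_gen_form: "ftds \<nu>s (gen_form (DV i M)) = gen_form (DV i (M + mset \<nu>s))"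
  by (induction \<nu>s) (simp_all add: ftds_Nil ftds_Cons ftd_gen_form)

section \<open>Sums over tuples and binomial transforms\<close>

definition words :: "nat set \<Rightarrow> nat \<Rightarrow> nat list set" where
  "words A m = {xs. set xs \<subseteq> A \<and> length xs = m}"

lemma finite_words: "finite A \<Longrightarrow> finite (words A m)"
  unfolding words_def by (rule finite_lists_length_eq)

lemma words_0: "words A 0 = {[]}"
  by (auto simp: words_def)

lemma sum_words_Suc: "(\<Sum>xs\<in>words A (Suc m). f xs) = (\<Sum>i\<in>A. \<Sum>xs\<in>words A m. f (i # xs))"
proof -
  have "(\<Sum>i\<in>A. \<Sum>xs\<in>words A m. f (i # xs)) = (\<Sum>(i, xs)\<in>A \<times> words A m. f (i # xs))"
    by (rule sum.cartesian_product)
  also have "\<dots> = (\<Sum>xs\<in>words A (Suc m). f xs)"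
    by (rule sum.reindex_bij_witness[of _ "\<lambda>xs. (hd xs, tl xs)" "\<lambda>(i, xs). i # xs"])
      (auto simp: words_def length_Suc_conv)
  finally show ?thesis ..
qed

text \<open>\<open>Sum_any\<close> returns 0 when the support is infinite, so every sum over tuples
  first needs bounds on its letters and its length. \<open>A\<close> may be smaller than
  \<open>B\<close> because sums over all directions often see spatial tuples only.\<close>

lemma sum_over_words:
  assumes "finite A" "A \<subseteq> B"
    and "\<And>xs. xs \<in> lists B \<Longrightarrow> g xs \<noteq> 0 \<Longrightarrow> xs \<in> lists A \<and> length xs \<le> N"
  shows "sum_over (lists B) g = (\<Sum>m\<le>N. \<Sum>xs\<in>words A m. g xs)"
proof -
  have "sum_over (lists B) g = (\<Sum>xs\<in>(\<Union>m\<le>N. words A m). if xs \<in> lists B then g xs else 0)"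
  proof (rule Sum_any.expand_superset)
    show "finite (\<Union>m\<le>N. words A m)"
      using finite_words[OF assms(1)] by blast
    show "{xs. (if xs \<in> lists B then g xs else 0) \<noteq> 0} \<subseteq> (\<Union>m\<le>N. words A m)"
      using assms(3) by (auto simp: words_def split: if_splits)
  qed
  also have "\<dots> = (\<Sum>xs\<in>(\<Union>m\<le>N. words A m). g xs)"
    using assms(2) by (intro sum.cong) (auto simp: words_def)
  also have "\<dots> = (\<Sum>m\<le>N. \<Sum>xs\<in>words A m. g xs)"
    by (rule sum.UNION_disjoint) (auto simp: finite_words assms(1), auto simp: words_def)
  finally show ?thesis .
qed

text \<open>A divergence on families indexed by tuples. Its powers yield the sums of total
  derivatives over all tuples of a given length that occur in Euler-Lagrange derivatives.\<close>

definition nabla :: "nat set \<Rightarrow> (nat list \<Rightarrow> 'i local_fn) \<Rightarrow> nat list \<Rightarrow> 'i local_fn" where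
  "nabla A P ks = (\<Sum>i\<in>A. td i (P (ks @ [i])))"

definition locals :: "(nat list \<Rightarrow> 'i local_fn) \<Rightarrow> bool" where
  "locals P \<longleftrightarrow> (\<forall>ks. local_in UNIV (P ks))"

definition symmetric_on_words :: "(nat list \<Rightarrow> 'x) \<Rightarrow> bool" where
  "symmetric_on_words P \<longleftrightarrow> (\<forall>xs ys. mset xs = mset ys \<longrightarrow> P xs = P ys)"

definition vanishes_beyond :: "nat \<Rightarrow> (nat list \<Rightarrow> 'x::zero) \<Rightarrow> bool" where
  "vanishes_beyond N P \<longleftrightarrow> (\<forall>xs. N < length xs \<longrightarrow> P xs = 0)"

lemma localsD: "locals P \<Longrightarrow> local_in UNIV (P ks)"
  by (simp add: locals_def)

lemma locals_nabla_power: "locals P \<Longrightarrow> locals ((nabla A ^^ l) P)"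
  by (induction l) (auto simp: locals_def nabla_def intro!: local_in_sum local_in_UNIV_td)

lemma nabla_power:
  assumes "locals P"
  shows "(nabla A ^^ l) P ks = (\<Sum>ls\<in>words A l. tds ls (P (ks @ ls)))"
proof (induction l arbitrary: ks)
  case 0
  then show ?case by (simp add: words_0 tds_Nil)
next
  case (Suc l)
  have "(nabla A ^^ Suc l) P ks = (\<Sum>i\<in>A. td i (\<Sum>ls\<in>words A l. tds ls (P ((ks @ [i]) @ ls))))"
    by (simp only: funpow.simps comp_def nabla_def[of A "(nabla A ^^ l) _"] Suc)
  also have "\<dots> = (\<Sum>i\<in>A. \<Sum>ls\<in>words A l. tds (i # ls) (P (ks @ i # ls)))"
    by (intro sum.cong refl, subst td_sum)
      (simp_all add: tds_Cons local_in_UNIV_tds localsD[OF assms])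
  finally show ?case
    by (simp only: sum_words_Suc)
qed

text \<open>After \<open>l\<close> steps the family is evaluated only at tuples of length
  \<open>length ks + l\<close>, where the weight is one constant.\<close>

lemma nabla_power_weighted:
  assumes "locals P"
  shows "(nabla A ^^ l) (\<lambda>ks. (\<lambda>_. c (length ks)) * P ks) ks =
    (\<lambda>_. c (length ks + l)) * (nabla A ^^ l) P ks"
proof -
  have loc: "locals (\<lambda>ks. (\<lambda>_. c (length ks)) * P ks)"
    using assms by (auto simp: locals_def intro: local_in_mult local_in_const)
  show ?thesis
    unfolding nabla_power[OF assms] nabla_power[OF loc] sum_distrib_left
    by (intro sum.cong refl) (simp add: tds_cmult localsD[OF assms] words_def)
qed

lemma nabla_power_sum:
  assumes "\<And>r. r \<in> R \<Longrightarrow> locals (P r)"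
  shows "(nabla A ^^ l) (\<lambda>ks. \<Sum>r\<in>R. P r ks) ks = (\<Sum>r\<in>R. (nabla A ^^ l) (P r) ks)"
proof (induction l arbitrary: ks)
  case (Suc l)
  have "(nabla A ^^ Suc l) (\<lambda>ks. \<Sum>r\<in>R. P r ks) ks =
      (\<Sum>i\<in>A. td i (\<Sum>r\<in>R. (nabla A ^^ l) (P r) (ks @ [i])))"
    by (simp only: funpow.simps comp_def nabla_def[of A "(nabla A ^^ l) _"] Suc)
  also have "\<dots> = (\<Sum>i\<in>A. \<Sum>r\<in>R. td i ((nabla A ^^ l) (P r) (ks @ [i])))"
    by (intro sum.cong refl td_sum localsD locals_nabla_power assms)
  also have "\<dots> = (\<Sum>r\<in>R. (nabla A ^^ Suc l) (P r) ks)"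
    unfolding funpow.simps comp_def nabla_def[of A "(nabla A ^^ l) _"] by (rule sum.swap)
  finally show ?case .
qed simp

lemma nabla_power_vanishes:
  assumes "vanishes_beyond N P" "N < length ks + l"
  shows "(nabla A ^^ l) P ks = 0"
  using assms(2)
proof (induction l arbitrary: ks)
  case 0
  then show ?case
    using assms(1) by (simp add: vanishes_beyond_def)
next
  case (Suc l)
  then show ?case
    by (simp add: nabla_def[of A "(nabla A ^^ l) P"] td_0)
qed

lemma symmetric_nabla_power:
  assumes "symmetric_on_words P"
  shows "symmetric_on_words ((nabla A ^^ l) P)"
proof (induction l)
  case (Suc l)
  then have *: "(nabla A ^^ l) P (xs @ [i]) = (nabla A ^^ l) P (ys @ [i])" if "mset xs = mset ys" for xs ys i
    using that by (simp add: symmetric_on_words_def)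
  show ?case
    unfolding symmetric_on_words_def
  proof (intro allI impI)
    fix xs ys :: "nat list"
    assume "mset xs = mset ys"
    from *[OF this] show "(nabla A ^^ Suc l) P xs = (nabla A ^^ Suc l) P ys"
      by (simp add: nabla_def[of A "(nabla A ^^ l) P"])
  qed
qed (simp add: assms)

text \<open>\<open>nabla\<close> works on the last index, so a fixed first index goes along
  unchanged. Inductions that split off the first index rely on this.\<close>

lemma nabla_power_Cons: "(nabla A ^^ l) (\<lambda>ks. P (i # ks)) ks = (nabla A ^^ l) P (i # ks)"
  by (induction l arbitrary: ks) (simp_all add: nabla_def)

text \<open>Reorders a double sum by total order. Both the inversion of the transforms and the
  regrouping after the Leibniz rule use it, with \<open>N\<close> a bound on the jet order.\<close>

lemma sum_triangle_square:
  fixes g :: "nat \<Rightarrow> nat \<Rightarrow> 'x::comm_monoid_add"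
  assumes "\<And>k l. N < k + l \<Longrightarrow> g k l = 0"
  shows "(\<Sum>m\<le>N. \<Sum>k\<le>m. g k (m - k)) = (\<Sum>k\<le>N. \<Sum>l\<le>N. g k l)"
proof -
  have "(\<Sum>m\<le>N. \<Sum>k\<le>m. g k (m - k)) = (\<Sum>(k, l)\<in>{(k, l). k + l \<le> N}. g k l)"
    by (rule sum.triangle_reindex_eq[symmetric])
  also have "\<dots> = (\<Sum>(k, l)\<in>{..N} \<times> {..N}. g k l)"
    by (rule sum.mono_neutral_left) (auto intro!: assms)
  finally show ?thesis
    by (simp only: sum.cartesian_product)
qed

text \<open>The binomial coefficient is (k + l)! / (k! l!). Hence, after families are rescaled by
  the factorial of the tuple length, this is the exponential of \<epsilon> times
  \<open>nabla\<close>, truncated at \<open>N\<close>. With \<epsilon> = - 1 and symmetrised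
  derivatives as the family it gives the higher Euler-Lagrange derivatives.\<close>

definition binomial_sum ::
    "nat set \<Rightarrow> real \<Rightarrow> nat \<Rightarrow> (nat list \<Rightarrow> 'i local_fn) \<Rightarrow> nat list \<Rightarrow> 'i local_fn" where
  "binomial_sum A \<epsilon> N P ks = (\<Sum>l\<le>N.
     (\<lambda>_. of_nat ((length ks + l) choose length ks) * \<epsilon> ^ l) * (nabla A ^^ l) P ks)"

text \<open>Composing the two sums and collecting by m = l + r leaves (k + m choose k) times the
  binomial expansion of (\<epsilon> - \<epsilon>)^m, which kills every m except 0.\<close>

lemma binomial_sum_inverse:
  assumes "locals P" "vanishes_beyond N P"
  shows "binomial_sum A \<epsilon> N (binomial_sum A (- \<epsilon>) N P) ks = P ks"
proof
  fix p
  define k where "k = length ks"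
  define f where "f m = (nabla A ^^ m) P ks p" for m
  have f0: "f m = 0" if "N < m" for m
    using nabla_power_vanishes[OF assms(2), of ks m] that unfolding f_def by (simp add: fun_apply)
  define c where "c l r = real ((k + l) choose k) * \<epsilon> ^ l * (real ((k + l + r) choose (k + l)) * (- \<epsilon>) ^ r)" for l r
  have "(nabla A ^^ l) (binomial_sum A (- \<epsilon>) N P) ks =
      (\<Sum>r\<le>N. (\<lambda>_. of_nat ((k + l + r) choose (k + l)) * (- \<epsilon>) ^ r) * (nabla A ^^ (l + r)) P ks)" for l
  proof -
    have "locals (\<lambda>ks. (\<lambda>_. of_nat ((length ks + r) choose length ks) * (- \<epsilon>) ^ r) * (nabla A ^^ r) P ks)" for r
      using locals_nabla_power[OF assms(1), where A = A and l = r]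
      by (auto simp: locals_def intro: local_in_mult local_in_const)
    then have "(nabla A ^^ l) (binomial_sum A (- \<epsilon>) N P) ks = (\<Sum>r\<le>N. (nabla A ^^ l)
        (\<lambda>ks. (\<lambda>_. of_nat ((length ks + r) choose length ks) * (- \<epsilon>) ^ r) * (nabla A ^^ r) P ks) ks)"
      unfolding binomial_sum_def by (rule nabla_power_sum)
    also have "\<dots> = (\<Sum>r\<le>N. (\<lambda>_. of_nat ((k + l + r) choose (k + l)) * (- \<epsilon>) ^ r) *
        (nabla A ^^ (l + r)) P ks)"
      unfolding k_def
      by (simp only: nabla_power_weighted[OF locals_nabla_power[OF assms(1)],
            where c = "\<lambda>m. of_nat ((m + r) choose m) * (- \<epsilon>) ^ r" for r] funpow_add comp_def)
    finally show ?thesis .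
  qed
  then have "binomial_sum A \<epsilon> N (binomial_sum A (- \<epsilon>) N P) ks p =
      (\<Sum>l\<le>N. \<Sum>r\<le>N. c l r * f (l + r))"
    unfolding binomial_sum_def[of A \<epsilon>]
    by (simp add: sum_fun_apply fun_apply sum_distrib_left c_def f_def k_def mult_ac)
  also have "\<dots> = (\<Sum>m\<le>N. \<Sum>l\<le>m. c l (m - l) * f (l + (m - l)))"
    by (rule sum_triangle_square[symmetric]) (simp add: f0)
  also have "\<dots> = (\<Sum>m\<le>N. (real ((k + m) choose k) * f m) * (\<Sum>l\<le>m. of_nat (m choose l) * \<epsilon> ^ l * (- \<epsilon>) ^ (m - l)))"
    unfolding sum_distrib_left
  proof (intro sum.cong refl)
    fix m l :: nat
    assume "l \<in> {..m}"
    then have l: "l \<le> m" by simp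
    \<comment> \<open>Trinomial revision splits off the factor that does not depend on
      \<open>l\<close>.\<close>
    have "((k + m) choose (k + l)) * ((k + l) choose k) = ((k + m) choose k) * (m choose l)"
      using choose_mult[of k "k + l" "k + m"] l by simp
    then have "real ((k + m) choose (k + l)) * real ((k + l) choose k) = real ((k + m) choose k) * real (m choose l)"
      by (metis of_nat_mult)
    then show "c l (m - l) * f (l + (m - l)) =
        real ((k + m) choose k) * f m * (real (m choose l) * \<epsilon> ^ l * (- \<epsilon>) ^ (m - l))"
      using l by (simp add: c_def mult_ac)
  qed
  also have "\<dots> = (\<Sum>m\<le>N. (real ((k + m) choose k) * f m) * 0 ^ m)"
    by (simp flip: binomial_ring)
  also have "\<dots> = f 0"
    by (subst sum.mono_neutral_right[of _ "{0}"]) auto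
  finally show "binomial_sum A \<epsilon> N (binomial_sum A (- \<epsilon>) N P) ks p = P ks p"
    by (simp add: f_def)
qed

text \<open>Each of the \<open>m\<close> derivatives hits either the coefficient or
  \<open>w\<close>. Symmetry of \<open>Q\<close> lets the \<open>k\<close> indices that hit
  \<open>w\<close> be written in front, whence the factor m choose k.\<close>

lemma ftds_fscale_words:
  assumes "finite A" "locals Q" "symmetric_on_words Q" "local_form w"
  shows "(\<Sum>js\<in>words A m. ftds js (fscale (Q js) w)) =
    (\<Sum>k\<le>m. \<Sum>ks\<in>words A k. fscale ((\<lambda>_. of_nat (m choose k)) * (nabla A ^^ (m - k)) Q ks) (ftds ks w))"
  using assms(2,3)
proof (induction m arbitrary: Q)
  case 0
  then show ?case
    by (simp add: words_0 ftds_Nil flip: one_fun_def)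
next
  case (Suc m)
  define B where "B k l = (\<Sum>ks\<in>words A k. fscale ((nabla A ^^ l) Q ks) (ftds ks w))" for k l
  have loc: "locals (\<lambda>ks. Q (i # ks))" for i
    using Suc.prems(1) by (simp add: locals_def)
  have sym: "symmetric_on_words (\<lambda>ks. Q (i # ks))" for i
    using Suc.prems(2) by (simp add: symmetric_on_words_def)
  have cscale: "fscale ((\<lambda>_. c) * F) v = fscale (\<lambda>_. c) (fscale F v)" for c F and v :: "'a form"
    by (simp only: fscale_fscale)
  \<comment> \<open>By the Leibniz rule one more derivative either contracts a further index of
    \<open>Q\<close> or lengthens the tuple that acts on \<open>w\<close>.\<close>
  have step: "(\<Sum>i\<in>A. \<Sum>ks\<in>words A k. ftd i (fscale ((nabla A ^^ l) Q (i # ks)) (ftds ks w))) =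
      B k (Suc l) + B (Suc k) l" for k l
  proof -
    have "(nabla A ^^ l) Q (i # ks) = (nabla A ^^ l) Q (ks @ [i])" for i ks
      using symmetric_nabla_power[OF Suc.prems(2)] by (simp add: symmetric_on_words_def)
    then have nab: "(\<Sum>i\<in>A. td i ((nabla A ^^ l) Q (i # ks))) = (nabla A ^^ Suc l) Q ks" for ks
      by (simp add: nabla_def)
    have "(\<Sum>i\<in>A. \<Sum>ks\<in>words A k. ftd i (fscale ((nabla A ^^ l) Q (i # ks)) (ftds ks w))) =
        (\<Sum>i\<in>A. \<Sum>ks\<in>words A k. fscale (td i ((nabla A ^^ l) Q (i # ks))) (ftds ks w)) +
        (\<Sum>i\<in>A. \<Sum>ks\<in>words A k. fscale ((nabla A ^^ l) Q (i # ks)) (ftds (i # ks) w))"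
      by (simp only: ftd_fscale[OF localsD[OF locals_nabla_power[OF Suc.prems(1)]] local_form_ftds[OF assms(4)]]
          sum.distrib ftds_Cons)
    also have "(\<Sum>i\<in>A. \<Sum>ks\<in>words A k. fscale (td i ((nabla A ^^ l) Q (i # ks))) (ftds ks w)) = B k (Suc l)"
      unfolding B_def by (subst sum.swap) (simp only: nab flip: fscale_sum_left)
    also have "(\<Sum>i\<in>A. \<Sum>ks\<in>words A k. fscale ((nabla A ^^ l) Q (i # ks)) (ftds (i # ks) w)) = B (Suc k) l"
      unfolding B_def by (simp only: sum_words_Suc)
    finally show ?thesis .
  qed
  have "(\<Sum>js\<in>words A (Suc m). ftds js (fscale (Q js) w)) =
      (\<Sum>i\<in>A. ftd i (\<Sum>js\<in>words A m. ftds js (fscale (Q (i # js)) w)))"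
    by (simp add: sum_words_Suc ftds_Cons ftd_sum local_form_ftds local_form_fscale assms(4)
        localsD[OF Suc.prems(1)])
  also have "\<dots> = (\<Sum>i\<in>A. ftd i (\<Sum>k\<le>m. \<Sum>ks\<in>words A k. fscale (\<lambda>_. of_nat (m choose k))
      (fscale ((nabla A ^^ (m - k)) Q (i # ks)) (ftds ks w))))"
    by (simp only: Suc.IH[OF loc sym] nabla_power_Cons cscale)
  also have "\<dots> = (\<Sum>i\<in>A. \<Sum>k\<le>m. \<Sum>ks\<in>words A k. fscale (\<lambda>_. of_nat (m choose k))
      (ftd i (fscale ((nabla A ^^ (m - k)) Q (i # ks)) (ftds ks w))))"
    by (simp add: ftd_sum ftd_cscale local_form_sum local_form_fscale local_form_ftds assms(4) local_in_const
        localsD[OF locals_nabla_power[OF Suc.prems(1)]])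
  also have "\<dots> = (\<Sum>k\<le>m. fscale (\<lambda>_. of_nat (m choose k)) (\<Sum>i\<in>A. \<Sum>ks\<in>words A k.
      ftd i (fscale ((nabla A ^^ (m - k)) Q (i # ks)) (ftds ks w))))"
    by (simp only: fscale_sum_right sum.swap[of _ _ A])
  also have "\<dots> = (\<Sum>k\<le>m. fscale (\<lambda>_. of_nat (m choose k)) (B k (Suc m - k) + B (Suc k) (m - k)))"
    by (intro sum.cong refl) (simp add: step Suc_diff_le)
  \<comment> \<open>Pascal's rule merges the two kinds of terms.\<close>
  also have "\<dots> = (\<Sum>k\<le>Suc m. fscale (\<lambda>_. of_nat (Suc m choose k)) (B k (Suc m - k)))"
  proof -
    define b where "b k = B k (Suc m - k)" for k
    have "(\<Sum>k\<le>Suc m. fscale (\<lambda>_. of_nat (Suc m choose k)) (b k)) =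
        fscale (\<lambda>_. 1) (b 0) + (\<Sum>k\<le>m. fscale (\<lambda>_. of_nat (m choose k) + of_nat (m choose Suc k)) (b (Suc k)))"
      by (simp only: sum.atMost_Suc_shift) simp
    also have "\<dots> = (\<Sum>k\<le>m. fscale (\<lambda>_. of_nat (m choose k)) (b (Suc k))) +
        (fscale (\<lambda>_. 1) (b 0) + (\<Sum>k\<le>m. fscale (\<lambda>_. of_nat (m choose Suc k)) (b (Suc k))))"
      by (simp only: fscale_const_add sum.distrib add_ac)
    also have "fscale (\<lambda>_. 1) (b 0) + (\<Sum>k\<le>m. fscale (\<lambda>_. of_nat (m choose Suc k)) (b (Suc k))) =
        (\<Sum>k\<le>Suc m. fscale (\<lambda>_. of_nat (m choose k)) (b k))"
      by (simp only: sum.atMost_Suc_shift) simp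
    also have "\<dots> = (\<Sum>k\<le>m. fscale (\<lambda>_. of_nat (m choose k)) (b k))"
      by (simp add: fscale_const_0 binomial_eq_0)
    finally show ?thesis
      by (simp add: fscale_add_right sum.distrib b_def add_ac)
  qed
  finally show ?case
    unfolding B_def by (simp only: cscale fscale_sum_right)
qed

text \<open>Once all lengths are summed, the terms with \<open>k\<close> derivatives on
  \<open>w\<close> and \<open>l\<close> on the coefficient carry the weight (k + l choose k), which
  is the transform with +1.\<close>

lemma sum_ftds_fscale:
  assumes "finite A" "locals Q" "symmetric_on_words Q" "vanishes_beyond N Q" "local_form w"
  shows "(\<Sum>m\<le>N. \<Sum>js\<in>words A m. ftds js (fscale (Q js) w)) =
    (\<Sum>m\<le>N. \<Sum>ks\<in>words A m. fscale (binomial_sum A 1 N Q ks) (ftds ks w))"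
proof -
  define g where "g k l = (\<Sum>ks\<in>words A k.
    fscale ((\<lambda>_. of_nat ((k + l) choose k)) * (nabla A ^^ l) Q ks) (ftds ks w))" for k l
  have "(\<Sum>m\<le>N. \<Sum>js\<in>words A m. ftds js (fscale (Q js) w)) = (\<Sum>m\<le>N. \<Sum>k\<le>m. g k (m - k))"
    unfolding ftds_fscale_words[OF assms(1,2,3,5)] g_def by (intro sum.cong refl) simp
  also have "\<dots> = (\<Sum>k\<le>N. \<Sum>l\<le>N. g k l)"
    by (rule sum_triangle_square)
      (auto simp: g_def words_def nabla_power_vanishes[OF assms(4)] fscale_0_left intro!: sum.neutral)
  also have "\<dots> = (\<Sum>k\<le>N. \<Sum>ks\<in>words A k. fscale (binomial_sum A 1 N Q ks) (ftds ks w))"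
    unfolding binomial_sum_def fscale_sum_left g_def sum.swap[of _ "{..N}" "words A _"]
    by (intro sum.cong refl) (simp add: words_def)
  finally show ?thesis .
qed

section \<open>Euler-Lagrange derivatives\<close>

text \<open>Orbit-stabiliser: \<open>symdelta\<close> is the order of the stabiliser of
  \<open>xs\<close> over the order of the symmetric group, and the rearrangements of
  \<open>xs\<close> form the orbit.\<close>

lemma symdelta_mult_card: "symdelta xs * real (card (permutations_of_multiset (mset xs))) = 1"
proof -
  let ?n = "length xs"
  define G where "G = {\<pi>. \<pi> permutes {..<?n}}"
  define fibre where "fibre ys = {\<pi>\<in>G. permute_list \<pi> xs = ys}" for ys
  have stab: "{\<pi>. \<pi> permutes {..<?n} \<and> (\<forall>j<?n. xs ! (\<pi> j) = xs ! j)} = fibre xs"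
    unfolding fibre_def G_def by (auto simp: list_eq_iff_nth_eq permute_list_nth)
  have fin: "finite G" and card: "card G = fact ?n"
    unfolding G_def by (simp_all add: finite_permutations card_permutations)
  have fibre: "card (fibre ys) = card (fibre xs)" if "ys \<in> permutations_of_multiset (mset xs)" for ys
  proof -
    from that have "mset ys = mset xs" by (rule permutations_of_multisetD)
    then obtain \<sigma> where \<sigma>: "\<sigma> permutes {..<?n}" "permute_list \<sigma> xs = ys"
      by (rule mset_eq_permutation)
    note inv = permutes_inv[OF \<sigma>(1)]
    \<comment> \<open>The permutations that carry \<open>xs\<close> to \<open>ys\<close> form a
      coset of the stabiliser.\<close>
    have "bij_betw (\<lambda>\<pi>. \<pi> \<circ> \<sigma>) (fibre xs) (fibre ys)"
    proof (rule bij_betw_byWitness[where f' = "\<lambda>\<tau>. \<tau> \<circ> inv_into UNIV \<sigma>"])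
      show "\<forall>\<pi>\<in>fibre xs. (\<pi> \<circ> \<sigma>) \<circ> inv_into UNIV \<sigma> = \<pi>" "\<forall>\<tau>\<in>fibre ys. (\<tau> \<circ> inv_into UNIV \<sigma>) \<circ> \<sigma> = \<tau>"
        using permutes_inv_o[OF \<sigma>(1)] by (simp_all add: comp_assoc)
      show "(\<lambda>\<pi>. \<pi> \<circ> \<sigma>) ` fibre xs \<subseteq> fibre ys"
        using \<sigma> by (auto simp: fibre_def G_def permute_list_compose intro: permutes_compose)
      have "permute_list (inv_into UNIV \<sigma>) ys = xs"
        using permute_list_compose[OF inv, of \<sigma>] \<sigma> permutes_inv_o(1)[OF \<sigma>(1)] by (metis permute_list_id)
      then show "(\<lambda>\<tau>. \<tau> \<circ> inv_into UNIV \<sigma>) ` fibre ys \<subseteq> fibre xs"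
        using inv by (auto simp: fibre_def G_def permute_list_compose intro: permutes_compose)
    qed
    then show ?thesis by (metis bij_betw_same_card)
  qed
  have "(\<lambda>\<pi>. permute_list \<pi> xs) ` G \<subseteq> permutations_of_multiset (mset xs)"
    by (auto simp: G_def intro: permutations_of_multisetI)
  from sum.group[OF fin _ this, of "\<lambda>_. 1 :: nat"]
  have "card G = (\<Sum>ys\<in>permutations_of_multiset (mset xs). card (fibre ys))"
    by (simp add: fibre_def)
  also have "\<dots> = card (permutations_of_multiset (mset xs)) * card (fibre xs)"
    by (simp add: fibre)
  finally have "fact ?n = real (card (fibre xs)) * real (card (permutations_of_multiset (mset xs)))"
    unfolding card by (metis mult.commute of_nat_fact of_nat_mult)
  then show ?thesis
    unfolding symdelta_def stab by (metis divide_self fact_nonzero times_divide_eq_left)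
qed

lemma symdelta_eq: "symdelta xs = 1 / real (card (permutations_of_multiset (mset xs)))"
  using symdelta_mult_card[of xs] by (auto simp: eq_divide_eq)

lemma symdelta_cong: "mset xs = mset ys \<Longrightarrow> symdelta xs = symdelta ys"
  by (simp add: symdelta_eq)

text \<open>A letter that does not occur in \<open>xs\<close> can be inserted at length + 1 places
  of each rearrangement. Applied to the time index, this is the origin of the weight
  1/(|ms|+1).\<close>

lemma symdelta_Cons:
  assumes "x \<notin> set xs"
  shows "symdelta (x # xs) = symdelta xs / (real (length xs) + 1)"
proof -
  have count: "count (mset xs) x = 0"
    using assms by (metis not_in_iff set_mset_mset)
  have "card (permutations_of_multiset (mset (x # xs))) = (length xs + 1) * card (permutations_of_multiset (mset xs))"
    using card_permutations_of_multiset_insert_aux[of "mset xs" x, unfolded count] by simp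
  then show ?thesis
    by (simp add: symdelta_eq algebra_simps)
qed

lemma fscale_const_mult: "fscale ((\<lambda>_. x) * F) w = fscale (\<lambda>_. x) (fscale F w)"
  by (simp only: fscale_fscale)

text \<open>The arrangements of one multiset are weighted so that together they count once. This
  mediates between the tuples in Euler-Lagrange derivatives and the multisets in
  \<open>d_V_z\<close>.\<close>

lemma sum_symdelta:
  assumes "finite W" "\<And>xs ys. xs \<in> W \<Longrightarrow> mset xs = mset ys \<Longrightarrow> ys \<in> W"
  shows "(\<Sum>xs\<in>W. fscale (\<lambda>_. symdelta xs) (\<phi> (mset xs))) = (\<Sum>M\<in>mset ` W. \<phi> M)"
proof -
  have "(\<Sum>xs\<in>{xs \<in> W. mset xs = M}. fscale (\<lambda>_. symdelta xs) (\<phi> (mset xs))) = \<phi> M"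
    if "M \<in> mset ` W" for M
  proof -
    from that obtain zs where zs: "zs \<in> W" "mset zs = M" by blast
    have eq: "{xs \<in> W. mset xs = M} = permutations_of_multiset M"
      using assms(2)[OF zs(1)] zs(2) by (auto simp: permutations_of_multiset_def)
    have "(\<Sum>xs\<in>{xs \<in> W. mset xs = M}. fscale (\<lambda>_. symdelta xs) (\<phi> (mset xs))) =
        (\<Sum>xs\<in>permutations_of_multiset M. fscale (\<lambda>_. symdelta zs) (\<phi> M))"
      unfolding eq by (intro sum.cong refl) (metis permutations_of_multisetD symdelta_cong zs(2))
    also have "\<dots> = fscale (\<Sum>xs\<in>permutations_of_multiset M. (\<lambda>_. symdelta zs)) (\<phi> M)"
      by (rule fscale_sum_left[symmetric])
    also have "(\<Sum>xs\<in>permutations_of_multiset M. (\<lambda>_. symdelta zs)) = 1"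
      using symdelta_mult_card[of zs] zs(2) by (simp add: fun_eq_iff sum_fun_apply fun_apply mult.commute)
    finally show ?thesis
      by (simp add: fscale_1)
  qed
  then have "(\<Sum>M\<in>mset ` W. \<phi> M) =
      (\<Sum>M\<in>mset ` W. \<Sum>xs\<in>{xs \<in> W. mset xs = M}. fscale (\<lambda>_. symdelta xs) (\<phi> (mset xs)))"
    by simp
  also have "\<dots> = (\<Sum>xs\<in>W. fscale (\<lambda>_. symdelta xs) (\<phi> (mset xs)))"
    using assms(1) by (intro sum.group) auto
  finally show ?thesis ..
qed

section \<open>Jet order, and Euler-Lagrange derivatives as binomial transforms\<close>

definition order_le :: "nat \<Rightarrow> 'i local_fn \<Rightarrow> bool" where
  "order_le N F \<longleftrightarrow> (\<forall>i M. N < size M \<longrightarrow> pd (U i M) F = 0)"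

lemma smooth_sum: "(\<And>a. a \<in> A \<Longrightarrow> smooth (F a)) \<Longrightarrow> smooth (\<Sum>a\<in>A. F a)"
  by (induction A rule: infinite_finite_induct)
    (simp_all add: smooth_add smooth_const[of 0, folded zero_fun_def])

lemma pd_sum: "(\<And>a. a \<in> A \<Longrightarrow> smooth (F a)) \<Longrightarrow> pd c (\<Sum>a\<in>A. F a) = (\<Sum>a\<in>A. pd c (F a))"
  by (induction A rule: infinite_finite_induct)
    (simp_all add: pd_add smooth_sum pd_const[of _ 0, folded zero_fun_def])

lemma td_diff:
  assumes "local_in UNIV F" "local_in UNIV G"
  shows "td \<nu> (F - G) = td \<nu> F - td \<nu> G"
  using td_add[OF local_in_diff[OF assms] assms(2)] by (simp add: algebra_simps)

lemma tds_diff: "local_in UNIV F \<Longrightarrow> local_in UNIV G \<Longrightarrow> tds \<nu>s (F - G) = tds \<nu>s F - tds \<nu>s G"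
  by (induction \<nu>s) (simp_all add: tds_Nil tds_Cons td_diff local_in_UNIV_tds)

lemma order_le_mono: "order_le N F \<Longrightarrow> N \<le> N' \<Longrightarrow> order_le N' F"
  by (simp add: order_le_def)

lemma order_le_exists:
  assumes "local_in D F"
  obtains N where "order_le N F"
proof -
  have "finite ((\<lambda>(i, M). size M) ` {(i, M). pd (U i M) F \<noteq> 0})"
    using finite_pd_U_support[OF assms] by blast
  then obtain N where "\<forall>m\<in>(\<lambda>(i, M). size M) ` {(i, M). pd (U i M) F \<noteq> 0}. m \<le> N"
    using finite_nat_set_iff_bounded_le by blast
  then have "order_le N F"
    unfolding order_le_def by (force simp: not_le[symmetric])
  then show ?thesis by (rule that)
qed

lemma order_le_exists_family:
  assumes "finite B" "\<And>b. b \<in> B \<Longrightarrow> local_in (D b) (F b)"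
  shows "\<exists>N. \<forall>b\<in>B. order_le N (F b)"
  using assms
proof (induction B rule: finite_induct)
  case (insert b B)
  then obtain N1 N2 where "\<forall>b\<in>B. order_le N1 (F b)" "order_le N2 (F b)"
    by (metis insertCI order_le_exists)
  then show ?case
    by (intro exI[of _ "max N1 N2"]) (auto intro: order_le_mono)
qed simp

lemma pS_eq_0: "pd (U i (mset \<mu>s)) F = 0 \<Longrightarrow> pS i \<mu>s F = 0"
  by (simp add: pS_def)

lemma vanishes_pS: "order_le N F \<Longrightarrow> vanishes_beyond N (\<lambda>\<mu>s. pS i \<mu>s F)"
  by (auto simp: vanishes_beyond_def order_le_def intro!: pS_eq_0)

lemma symmetric_pS: "symmetric_on_words (\<lambda>\<mu>s. pS i \<mu>s F)"
  unfolding symmetric_on_words_def pS_def by (metis symdelta_cong)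

lemma pS_support:
  assumes "local_in (jet_coords n I A) F" "pS i \<mu>s F \<noteq> 0"
  shows "i \<in> I \<and> set \<mu>s \<subseteq> A"
proof (rule ccontr)
  assume "\<not> ?thesis"
  then have "U i (mset \<mu>s) \<notin> jet_coords n I A"
    by (auto simp: jet_coords_def)
  then have "pd (U i (mset \<mu>s)) F = 0"
    by (rule pd_not_depends[OF local_in_depends_on[OF assms(1)]])
  with assms(2) pS_eq_0 show False by metis
qed

lemma locals_pS: "local_in D F \<Longrightarrow> locals (\<lambda>\<mu>s. pS i \<mu>s F)"
  by (simp add: locals_def local_in_pS[OF local_in_UNIV])

lemma local_in_binomial_sum:
  assumes "\<And>ks. local_in D (P ks)" "prolonged A D"
  shows "local_in D (binomial_sum A \<epsilon> N P ks)"
proof -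
  have "local_in D ((nabla A ^^ l) P ks)" for l ks
    by (induction l arbitrary: ks) (auto simp: nabla_def assms(1) intro!: local_in_sum local_in_td[OF _ assms(2)])
  then show ?thesis
    unfolding binomial_sum_def by (intro local_in_intros)
qed

lemma locals_binomial_sum: "locals P \<Longrightarrow> locals (binomial_sum A \<epsilon> N P)"
  unfolding locals_def by (blast intro: local_in_binomial_sum prolonged_UNIV)

lemma symmetric_binomial_sum:
  assumes "symmetric_on_words P"
  shows "symmetric_on_words (binomial_sum A \<epsilon> N P)"
  unfolding symmetric_on_words_def binomial_sum_def
proof (intro allI impI sum.cong refl)
  fix xs ys :: "nat list" and l
  assume "mset xs = mset ys"
  moreover from this have "length xs = length ys" by (rule mset_eq_length)
  ultimately show "(\<lambda>_. of_nat (length xs + l choose length xs) * \<epsilon> ^ l) * (nabla A ^^ l) P xs =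
      (\<lambda>_. of_nat (length ys + l choose length ys) * \<epsilon> ^ l) * (nabla A ^^ l) P ys"
    using symmetric_nabla_power[OF assms] by (metis symmetric_on_words_def)
qed

lemma vanishes_binomial_sum:
  assumes "vanishes_beyond N P"
  shows "vanishes_beyond N (binomial_sum A \<epsilon> N P)"
  unfolding vanishes_beyond_def binomial_sum_def
  by (auto intro!: sum.neutral simp: nabla_power_vanishes[OF assms])

text \<open>Derivatives with respect to jets outside \<open>A\<close> vanish, so the sum over tuples
  of all directions shrinks to tuples over \<open>A\<close>. For functions without time derivatives
  the transform is therefore purely spatial.\<close>

lemma euler_eq_binomial_sum:
  assumes "local_in (jet_coords n I A) F" "A \<subseteq> {..<n}" "order_le N F"
  shows "euler n i \<mu>s F = binomial_sum A (- 1) N (\<lambda>xs. pS i xs F) \<mu>s"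
proof -
  have "xs \<in> lists A \<and> length xs \<le> N" if "pS i (\<mu>s @ xs) F \<noteq> 0" for xs
  proof -
    have "\<not> N < length (\<mu>s @ xs)"
      using that vanishes_pS[OF assms(3), of i] unfolding vanishes_beyond_def by metis
    then show ?thesis
      using pS_support[OF assms(1) that] by auto
  qed
  then have "euler n i \<mu>s F = (\<Sum>m\<le>N. \<Sum>\<nu>s\<in>words A m.
      (\<lambda>_. of_nat ((length \<mu>s + length \<nu>s) choose length \<mu>s) * (- 1) ^ length \<nu>s) * tds \<nu>s (pS i (\<mu>s @ \<nu>s) F))"
    unfolding euler_def using finite_subset[OF assms(2)] assms(2)
    by (intro sum_over_words) (simp, simp, metis tds_0 mult_zero_right)
  also have "\<dots> = binomial_sum A (- 1) N (\<lambda>xs. pS i xs F) \<mu>s"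
    unfolding binomial_sum_def nabla_power[OF locals_pS[OF assms(1)]] sum_distrib_left
    by (intro sum.cong refl) (simp add: words_def)
  finally show ?thesis .
qed

lemma euler_eq_0:
  assumes "local_in (jet_coords n I A) F" "A \<subseteq> {..<n}" "\<not> (i \<in> I \<and> set \<mu>s \<subseteq> A)"
  shows "euler n i \<mu>s F = 0"
proof -
  have "pS i (\<mu>s @ \<nu>s) F = 0" for \<nu>s
    using pS_support[OF assms(1), of i "\<mu>s @ \<nu>s"] assms(3) by auto
  then show ?thesis
    by (simp only: euler_def tds_0 mult_zero_right if_cancel Sum_any.neutral)
qed

lemma euler_vanishes:
  assumes "order_le N F" "N < length \<mu>s"
  shows "euler n i \<mu>s F = 0"
proof -
  have "pS i (\<mu>s @ \<nu>s) F = 0" for \<nu>s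
    using vanishes_pS[OF assms(1), of i] assms(2) by (simp add: vanishes_beyond_def)
  then show ?thesis
    by (simp only: euler_def tds_0 mult_zero_right if_cancel Sum_any.neutral)
qed

text \<open>As a transform over \<open>A\<close>, the Euler-Lagrange derivative introduces no
  derivatives in directions outside \<open>A\<close>.\<close>

lemma local_in_euler:
  assumes "local_in (jet_coords n I A) F" "A \<subseteq> {..<n}"
  shows "local_in (jet_coords n I A) (euler n i \<mu>s F)"
proof -
  obtain N where N: "order_le N F"
    using order_le_exists[OF assms(1)] .
  show ?thesis
    unfolding euler_eq_binomial_sum[OF assms N]
    by (intro local_in_binomial_sum local_in_pS assms prolonged_jet_coords)
qed

text \<open>With the last index held fixed this is a family in \<open>ms\<close> alone. Transforms
  applied to it count \<open>length ms\<close> and not the fixed index, so their binomial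
  coefficients differ from those that invert \<open>euler\<close>.\<close>

definition shifted_euler :: "nat \<Rightarrow> nat \<Rightarrow> ('a, 'c) lfun \<Rightarrow> 'a + 'a \<Rightarrow> nat \<Rightarrow> nat list \<Rightarrow> ('a, 'c) lfun" where
  "shifted_euler n N g A i ms = binomial_sum {1..<n} (- 1) N (\<lambda>xs. pS (Z A) xs g) (ms @ [i])"

lemma spatial_subset: "{1..<n} \<subseteq> {..<n}"
  by auto

section \<open>A function without time derivatives: its variation and its boundary terms\<close>

context
  fixes n N :: nat and g :: "('a::finite, 'c) lfun" and I
  assumes local_g: "local_in (jet_coords n I {1..<n}) g" and order_g: "order_le N g"
begin

lemma euler_shifted: "euler n (Z A) (ms @ [i]) g = shifted_euler n N g A i ms"
  unfolding shifted_euler_def by (rule euler_eq_binomial_sum[OF local_g spatial_subset order_g])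

lemma locals_shifted_euler: "locals (shifted_euler n N g A i)"
  unfolding locals_def shifted_euler_def
  by (intro allI local_in_binomial_sum local_in_pS[OF local_in_UNIV[OF local_g]] prolonged_UNIV)

lemma local_in_shifted_euler: "local_in (jet_coords n I {1..<n}) (shifted_euler n N g A i ms)"
  unfolding shifted_euler_def
  by (intro local_in_binomial_sum local_in_pS local_g prolonged_jet_coords)

lemma symmetric_shifted_euler: "symmetric_on_words (shifted_euler n N g A i)"
  using symmetric_binomial_sum[OF symmetric_pS, of "{1..<n}" "- 1" N "Z A" g]
  by (simp add: symmetric_on_words_def shifted_euler_def)

lemma vanishes_shifted_euler: "vanishes_beyond N (shifted_euler n N g A i)"
  using vanishes_binomial_sum[OF vanishes_pS[OF order_g], of "{1..<n}" "- 1" "Z A"]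
  by (simp add: vanishes_beyond_def shifted_euler_def)

lemma bdry_eq_sum_words:
  assumes "i \<in> {1..<n}"
  shows "bdry n i Q g = (\<Sum>A\<in>UNIV. \<Sum>m\<le>N. \<Sum>ms\<in>words {1..<n} m. ftds ms (fscale (shifted_euler n N g A i ms) (Q A)))"
  unfolding bdry_def euler_shifted
proof (intro sum.cong refl sum_over_words)
  fix A ms
  assume "ms \<in> lists {1..<n}" "ftds ms (fscale (shifted_euler n N g A i ms) (Q A)) \<noteq> 0"
  moreover from this(2) have "shifted_euler n N g A i ms \<noteq> 0"
    by (metis fscale_0_left ftds_0)
  ultimately show "ms \<in> lists {1..<n} \<and> length ms \<le> N"
    using vanishes_shifted_euler unfolding vanishes_beyond_def by (metis not_le)
qed auto

text \<open>Moving the derivatives onto \<open>Q\<close> by the Leibniz rule exposes the coefficient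
  of each derivative of \<open>Q\<close>. Velocities and multipliers can be read off in this
  form.\<close>

lemma bdry_eq_binomial_sum:
  assumes "i \<in> {1..<n}" "\<And>A. local_form (Q A)"
  shows "bdry n i Q g = (\<Sum>A\<in>UNIV. \<Sum>m\<le>N. \<Sum>ms\<in>words {1..<n} m.
    fscale (binomial_sum {1..<n} 1 N (shifted_euler n N g A i) ms) (ftds ms (Q A)))"
  unfolding bdry_eq_sum_words[OF assms(1)]
  by (intro sum.cong refl sum_ftds_fscale locals_shifted_euler symmetric_shifted_euler
      vanishes_shifted_euler assms(2) finite_atLeastLessThan)

text \<open>Passes from multisets to tuples by \<open>sum_symdelta\<close>. Locality and the order
  bound confine the sum to spatial tuples of length at most \<open>N\<close>, a set closed under
  rearrangement.\<close>

lemma d_V_z_eq_sum_words: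
  "d_V_z g = (\<Sum>A\<in>UNIV. \<Sum>m\<le>N. \<Sum>ms\<in>words {1..<n} m. fscale (pS (Z A) ms g) (ftds ms (dz A)))"
proof -
  define W where "W = (\<Union>m\<le>N. words {1..<n} m)"
  have finW: "finite W"
    unfolding W_def using finite_words by blast
  have W: "ys \<in> W" if "xs \<in> W" "mset xs = mset ys" for xs ys
    using that mset_eq_length[OF that(2)] mset_eq_setD[OF that(2)] by (auto simp: W_def words_def)
  have zero: "pd (U (Z A) M) g = 0" if "M \<notin> mset ` W" for A M
  proof (rule ccontr)
    assume nz: "pd (U (Z A) M) g \<noteq> 0"
    then have "U (Z A) M \<in> jet_coords n I {1..<n}"
      using pd_not_depends[OF local_in_depends_on[OF local_g]] by blast
    moreover have "\<not> N < size M"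
      using nz order_g unfolding order_le_def by metis
    ultimately have "sorted_list_of_multiset M \<in> W"
      by (auto simp: W_def words_def jet_coords_def size_mset[symmetric] simp del: size_mset)
    with that show False
      by (metis image_eqI mset_sorted_list_of_multiset)
  qed
  have "d_V_z g = (\<Sum>(A, M)\<in>UNIV \<times> mset ` W. fscale (pd (U (Z A) M) g) (gen_form (DV (Z A) M)))"
    unfolding d_V_z_def
  proof (rule Sum_any.expand_superset)
    show "finite ((UNIV :: ('a + 'a) set) \<times> mset ` W)"
      by (intro finite_cartesian_product finite_imageI finW finite)
    show "{x. (case x of (A, M) \<Rightarrow> fscale (pd (U (Z A) M) g) (gen_form (DV (Z A) M))) \<noteq> 0} \<subseteq> UNIV \<times> mset ` W"
    proof
      fix x
      assume x: "x \<in> {x. (case x of (A, M) \<Rightarrow> fscale (pd (U (Z A) M) g) (gen_form (DV (Z A) M))) \<noteq> 0}"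
      obtain A M where AM: "x = (A, M)" by (cases x)
      with x zero[of M A] have "M \<in> mset ` W"
        by (cases "M \<in> mset ` W") (simp_all add: fscale_0_left)
      with AM show "x \<in> UNIV \<times> mset ` W" by simp
    qed
  qed
  also have "\<dots> = (\<Sum>A\<in>UNIV. \<Sum>M\<in>mset ` W. fscale (pd (U (Z A) M) g) (gen_form (DV (Z A) M)))"
    by (rule sum.cartesian_product[symmetric])
  also have "\<dots> = (\<Sum>A\<in>UNIV. \<Sum>ms\<in>W. fscale (pS (Z A) ms g) (ftds ms (dz A)))"
  proof (rule sum.cong[OF refl])
    fix A :: "'a + 'a"
    have "(\<Sum>M\<in>mset ` W. fscale (pd (U (Z A) M) g) (gen_form (DV (Z A) M))) =
        (\<Sum>xs\<in>W. fscale (\<lambda>_. symdelta xs) (fscale (pd (U (Z A) (mset xs)) g) (gen_form (DV (Z A) (mset xs)))))"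
      by (rule sum_symdelta[OF finW W, symmetric])
    then show "(\<Sum>M\<in>mset ` W. fscale (pd (U (Z A) M) g) (gen_form (DV (Z A) M))) =
        (\<Sum>ms\<in>W. fscale (pS (Z A) ms g) (ftds ms (dz A)))"
      by (simp add: pS_def fscale_const_mult ftds_gen_form)
  qed
  also have "\<dots> = (\<Sum>A\<in>UNIV. \<Sum>m\<le>N. \<Sum>ms\<in>words {1..<n} m. fscale (pS (Z A) ms g) (ftds ms (dz A)))"
    unfolding W_def
    by (intro sum.cong refl sum.UNION_disjoint) (auto simp: finite_words, auto simp: words_def)
  finally show ?thesis .
qed

lemma d_V_z_eq_euler_plus_bdry:
  "d_V_z g = (\<Sum>A\<in>UNIV. fscale (euler n (Z A) [] g) (dz A)) + (\<Sum>i=1..<n. ftd i (bdry n i dz g))"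
proof -
  define E where "E A = binomial_sum {1..<n} (- 1) N (\<lambda>xs. pS (Z A) xs g)" for A
  have loc: "locals (E A)" and sym: "symmetric_on_words (E A)" and van: "vanishes_beyond N (E A)" for A
    unfolding E_def
    by (intro locals_binomial_sum symmetric_binomial_sum vanishes_binomial_sum locals_pS[OF local_g]
        symmetric_pS vanishes_pS order_g)+
  have lf: "local_form (fscale (E A ms) (dz A))" for A ms
    by (intro local_form_fscale local_form_gen_form localsD[OF loc])
  \<comment> \<open>The symmetrised derivatives are themselves a transform with +1, so the Leibniz
    regrouping can be read backwards.\<close>
  have pS: "pS (Z A) ms g = binomial_sum {1..<n} 1 N (E A) ms" for A ms
    unfolding E_def by (rule binomial_sum_inverse[OF locals_pS[OF local_g] vanishes_pS[OF order_g], symmetric])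
  have split: "(\<Sum>m\<le>N. \<Sum>ms\<in>words {1..<n} m. ftds ms (fscale (E A ms) (dz A))) =
      fscale (E A []) (dz A) +
      (\<Sum>m\<le>N. \<Sum>i=1..<n. \<Sum>ms\<in>words {1..<n} m. ftd i (ftds ms (fscale (E A (ms @ [i])) (dz A))))" for A
  proof -
    \<comment> \<open>The layer of length \<open>Suc N\<close> is zero. Adding it lets the shift of
      the length leave a sum up to \<open>N\<close>.\<close>
    have "ftds ms (fscale (E A ms) (dz A)) = 0" if "ms \<in> words {1..<n} (Suc N)" for ms
      using van[of A] that by (simp add: vanishes_beyond_def words_def fscale_0_left ftds_0)
    then have "(\<Sum>m\<le>N. \<Sum>ms\<in>words {1..<n} m. ftds ms (fscale (E A ms) (dz A))) =
        (\<Sum>m\<le>Suc N. \<Sum>ms\<in>words {1..<n} m. ftds ms (fscale (E A ms) (dz A)))"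
      by simp
    also have "\<dots> = fscale (E A []) (dz A) +
        (\<Sum>m\<le>N. \<Sum>ms\<in>words {1..<n} (Suc m). ftds ms (fscale (E A ms) (dz A)))"
      by (simp only: sum.atMost_Suc_shift) (simp add: words_0 ftds_Nil)
    also have "(\<Sum>m\<le>N. \<Sum>ms\<in>words {1..<n} (Suc m). ftds ms (fscale (E A ms) (dz A))) =
        (\<Sum>m\<le>N. \<Sum>i=1..<n. \<Sum>ms\<in>words {1..<n} m. ftd i (ftds ms (fscale (E A (i # ms)) (dz A))))"
      by (simp only: sum_words_Suc ftds_Cons)
    also have "\<dots> = (\<Sum>m\<le>N. \<Sum>i=1..<n. \<Sum>ms\<in>words {1..<n} m. ftd i (ftds ms (fscale (E A (ms @ [i])) (dz A))))"
    proof -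
      \<comment> \<open>Symmetry moves the split-off index to the end, where \<open>bdry\<close> has
        it.\<close>
      have "E A (i # ms) = E A (ms @ [i])" for i ms
        using sym[of A] by (simp add: symmetric_on_words_def)
      then show ?thesis by simp
    qed
    finally show ?thesis .
  qed
  have bd: "ftd i (bdry n i dz g) =
      (\<Sum>A\<in>UNIV. \<Sum>m\<le>N. \<Sum>ms\<in>words {1..<n} m. ftd i (ftds ms (fscale (E A (ms @ [i])) (dz A))))"
    if "i \<in> {1..<n}" for i
    unfolding bdry_eq_sum_words[OF that] shifted_euler_def E_def[symmetric]
    by (simp add: ftd_sum local_form_sum local_form_ftds lf)
  have "d_V_z g = (\<Sum>A\<in>UNIV. \<Sum>m\<le>N. \<Sum>ms\<in>words {1..<n} m. ftds ms (fscale (E A ms) (dz A)))"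
    unfolding d_V_z_eq_sum_words pS
    by (intro sum.cong refl sum_ftds_fscale[symmetric] loc sym van local_form_gen_form finite_atLeastLessThan)
  also have "\<dots> = (\<Sum>A\<in>UNIV. fscale (E A []) (dz A)) + (\<Sum>i=1..<n. ftd i (bdry n i dz g))"
    by (simp only: split sum.distrib bd sum.swap[of _ "{1..<n}"] cong: sum.cong)
  also have "(\<Sum>A\<in>UNIV. fscale (E A []) (dz A)) = (\<Sum>A\<in>UNIV. fscale (euler n (Z A) [] g) (dz A))"
    unfolding E_def by (simp only: euler_eq_binomial_sum[OF local_g spatial_subset order_g])
  finally show ?thesis .
qed

text \<open>Isolates the part of the current that is linear in the velocities: spatial derivatives
  of \<open>zdot A\<close> are coordinates with a single time index, and the coefficients in front
  of them contain no time derivatives.\<close>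

lemma bdry_velocity:
  assumes "k \<in> {1..<n}" "\<And>A. local_in UNIV (E A)"
  shows "bdry n k (\<lambda>A. zero_form (zdot A - E A)) g [] =
    (\<Sum>A\<in>UNIV. \<Sum>m\<le>N. \<Sum>ms\<in>words {1..<n} m.
      binomial_sum {1..<n} 1 N (shifted_euler n N g A k) ms * coordf (U (Z A) (add_mset 0 (mset ms)))) -
    (\<Sum>A\<in>UNIV. \<Sum>m\<le>N. \<Sum>ms\<in>words {1..<n} m.
      binomial_sum {1..<n} 1 N (shifted_euler n N g A k) ms * tds ms (E A))"
proof -
  have loc: "local_in UNIV (zdot A)" for A :: "'a + 'a"
    by (simp add: zdot_def local_in_coordf)
  then have "local_form (zero_form (zdot A - E A))" for A
    by (intro local_form_zero_form local_in_diff assms(2))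
  note bdry = bdry_eq_binomial_sum[OF assms(1), of "\<lambda>A. zero_form (zdot A - E A)", OF this]
  have "fscale F (ftds ms (zero_form (zdot A - E A))) [] =
      F * coordf (U (Z A) (add_mset 0 (mset ms))) - F * tds ms (E A)" for F A ms
  proof -
    have "tds ms (zdot A - E A) = coordf (U (Z A) (add_mset 0 (mset ms))) - tds ms (E A)"
      using tds_diff[OF loc assms(2)] by (simp add: zdot_def tds_coordf)
    moreover have "zero_form H [] = H" for H :: "('a, 'c) lfun"
      by (simp add: zero_form_def)
    ultimately show ?thesis
      by (simp only: fscale_def ftds_zero_form right_diff_distrib)
  qed
  then show ?thesis
    unfolding bdry by (simp add: sum_fun_apply sum_subtractf)
qed

text \<open>Neither the coefficients nor \<open>R\<close> contain time derivatives, so a derivative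
  with a time index sees only the displayed coordinates. All arrangements of one multiset contribute
  equally, and their number cancels \<open>symdelta\<close> up to the factor of the time index. The
  0 stands before \<open>\<nu>s\<close> because that is its place in \<open>euler\<close>.\<close>

lemma velocity_pS:
  assumes "F = (\<Sum>A\<in>UNIV. \<Sum>m\<le>N. \<Sum>ms\<in>words {1..<n} m.
      binomial_sum {1..<n} 1 N (shifted_euler n N g A k) ms * coordf (U (Z A) (add_mset 0 (mset ms)))) + R"
    and "local_in (jet_coords n UNIV {1..<n}) R"
  shows "pS j (ms @ 0 # \<nu>s) F = (case j of Z A \<Rightarrow>
      (if set (ms @ \<nu>s) \<subseteq> {1..<n}
       then (\<lambda>_. 1 / (real (length (ms @ \<nu>s)) + 1)) *
         binomial_sum {1..<n} 1 N (shifted_euler n N g A k) (ms @ \<nu>s) else 0) | _ \<Rightarrow> 0)"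
proof -
  define G where "G A = binomial_sum {1..<n} 1 N (shifted_euler n N g A k)" for A
  define W where "W = (\<Union>m\<le>N. words {1..<n} m)"
  define xs where "xs = ms @ \<nu>s"
  have finW: "finite W"
    unfolding W_def using finite_words by blast
  have locG: "local_in (jet_coords n I {1..<n}) (G A xs)" for A xs
    unfolding G_def by (intro local_in_binomial_sum local_in_shifted_euler prolonged_jet_coords)
  have symG: "symmetric_on_words (G A)" and vanG: "vanishes_beyond N (G A)" for A
    unfolding G_def
    by (intro symmetric_binomial_sum vanishes_binomial_sum symmetric_shifted_euler vanishes_shifted_euler)+
  have nonspatial: "U i (add_mset 0 M) \<notin> jet_coords n J {1..<n}" for i M J
    by (auto simp: jet_coords_def)
  have F: "F = (\<Sum>A\<in>UNIV. \<Sum>ms\<in>W. G A ms * coordf (U (Z A) (add_mset 0 (mset ms)))) + R"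
    unfolding assms(1) G_def[symmetric] W_def
    by (subst sum.UNION_disjoint) (auto simp: finite_words, auto simp: words_def)
  have sm: "smooth (G A ms * coordf c)" for A ms c
    by (intro smooth_mult local_in_smooth[OF locG] smooth_coordf)
  have "pd (U j (add_mset 0 M)) (G A ms * coordf c) =
      G A ms * (\<lambda>_. of_bool (U j (add_mset 0 M) = c))" for A ms c M
    using pd_not_depends[OF local_in_depends_on[OF locG] nonspatial]
    by (simp add: pd_mult local_in_smooth[OF locG] smooth_coordf pd_coordf)
  moreover have "pd (U j (add_mset 0 M)) R = 0" for M
    by (rule pd_not_depends[OF local_in_depends_on[OF assms(2)] nonspatial])
  ultimately have pdF: "pd (U j (add_mset 0 M)) F = (\<Sum>A\<in>UNIV. \<Sum>ms\<in>W. G A ms *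
      (\<lambda>_. of_bool (U j (add_mset 0 M) = U (Z A) (add_mset 0 (mset ms)))))" for M
    unfolding F
    by (simp add: pd_add pd_sum sm smooth_sum local_in_smooth[OF assms(2)])
  have "pS j (ms @ 0 # \<nu>s) F = (\<lambda>_. symdelta (ms @ 0 # \<nu>s)) * pd (U j (add_mset 0 (mset xs))) F"
    by (simp add: pS_def xs_def)
  also have "symdelta (ms @ 0 # \<nu>s) = symdelta (0 # xs)"
    by (rule symdelta_cong) (simp add: xs_def)
  finally have pS: "pS j (ms @ 0 # \<nu>s) F = (\<lambda>_. symdelta (0 # xs)) * pd (U j (add_mset 0 (mset xs))) F" .
  show ?thesis
  proof (cases "\<exists>B. j = Z B \<and> set xs \<subseteq> {1..<n}")
    case False
    have "U j (add_mset 0 (mset xs)) \<noteq> U (Z A) (add_mset 0 (mset ms))" if "ms \<in> W" for A ms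
    proof
      assume "U j (add_mset 0 (mset xs)) = U (Z A) (add_mset 0 (mset ms))"
      then have "j = Z A" "set xs = set ms"
        by (auto dest: mset_eq_setD)
      with that False show False
        by (auto simp: W_def words_def)
    qed
    then have "pd (U j (add_mset 0 (mset xs))) F = 0"
      unfolding pdF by (intro sum.neutral ballI) (auto simp: zero_fun_def times_fun_def)
    with False pS show ?thesis
      by (auto simp: xs_def split: fld.split)
  next
    case True
    then obtain B where B: "j = Z B" and xs: "set xs \<subseteq> {1..<n}" by blast
    have "pd (U j (add_mset 0 (mset xs))) F =
        (\<Sum>A\<in>UNIV. if A = B then \<Sum>ms\<in>W. G A ms * (\<lambda>_. of_bool (mset ms = mset xs)) else 0)"
      unfolding B pdF[unfolded B]
      by (intro sum.cong refl) (auto simp: zero_fun_def times_fun_def eq_commute[of "mset xs"])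
    also have "\<dots> = (\<Sum>ms\<in>W. G B ms * (\<lambda>_. of_bool (mset ms = mset xs)))"
      by (simp add: sum.delta)
    also have "\<dots> = (\<Sum>ms\<in>{ms\<in>W. mset ms = mset xs}. G B ms)"
      by (intro sum.mono_neutral_cong_right finW) (auto simp: zero_fun_def times_fun_def)
    \<comment> \<open>Beyond length \<open>N\<close> no tuple of \<open>W\<close> qualifies, but
      then the coefficient is zero as well.\<close>
    also have "\<dots> = (\<lambda>_. real (card (permutations_of_multiset (mset xs)))) * G B xs"
    proof (cases "length xs \<le> N")
      case True
      have "{ms\<in>W. mset ms = mset xs} = permutations_of_multiset (mset xs)"
      proof
        show "permutations_of_multiset (mset xs) \<subseteq> {ms\<in>W. mset ms = mset xs}"
        proof
          fix ys
          assume "ys \<in> permutations_of_multiset (mset xs)"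
          then have ys: "mset ys = mset xs"
            by (rule permutations_of_multisetD)
          then have "length ys = length xs" "set ys = set xs"
            by (blast dest: mset_eq_length mset_eq_setD)+
          with ys True xs show "ys \<in> {ms\<in>W. mset ms = mset xs}"
            by (simp add: W_def words_def)
        qed
      qed (auto simp: permutations_of_multiset_def)
      moreover have "G B ms = G B xs" if "ms \<in> permutations_of_multiset (mset xs)" for ms
        using symG[of B] permutations_of_multisetD[OF that] unfolding symmetric_on_words_def by blast
      ultimately show ?thesis
        by (simp add: of_nat_fun)
    next
      case False
      then have "ms \<notin> W" if "mset ms = mset xs" for ms
        using mset_eq_length[OF that] by (auto simp: W_def words_def)
      then have empty: "{ms\<in>W. mset ms = mset xs} = {}" by blast
      have "G B xs = 0"
        using False vanG[of B] by (simp add: vanishes_beyond_def)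
      then show ?thesis
        by (simp only: empty sum.empty mult_zero_right)
    qed
    finally have "pS j (ms @ 0 # \<nu>s) F =
        (\<lambda>_. symdelta (0 # xs)) * ((\<lambda>_. real (card (permutations_of_multiset (mset xs)))) * G B xs)"
      by (simp only: pS)
    moreover have "symdelta (0 # xs) * real (card (permutations_of_multiset (mset xs))) =
        1 / (real (length xs) + 1)"
    proof -
      have "0 \<notin> set xs" using xs by auto
      then show ?thesis
        by (simp add: symdelta_Cons symdelta_mult_card)
    qed
    ultimately show ?thesis
      using xs B by (simp add: times_fun_def xs_def G_def mult.assoc[symmetric])
  qed
qed

text \<open>By the absorption identity for binomial coefficients the numerical factors combine to
  1/(|ms|+1) times those of the tuple without the time index. What is left is the transform with -1
  of the transform with +1 of \<open>shifted_euler\<close>.\<close>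

lemma euler_velocity:
  assumes F: "F = (\<Sum>A\<in>UNIV. \<Sum>m\<le>N. \<Sum>ms\<in>words {1..<n} m.
      binomial_sum {1..<n} 1 N (shifted_euler n N g A k) ms * coordf (U (Z A) (add_mset 0 (mset ms)))) + R"
    and R: "local_in (jet_coords n UNIV {1..<n}) R"
  shows "euler n j (ms @ [0]) F = (case j of Z A \<Rightarrow>
      (if set ms \<subseteq> {1..<n} then (\<lambda>_. 1 / (real (length ms) + 1)) * shifted_euler n N g A k ms else 0)
    | _ \<Rightarrow> 0)"
proof (cases "\<exists>A. j = Z A \<and> set ms \<subseteq> {1..<n}")
  case False
  then have "pS j ((ms @ [0]) @ \<nu>s) F = 0" for \<nu>s
    using velocity_pS[OF assms, of j ms \<nu>s] by (auto split: fld.splits)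
  then have "euler n j (ms @ [0]) F = 0"
    by (simp only: euler_def tds_0 mult_zero_right if_cancel Sum_any.neutral)
  with False show ?thesis
    by (auto split: fld.split)
next
  case True
  then obtain A where j: "j = Z A" and ms: "set ms \<subseteq> {1..<n}" by blast
  define G where "G = binomial_sum {1..<n} 1 N (shifted_euler n N g A k)"
  define a where "a = length ms"
  have locG: "locals G" and vanG: "vanishes_beyond N G"
    unfolding G_def
    by (intro locals_binomial_sum locals_shifted_euler vanishes_binomial_sum vanishes_shifted_euler)+
  \<comment> \<open>Tuples with a further time index drop out, since each displayed coordinate
    carries exactly one.\<close>
  have pS: "pS j ((ms @ [0]) @ \<nu>s) F = (if set \<nu>s \<subseteq> {1..<n}
      then (\<lambda>_. 1 / (real (a + length \<nu>s) + 1)) * G (ms @ \<nu>s) else 0)" for \<nu>s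
    using velocity_pS[OF assms, of j ms \<nu>s] ms by (simp add: j G_def a_def)
  have "euler n j (ms @ [0]) F = (\<Sum>m\<le>N. \<Sum>\<nu>s\<in>words {1..<n} m.
      (\<lambda>_. of_nat ((length (ms @ [0]) + length \<nu>s) choose length (ms @ [0])) * (- 1) ^ length \<nu>s) *
      tds \<nu>s (pS j ((ms @ [0]) @ \<nu>s) F))"
    unfolding euler_def
  proof (rule sum_over_words)
    fix \<nu>s
    assume "(\<lambda>_. of_nat ((length (ms @ [0]) + length \<nu>s) choose length (ms @ [0])) * (- 1) ^ length \<nu>s) *
      tds \<nu>s (pS j ((ms @ [0]) @ \<nu>s) F) \<noteq> 0"
    then have nz: "pS j ((ms @ [0]) @ \<nu>s) F \<noteq> 0"
      by (metis tds_0 mult_zero_right)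
    then have "set \<nu>s \<subseteq> {1..<n}" "G (ms @ \<nu>s) \<noteq> 0"
      unfolding pS by (auto split: if_splits)
    with vanG show "\<nu>s \<in> lists {1..<n} \<and> length \<nu>s \<le> N"
      unfolding vanishes_beyond_def by (metis in_lists_conv_set length_append not_le subsetD trans_less_add2)
  qed auto
  also have "\<dots> = (\<Sum>m\<le>N. \<Sum>\<nu>s\<in>words {1..<n} m. (\<lambda>_. 1 / (real a + 1)) *
      ((\<lambda>_. of_nat ((a + m) choose a) * (- 1) ^ m) * tds \<nu>s (G (ms @ \<nu>s))))"
  proof (intro sum.cong refl)
    fix m \<nu>s
    assume "\<nu>s \<in> words {1..<n} m"
    then have \<nu>s: "set \<nu>s \<subseteq> {1..<n}" "length \<nu>s = m"
      by (auto simp: words_def)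
    have "Suc a * (Suc (a + m) choose Suc a) = Suc (a + m) * ((a + m) choose a)"
      by (rule Suc_times_binomial)
    then have "(real a + 1) * real (Suc (a + m) choose Suc a) = (real (a + m) + 1) * real ((a + m) choose a)"
      by (metis of_nat_Suc of_nat_mult add.commute)
    then have binom: "real (Suc (a + m) choose Suc a) * (1 / (real (a + m) + 1)) =
        1 / (real a + 1) * real ((a + m) choose a)"
      by (simp add: field_simps)
    have "tds \<nu>s (pS j ((ms @ [0]) @ \<nu>s) F) = (\<lambda>_. 1 / (real (a + m) + 1)) * tds \<nu>s (G (ms @ \<nu>s))"
      unfolding pS using \<nu>s by (simp add: tds_cmult localsD[OF locG])
    moreover have "real (Suc (a + m) choose Suc a) * (- 1) ^ m * (1 / (real (a + m) + 1) * t) =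
        1 / (real a + 1) * (real ((a + m) choose a) * (- 1) ^ m * t)" for t
    proof -
      have "real (Suc (a + m) choose Suc a) * (- 1) ^ m * (1 / (real (a + m) + 1) * t) =
          (real (Suc (a + m) choose Suc a) * (1 / (real (a + m) + 1))) * ((- 1) ^ m * t)"
        by (simp only: mult_ac)
      then show ?thesis
        unfolding binom by (simp only: mult_ac)
    qed
    moreover have "length (ms @ [0]) = Suc a" "Suc a + length \<nu>s = Suc (a + m)"
      using \<nu>s(2) by (simp_all add: a_def)
    ultimately show "(\<lambda>_. of_nat ((length (ms @ [0]) + length \<nu>s) choose length (ms @ [0])) * (- 1) ^ length \<nu>s) *
        tds \<nu>s (pS j ((ms @ [0]) @ \<nu>s) F) =
        (\<lambda>_. 1 / (real a + 1)) * ((\<lambda>_. of_nat ((a + m) choose a) * (- 1) ^ m) * tds \<nu>s (G (ms @ \<nu>s)))"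
      using \<nu>s(2) by (simp only: fun_eq_iff times_fun_apply simp_thms)
  qed
  also have "\<dots> = (\<lambda>_. 1 / (real a + 1)) * binomial_sum {1..<n} (- 1) N G ms"
    unfolding binomial_sum_def nabla_power[OF locG] sum_distrib_left a_def ..
  also have "binomial_sum {1..<n} (- 1) N G ms = shifted_euler n N g A k ms"
    using binomial_sum_inverse[OF locals_shifted_euler vanishes_shifted_euler, of "{1..<n}" "- 1" A k ms]
    by (simp add: G_def)
  finally show ?thesis
    using ms by (simp add: j a_def)
qed

end

section \<open>The homotopy operator on currents\<close>

text \<open>Captures the two features of \<open>dxf\<close> that let total derivatives pass through
  it: constant coefficients and the absence of vertical generators.\<close>

definition constant_dx_form :: "'i form \<Rightarrow> bool" where
  "constant_dx_form \<eta> \<longleftrightarrow> (\<forall>gs. (\<exists>c. \<eta> gs = (\<lambda>_. c)) \<and> (\<not> list_all is_Dx gs \<longrightarrow> \<eta> gs = 0))"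

lemma constant_dx_form_dxf: "constant_dx_form (dxf n \<mu>s)"
  unfolding constant_dx_form_def dxf_def by (auto simp: zero_fun_def)

lemma constant_dx_form_cscale:
  assumes "constant_dx_form \<eta>"
  shows "constant_dx_form (fscale (\<lambda>_. c) \<eta>)"
  unfolding constant_dx_form_def fscale_def
proof (intro allI conjI impI)
  fix gs
  obtain d where "\<eta> gs = (\<lambda>_. d)"
    using assms unfolding constant_dx_form_def by blast
  then show "\<exists>d. (\<lambda>_. c) * \<eta> gs = (\<lambda>_. d)"
    by (auto simp: times_fun_def)
  show "(\<lambda>_. c) * \<eta> gs = 0" if "\<not> list_all is_Dx gs"
    using assms that unfolding constant_dx_form_def by simp
qed

lemma constant_dx_form_td: "constant_dx_form \<eta> \<Longrightarrow> td \<nu> (\<eta> gs) = 0"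
  unfolding constant_dx_form_def by (metis td_const)

lemma constant_dx_form_local: "constant_dx_form \<eta> \<Longrightarrow> local_in D (\<eta> gs)"
  unfolding constant_dx_form_def by (metis local_in_const)

lemma constant_dx_form_DV: "constant_dx_form \<eta> \<Longrightarrow> DV i M \<in> set gs \<Longrightarrow> \<eta> gs = 0"
  unfolding constant_dx_form_def list_all_iff by (metis gen.disc(2))

lemma local_form_constant_dx_form: "constant_dx_form \<eta> \<Longrightarrow> local_form \<eta>"
  by (simp add: local_form_def constant_dx_form_local)

lemma ftd_constant_dx_form:
  assumes "constant_dx_form \<eta>"
  shows "ftd \<nu> \<eta> = 0"
proof
  fix gs
  have "(\<Sum>k<length gs. case gs ! k of Dx \<mu> \<Rightarrow> 0
     | DV i M \<Rightarrow> if \<nu> \<in># M then \<eta> (gs[k := DV i (M - {#\<nu>#})]) else 0) = 0"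
  proof (intro sum.neutral ballI)
    fix k
    assume "k \<in> {..<length gs}"
    then have "\<eta> (gs[k := DV i M]) = 0" for i M
      by (intro constant_dx_form_DV[OF assms, of i M]) (simp add: set_update_memI)
    then show "(case gs ! k of Dx \<mu> \<Rightarrow> 0
     | DV i M \<Rightarrow> if \<nu> \<in># M then \<eta> (gs[k := DV i (M - {#\<nu>#})]) else 0) = 0"
      by (simp split: gen.split)
  qed
  then show "ftd \<nu> \<eta> gs = (0 :: 'a form) gs"
    unfolding ftd_def by (simp add: constant_dx_form_td[OF assms] fun_apply)
qed

lemma ftds_fscale_constant_dx_form:
  assumes "constant_dx_form \<eta>" "local_in UNIV F"
  shows "ftds \<nu>s (fscale F \<eta>) = fscale (tds \<nu>s F) \<eta>"
proof (induction \<nu>s)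
  case (Cons \<nu> \<nu>s)
  have "ftd \<nu> (fscale (tds \<nu>s F) \<eta>) = fscale (td \<nu> (tds \<nu>s F)) \<eta> + fscale (tds \<nu>s F) (ftd \<nu> \<eta>)"
    by (intro ftd_fscale local_in_UNIV_tds assms local_form_constant_dx_form)
  then show ?case
    by (simp only: ftds_Cons tds_Cons Cons ftd_constant_dx_form[OF assms(1)] fscale_0_right add_0_right)
qed (simp add: ftds_Nil tds_Nil)

text \<open>The total derivative is an even derivation and annihilates
  \<open>\<eta>\<close>.\<close>

lemma ftd_wedge1:
  assumes "constant_dx_form \<eta>" "local_form \<alpha>"
  shows "ftd \<nu> (wedge1 \<alpha> \<eta>) = wedge1 (ftd \<nu> \<alpha>) \<eta>"
proof
  fix gs
  define s where "s k = (\<lambda>_ :: 'a coord \<Rightarrow> real. (- 1 :: real) ^ k)" for k :: nat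
  define del where "del k xs = take k xs @ drop (Suc k) xs" for k and xs :: "'a gen list"
  define d where "d g = (case g of Dx \<mu> \<Rightarrow> 0
     | DV i M \<Rightarrow> if \<nu> \<in># M then \<alpha> [DV i (M - {#\<nu>#})] else 0)" for g
  define e where "e j = (case gs ! j of Dx \<mu> \<Rightarrow> 0
     | DV i M \<Rightarrow> if \<nu> \<in># M then wedge1 \<alpha> \<eta> (gs[j := DV i (M - {#\<nu>#})]) else 0)" for j
  have wedge: "wedge1 \<beta> \<eta> xs = (\<Sum>k<length xs. s k * \<beta> [xs ! k] * \<eta> (del k xs))" for \<beta> xs
    unfolding wedge1_def s_def del_def ..
  have ftd1: "ftd \<nu> \<alpha> [g] = td \<nu> (\<alpha> [g]) + d g" for g
    unfolding ftd_def d_def by (cases g) (simp_all add: lessThan_Suc)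
  \<comment> \<open>In every other summand of the product the new vertical generator is fed to
    \<open>\<eta>\<close>.\<close>
  have upd: "wedge1 \<alpha> \<eta> (gs[j := DV i M]) = s j * \<alpha> [DV i M] * \<eta> (del j gs)" if "j < length gs" for i j M
  proof -
    have "s k * \<alpha> [gs[j := DV i M] ! k] * \<eta> (del k (gs[j := DV i M])) = 0" if "k \<noteq> j" "k < length gs" for k
    proof -
      have "DV i M \<in> set (del k (gs[j := DV i M]))"
      proof (cases "j < k")
        case True
        then have "take k (gs[j := DV i M]) ! j = DV i M" "j < length (take k (gs[j := DV i M]))"
          using \<open>j < length gs\<close> by simp_all
        then show ?thesis
          unfolding del_def by (metis UnI1 nth_mem set_append)
      next
        case False
        then have "drop (Suc k) (gs[j := DV i M]) ! (j - Suc k) = DV i M"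
          "j - Suc k < length (drop (Suc k) (gs[j := DV i M]))"
          using \<open>j < length gs\<close> \<open>k \<noteq> j\<close> by simp_all
        then show ?thesis
          unfolding del_def by (metis UnI2 nth_mem set_append)
      qed
      then show ?thesis
        by (simp add: constant_dx_form_DV[OF assms(1)])
    qed
    then have "wedge1 \<alpha> \<eta> (gs[j := DV i M]) =
        (\<Sum>k\<in>{j}. s k * \<alpha> [gs[j := DV i M] ! k] * \<eta> (del k (gs[j := DV i M])))"
      unfolding wedge using that by (intro sum.mono_neutral_right) auto
    then show ?thesis
      using that by (simp add: del_def)
  qed
  have e: "e j = s j * d (gs ! j) * \<eta> (del j gs)" if "j < length gs" for j
    using upd[OF that] unfolding e_def d_def by (simp split: gen.split)
  have "td \<nu> (s k * \<alpha> [g] * \<eta> xs) = s k * td \<nu> (\<alpha> [g]) * \<eta> xs" for k g xs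
    unfolding s_def
    by (simp add: td_mult td_const local_in_mult local_in_const local_formD[OF assms(2)]
        constant_dx_form_local[OF assms(1)] constant_dx_form_td[OF assms(1)])
  moreover have "local_in UNIV (s k * \<alpha> [g] * \<eta> xs)" for k g xs
    unfolding s_def
    by (intro local_in_intros local_formD[OF assms(2)] constant_dx_form_local[OF assms(1)])
  ultimately have td: "td \<nu> (wedge1 \<alpha> \<eta> gs) = (\<Sum>k<length gs. s k * td \<nu> (\<alpha> [gs ! k]) * \<eta> (del k gs))"
    unfolding wedge by (simp add: td_sum)
  have "ftd \<nu> (wedge1 \<alpha> \<eta>) gs = td \<nu> (wedge1 \<alpha> \<eta> gs) + (\<Sum>k<length gs. e k)"
    unfolding ftd_def e_def ..
  also have "\<dots> = (\<Sum>k<length gs. s k * (td \<nu> (\<alpha> [gs ! k]) + d (gs ! k)) * \<eta> (del k gs))"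
    unfolding td by (simp add: e distrib_left distrib_right sum.distrib)
  also have "\<dots> = wedge1 (ftd \<nu> \<alpha>) \<eta> gs"
    unfolding wedge ftd1 ..
  finally show "ftd \<nu> (wedge1 \<alpha> \<eta>) gs = wedge1 (ftd \<nu> \<alpha>) \<eta> gs" .
qed

lemma ftds_wedge1:
  assumes "constant_dx_form \<eta>" "local_form \<alpha>"
  shows "ftds \<nu>s (wedge1 \<alpha> \<eta>) = wedge1 (ftds \<nu>s \<alpha>) \<eta>"
  by (induction \<nu>s) (simp_all add: ftds_Nil ftds_Cons ftd_wedge1[OF assms(1)] local_form_ftds assms(2))

lemma local_form_wedge1:
  assumes "constant_dx_form \<eta>" "local_form \<alpha>"
  shows "local_form (wedge1 \<alpha> \<eta>)"
  unfolding local_form_def wedge1_def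
  by (intro allI local_in_intros local_formD[OF assms(2)] constant_dx_form_local[OF assms(1)])

lemma wedge1_add_left: "wedge1 (\<alpha> + \<beta>) \<eta> = wedge1 \<alpha> \<eta> + wedge1 \<beta> \<eta>"
  and wedge1_add_right: "wedge1 \<alpha> (\<eta> + \<theta>) = wedge1 \<alpha> \<eta> + wedge1 \<alpha> \<theta>"
  by (rule ext, simp add: wedge1_def fun_apply distrib_left distrib_right sum.distrib)+

lemma wedge1_0_left: "wedge1 0 \<eta> = 0" and wedge1_0_right: "wedge1 \<alpha> 0 = 0"
  by (rule ext, simp add: wedge1_def fun_apply)+

lemma wedge1_uminus_left: "wedge1 (- \<alpha>) \<eta> = - wedge1 \<alpha> \<eta>"
  and wedge1_uminus_right: "wedge1 \<alpha> (- \<eta>) = - wedge1 \<alpha> \<eta>"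
  by (rule ext, simp add: wedge1_def fun_apply sum_negf)+

lemma wedge1_fscale_left: "wedge1 (fscale F \<alpha>) \<eta> = fscale F (wedge1 \<alpha> \<eta>)"
  and wedge1_fscale_right: "wedge1 \<alpha> (fscale F \<eta>) = fscale F (wedge1 \<alpha> \<eta>)"
  by (rule ext, simp add: wedge1_def fscale_def sum_distrib_left mult_ac)+

lemma wedge1_diff_left: "wedge1 (\<alpha> - \<beta>) \<eta> = wedge1 \<alpha> \<eta> - wedge1 \<beta> \<eta>"
  using wedge1_add_left[of \<alpha> "- \<beta>" \<eta>] by (simp add: wedge1_uminus_left)

lemma wedge1_sum_left: "wedge1 (\<Sum>a\<in>A. f a) \<eta> = (\<Sum>a\<in>A. wedge1 (f a) \<eta>)"
  by (induction A rule: infinite_finite_induct) (simp_all add: wedge1_0_left wedge1_add_left)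

lemma wedge1_sum_right: "wedge1 \<alpha> (\<Sum>a\<in>A. f a) = (\<Sum>a\<in>A. wedge1 \<alpha> (f a))"
  by (induction A rule: infinite_finite_induct) (simp_all add: wedge1_0_right wedge1_add_right)

text \<open>Exchanging the first two entries composes the permutation with the transposition of the
  positions 0 and 1. Repeated or missing entries make both sides 0.\<close>

lemma levi_civita_swap: "levi_civita n (\<nu> # \<mu> # xs) = - levi_civita n (\<mu> # \<nu> # xs)"
proof (cases "length (\<mu> # \<nu> # xs) = n \<and> set (\<mu> # \<nu> # xs) = {..<n}")
  case True
  define f where "f ys i = (if i < n then ys ! i else i)" for ys and i :: nat
  define \<tau> where "\<tau> = Transposition.transpose (0 :: nat) 1"
  let ?ys = "\<mu> # \<nu> # xs"
  have len: "length ?ys = n" and set: "set ?ys = {..<n}"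
    using True by blast+
  from len have n: "2 \<le> n"
    by simp
  have perm: "f ?ys permutes {..<n}"
  proof (rule bij_imp_permutes)
    have "f ?ys ` {..<n} = (!) ?ys ` {..<length ?ys}"
      unfolding len by (intro image_cong refl) (simp add: f_def)
    also have "\<dots> = {..<n}"
      unfolding set[symmetric] by (force simp: set_conv_nth)
    finally have "f ?ys ` {..<n} = {..<n}" .
    then show "bij_betw (f ?ys) {..<n} {..<n}"
      by (simp add: bij_betw_def eq_card_imp_inj_on)
  qed (simp add: f_def)
  have tau: "\<tau> permutes {..<n}"
    unfolding \<tau>_def using n by (intro permutes_swap_id) auto
  have "f (\<nu> # \<mu> # xs) = f ?ys \<circ> \<tau>"
  proof
    fix i
    show "f (\<nu> # \<mu> # xs) i = (f ?ys \<circ> \<tau>) i"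
      using n by (auto simp: f_def \<tau>_def Transposition.transpose_def nth_Cons' )
  qed
  then have "sign (f (\<nu> # \<mu> # xs)) = - sign (f ?ys)"
    using sign_compose[of "f ?ys" \<tau>] perm tau
    by (simp add: permutes_imp_permutation[of "{..<n}"] \<tau>_def sign_swap_id)
  moreover have "levi_civita n zs = of_int (sign (f zs))" if "length zs = n" "set zs = {..<n}" for zs
    using that by (simp add: levi_civita_def f_def[abs_def])
  moreover have "length (\<nu> # \<mu> # xs) = n" "set (\<nu> # \<mu> # xs) = {..<n}"
    using len set by (simp_all add: insert_commute)
  ultimately show ?thesis
    using len set by (simp only: of_int_minus)
next
  case False
  then have "\<not> (length (\<nu> # \<mu> # xs) = n \<and> set (\<nu> # \<mu> # xs) = {..<n})"
    by (simp add: insert_commute)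
  with False show ?thesis
    unfolding levi_civita_def by (simp only: if_False neg_equal_0_iff_equal)
qed

lemma dxf_swap: "dxf n [\<nu>, \<mu>] = - dxf n [\<mu>, \<nu>]"
proof
  fix gs
  show "dxf n [\<nu>, \<mu>] gs = (- dxf n [\<mu>, \<nu>]) gs"
    by (simp add: dxf_def fun_eq_iff fun_apply levi_civita_swap[of n \<nu> \<mu>])
qed

text \<open>The 2 is the quotient 2!/1! of the factorials in \<open>dxf\<close> for two indices and
  for one.\<close>

lemma dgen_dxf: "dgen (Dx \<nu>) (dxf n [\<mu>]) = fscale (\<lambda>_. 2) (dxf n [\<mu>, \<nu>])"
  by (auto simp: dgen_def dxf_def fscale_def fun_eq_iff fun_apply)

lemma dgen_current_form:
  "dgen (Dx \<nu>) (current_form n S) = (\<Sum>\<mu><n. fscale (S \<mu>) (fscale (\<lambda>_. 2) (dxf n [\<mu>, \<nu>])))"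
proof -
  have "dgen (Dx \<nu>) (\<Sum>\<mu><n. fscale (S \<mu>) (dxf n [\<mu>])) = (\<Sum>\<mu><n. fscale (S \<mu>) (dgen (Dx \<nu>) (dxf n [\<mu>])))"
  proof
    fix gs
    show "dgen (Dx \<nu>) (\<Sum>\<mu><n. fscale (S \<mu>) (dxf n [\<mu>])) gs =
        (\<Sum>\<mu><n. fscale (S \<mu>) (dgen (Dx \<nu>) (dxf n [\<mu>]))) gs"
      by (simp only: dgen_def sum_fun_apply[where x = "Dx \<nu> # gs"] sum_fun_apply[where x = gs] fscale_def)
  qed
  then show ?thesis
    by (simp only: current_form_def dgen_dxf)
qed

lemma pS_sum:
  assumes "\<And>a. a \<in> A \<Longrightarrow> local_in UNIV (F a)"
  shows "pS i \<mu>s (\<Sum>a\<in>A. F a) = (\<Sum>a\<in>A. pS i \<mu>s (F a))"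
proof -
  have "pd c (\<Sum>a\<in>A. F a) = (\<Sum>a\<in>A. pd c (F a))" for c
    by (intro pd_sum local_in_smooth[of UNIV] assms)
  then show ?thesis
    by (simp only: pS_def sum_distrib_left)
qed

lemma pS_fscale_constant_dx_form:
  assumes "constant_dx_form \<eta>" "local_in UNIV F"
  shows "pS i \<mu>s (fscale F \<eta> gs) = fscale (pS i \<mu>s F) \<eta> gs"
proof -
  obtain c where "\<eta> gs = (\<lambda>_. c)"
    using assms(1) unfolding constant_dx_form_def by blast
  then show ?thesis
    using pS_cmult[OF assms(2), of i \<mu>s c] by (simp add: fscale_def mult.commute)
qed

text \<open>The forms \<open>\<eta> b\<close> do not depend on the fields, so the Euler-Lagrange
  derivative acts on the component functions. One order bound for all components makes the sums on
  both sides finite.\<close>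

lemma feuler_sum_fscale:
  fixes F :: "'b \<Rightarrow> 'i local_fn"
  assumes "finite B" "\<And>b. b \<in> B \<Longrightarrow> local_in (jet_coords n UNIV {..<n}) (F b)"
    and "\<And>b. b \<in> B \<Longrightarrow> constant_dx_form (\<eta> b)"
  shows "feuler n i \<mu>s (\<Sum>b\<in>B. fscale (F b) (\<eta> b)) = (\<Sum>b\<in>B. fscale (euler n i \<mu>s (F b)) (\<eta> b))"
proof -
  obtain N where N: "\<And>b. b \<in> B \<Longrightarrow> order_le N (F b)"
    using order_le_exists_family[of B "\<lambda>_. jet_coords n UNIV {..<n}" F] assms(1,2) by blast
  note loc = local_in_UNIV[OF assms(2)]
  define c where "c \<nu>s = (\<lambda>_ :: 'i coord \<Rightarrow> real.
    of_nat ((length \<mu>s + length \<nu>s) choose length \<mu>s) * (- 1) ^ length \<nu>s :: real)" for \<nu>s :: "nat list"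
  have pS: "(\<lambda>gs. pS i \<nu>s ((\<Sum>b\<in>B. fscale (F b) (\<eta> b)) gs)) = (\<Sum>b\<in>B. fscale (pS i \<nu>s (F b)) (\<eta> b))" for \<nu>s
  proof
    fix gs
    have "local_in UNIV (fscale (F b) (\<eta> b) gs)" if "b \<in> B" for b
      unfolding fscale_def using that by (intro local_in_mult loc constant_dx_form_local assms(3))
    then show "pS i \<nu>s ((\<Sum>b\<in>B. fscale (F b) (\<eta> b)) gs) = (\<Sum>b\<in>B. fscale (pS i \<nu>s (F b)) (\<eta> b)) gs"
      by (simp add: sum_fun_apply pS_sum pS_fscale_constant_dx_form loc assms(3))
  qed
  have ftds: "ftds \<nu>s (\<Sum>b\<in>B. fscale (pS i (\<mu>s @ \<nu>s) (F b)) (\<eta> b)) =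
      (\<Sum>b\<in>B. fscale (tds \<nu>s (pS i (\<mu>s @ \<nu>s) (F b))) (\<eta> b))" for \<nu>s
    by (subst ftds_sum)
      (simp_all add: local_form_fscale local_in_pS loc assms(3) local_form_constant_dx_form
        ftds_fscale_constant_dx_form)
  have zero: "pS i (\<mu>s @ \<nu>s) (F b) = 0" if "b \<in> B" "N < length \<nu>s" for b \<nu>s
    using vanishes_pS[OF N[OF that(1)], of i] that(2) by (simp add: vanishes_beyond_def)
  have "feuler n i \<mu>s (\<Sum>b\<in>B. fscale (F b) (\<eta> b)) =
      (\<Sum>m\<le>N. \<Sum>\<nu>s\<in>words {..<n} m. fscale (c \<nu>s) (\<Sum>b\<in>B. fscale (tds \<nu>s (pS i (\<mu>s @ \<nu>s) (F b))) (\<eta> b)))"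
    unfolding feuler_def pS ftds c_def[symmetric]
  proof (rule sum_over_words)
    fix \<nu>s
    assume nz: "fscale (c \<nu>s) (\<Sum>b\<in>B. fscale (tds \<nu>s (pS i (\<mu>s @ \<nu>s) (F b))) (\<eta> b)) \<noteq> 0"
      and "\<nu>s \<in> lists {..<n}"
    moreover have "length \<nu>s \<le> N"
      using nz zero by (intro leI notI) (simp add: tds_0 fscale_0_left fscale_0_right)
    ultimately show "\<nu>s \<in> lists {..<n} \<and> length \<nu>s \<le> N" by blast
  qed auto
  also have "\<dots> = (\<Sum>b\<in>B. fscale (\<Sum>m\<le>N. \<Sum>\<nu>s\<in>words {..<n} m. c \<nu>s * tds \<nu>s (pS i (\<mu>s @ \<nu>s) (F b))) (\<eta> b))"
    by (simp only: fscale_sum_left fscale_sum_right fscale_fscale sum.swap[of _ _ B])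
  also have "\<dots> = (\<Sum>b\<in>B. fscale (euler n i \<mu>s (F b)) (\<eta> b))"
  proof (rule sum.cong[OF refl])
    fix b
    assume b: "b \<in> B"
    have "euler n i \<mu>s (F b) = (\<Sum>m\<le>N. \<Sum>\<nu>s\<in>words {..<n} m. c \<nu>s * tds \<nu>s (pS i (\<mu>s @ \<nu>s) (F b)))"
      unfolding euler_def c_def[symmetric]
    proof (rule sum_over_words)
      fix \<nu>s
      assume nz: "c \<nu>s * tds \<nu>s (pS i (\<mu>s @ \<nu>s) (F b)) \<noteq> 0" and "\<nu>s \<in> lists {..<n}"
      moreover have "length \<nu>s \<le> N"
        using nz zero[OF b] by (intro leI notI) (simp add: tds_0)
      ultimately show "\<nu>s \<in> lists {..<n} \<and> length \<nu>s \<le> N" by blast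
    qed auto
    then show "fscale (\<Sum>m\<le>N. \<Sum>\<nu>s\<in>words {..<n} m. c \<nu>s * tds \<nu>s (pS i (\<mu>s @ \<nu>s) (F b))) (\<eta> b) =
        fscale (euler n i \<mu>s (F b)) (\<eta> b)"
      by simp
  qed
  finally show ?thesis .
qed

text \<open>These are the T^{\<mu>\<nu>}. The weight is that of \<open>homotopy\<close> at p = n -
  1.\<close>

definition homotopy_coeff :: "nat \<Rightarrow> 'i set \<Rightarrow> nat \<Rightarrow> (nat \<Rightarrow> 'i local_fn) \<Rightarrow> nat \<Rightarrow> nat \<Rightarrow> 'i form" where
  "homotopy_coeff n I N S \<mu> \<nu> = (\<Sum>m\<le>N. \<Sum>ms\<in>words {..<n} m. fscale (\<lambda>_. (real m + 1) / (real m + 2))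
     (ftds ms (\<Sum>i\<in>I. fscale (euler n i (ms @ [\<nu>]) (S \<mu>)) (gen_form (DV i {#})))))"

lemma homotopy_current_form:
  fixes I :: "('a, 'c) fld set"
  assumes "1 \<le> n" "finite I" "\<And>\<mu>. \<mu> < n \<Longrightarrow> local_in (jet_coords n UNIV {..<n}) (S \<mu>)"
    and "\<And>\<mu>. \<mu> < n \<Longrightarrow> order_le N (S \<mu>)"
  shows "homotopy n I (n - 1) (current_form n S) =
    (\<Sum>\<mu><n. \<Sum>\<nu><n. wedge1 (homotopy_coeff n I N S \<mu> \<nu>) (fscale (\<lambda>_. 2) (dxf n [\<mu>, \<nu>])))"
proof -
  define \<eta> :: "nat \<Rightarrow> nat \<Rightarrow> ('a, 'c) lform" where "\<eta> \<mu> \<nu> = fscale (\<lambda>_. 2) (dxf n [\<mu>, \<nu>])" for \<mu> \<nu>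
  have \<eta>: "constant_dx_form (\<eta> \<mu> \<nu>)" for \<mu> \<nu>
    unfolding \<eta>_def by (intro constant_dx_form_cscale constant_dx_form_dxf)
  define \<theta> where "\<theta> ms \<mu> \<nu> = (\<Sum>i\<in>I. fscale (euler n i (ms @ [\<nu>]) (S \<mu>)) (gen_form (DV i {#})))" for ms \<mu> \<nu>
  have loc\<theta>: "local_form (\<theta> ms \<mu> \<nu>)" if "\<mu> < n" for ms \<mu> \<nu>
    unfolding \<theta>_def using assms(3)[OF that]
    by (intro local_form_sum local_form_fscale local_form_gen_form local_in_UNIV[OF local_in_euler]) auto
  define c where "c ms = (\<lambda>_ :: ('a, 'c) fld coord \<Rightarrow> real. (of_nat (length ms) + 1) / (of_nat n - of_nat (n - 1) + of_nat (length ms) + 1) :: real)" for ms :: "nat list"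
  \<comment> \<open>The natural number subtraction is exact by \<open>1 \<le> n\<close>, so n - p =
    1 in the weight.\<close>
  have c: "c ms = (\<lambda>_. (real m + 1) / (real m + 2))" if "ms \<in> words {..<n} m" for ms m
    using that assms(1) by (auto simp: c_def words_def of_nat_diff fun_eq_iff)
  have inner: "ftds ms (\<Sum>i\<in>I. \<Sum>\<nu><n. wedge1 (gen_form (DV i {#}))
      (feuler n i (ms @ [\<nu>]) (dgen (Dx \<nu>) (current_form n S)))) =
      (\<Sum>\<mu><n. \<Sum>\<nu><n. wedge1 (ftds ms (\<theta> ms \<mu> \<nu>)) (\<eta> \<mu> \<nu>))" for ms
  proof -
    have "feuler n i (ms @ [\<nu>]) (dgen (Dx \<nu>) (current_form n S)) =
        (\<Sum>\<mu><n. fscale (euler n i (ms @ [\<nu>]) (S \<mu>)) (\<eta> \<mu> \<nu>))" for i \<nu>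
      unfolding dgen_current_form \<eta>_def[symmetric] by (intro feuler_sum_fscale \<eta> assms(3)) auto
    then have "(\<Sum>i\<in>I. \<Sum>\<nu><n. wedge1 (gen_form (DV i {#})) (feuler n i (ms @ [\<nu>]) (dgen (Dx \<nu>) (current_form n S)))) =
        (\<Sum>i\<in>I. \<Sum>\<nu><n. \<Sum>\<mu><n. wedge1 (fscale (euler n i (ms @ [\<nu>]) (S \<mu>)) (gen_form (DV i {#}))) (\<eta> \<mu> \<nu>))"
      by (simp only: wedge1_sum_right wedge1_fscale_right wedge1_fscale_left)
    also have "\<dots> = (\<Sum>i\<in>I. \<Sum>\<mu><n. \<Sum>\<nu><n. wedge1 (fscale (euler n i (ms @ [\<nu>]) (S \<mu>)) (gen_form (DV i {#}))) (\<eta> \<mu> \<nu>))"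
      by (intro sum.cong refl sum.swap)
    also have "\<dots> = (\<Sum>\<mu><n. \<Sum>\<nu><n. wedge1 (\<theta> ms \<mu> \<nu>) (\<eta> \<mu> \<nu>))"
      unfolding \<theta>_def wedge1_sum_left
      by (subst sum.swap, intro sum.cong refl, rule sum.swap)
    finally have "ftds ms (\<Sum>i\<in>I. \<Sum>\<nu><n. wedge1 (gen_form (DV i {#}))
        (feuler n i (ms @ [\<nu>]) (dgen (Dx \<nu>) (current_form n S)))) =
        ftds ms (\<Sum>\<mu><n. \<Sum>\<nu><n. wedge1 (\<theta> ms \<mu> \<nu>) (\<eta> \<mu> \<nu>))"
      by (simp only:)
    also have "\<dots> = (\<Sum>\<mu><n. ftds ms (\<Sum>\<nu><n. wedge1 (\<theta> ms \<mu> \<nu>) (\<eta> \<mu> \<nu>)))"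
      by (rule ftds_sum) (auto intro!: local_form_sum local_form_wedge1 loc\<theta> \<eta>)
    also have "\<dots> = (\<Sum>\<mu><n. \<Sum>\<nu><n. ftds ms (wedge1 (\<theta> ms \<mu> \<nu>) (\<eta> \<mu> \<nu>)))"
      by (intro sum.cong refl ftds_sum) (auto intro!: local_form_wedge1 loc\<theta> \<eta>)
    also have "\<dots> = (\<Sum>\<mu><n. \<Sum>\<nu><n. wedge1 (ftds ms (\<theta> ms \<mu> \<nu>)) (\<eta> \<mu> \<nu>))"
      by (intro sum.cong refl ftds_wedge1 \<eta> loc\<theta>) auto
    finally show ?thesis .
  qed
  have "homotopy n I (n - 1) (current_form n S) =
      sum_over (lists {..<n}) (\<lambda>ms. fscale (c ms) (\<Sum>\<mu><n. \<Sum>\<nu><n. wedge1 (ftds ms (\<theta> ms \<mu> \<nu>)) (\<eta> \<mu> \<nu>)))"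
    unfolding homotopy_def inner c_def ..
  also have "\<dots> = (\<Sum>m\<le>N. \<Sum>ms\<in>words {..<n} m.
      fscale (c ms) (\<Sum>\<mu><n. \<Sum>\<nu><n. wedge1 (ftds ms (\<theta> ms \<mu> \<nu>)) (\<eta> \<mu> \<nu>)))"
  proof (rule sum_over_words)
    fix ms
    assume "ms \<in> lists {..<n}"
      and nz: "fscale (c ms) (\<Sum>\<mu><n. \<Sum>\<nu><n. wedge1 (ftds ms (\<theta> ms \<mu> \<nu>)) (\<eta> \<mu> \<nu>)) \<noteq> 0"
    moreover have "length ms \<le> N"
    proof (rule leI, rule notI)
      assume "N < length ms"
      then have "\<theta> ms \<mu> \<nu> = 0" if "\<mu> < n" for \<mu> \<nu>
        unfolding \<theta>_def using euler_vanishes[OF assms(4)[OF that], of "ms @ [\<nu>]"]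
        by (intro sum.neutral ballI) (simp add: fscale_0_left)
      with nz show False
        by (simp add: ftds_0 wedge1_0_left fscale_0_right)
    qed
    ultimately show "ms \<in> lists {..<n} \<and> length ms \<le> N" by blast
  qed auto
  also have "\<dots> = (\<Sum>m\<le>N. \<Sum>ms\<in>words {..<n} m. \<Sum>\<mu><n. \<Sum>\<nu><n.
      wedge1 (fscale (\<lambda>_. (real m + 1) / (real m + 2)) (ftds ms (\<theta> ms \<mu> \<nu>))) (\<eta> \<mu> \<nu>))"
    by (intro sum.cong refl) (simp only: c fscale_sum_right wedge1_fscale_left)
  also have "\<dots> = (\<Sum>\<mu><n. \<Sum>\<nu><n. \<Sum>m\<le>N. \<Sum>ms\<in>words {..<n} m.
      wedge1 (fscale (\<lambda>_. (real m + 1) / (real m + 2)) (ftds ms (\<theta> ms \<mu> \<nu>))) (\<eta> \<mu> \<nu>))"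
    by (simp only: sum.swap[of _ "{..<n}" "words {..<n} _"] sum.swap[of _ "{..<n}" "{..N}"])
  finally show ?thesis
    unfolding homotopy_coeff_def \<theta>_def[symmetric] \<eta>_def[symmetric] wedge1_sum_left .
qed

section \<open>Vertical 1-forms and uniqueness of the components\<close>

definition vertical_form :: "nat \<Rightarrow> 'i form \<Rightarrow> bool" where
  "vertical_form n \<alpha> \<longleftrightarrow> (\<forall>gs. local_in (jet_coords n UNIV {..<n}) (\<alpha> gs)) \<and> finite {gs. \<alpha> gs \<noteq> 0} \<and>
     (\<forall>gs. \<alpha> gs \<noteq> 0 \<longrightarrow> (\<exists>i M. gs = [DV i M] \<and> set_mset M \<subseteq> {..<n}))"

text \<open>Antisymmetry is automatic here: exchanging two entries takes a word of length at least
  2, on which the form vanishes.\<close>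

lemma is_form_0_1_iff: "is_form n 0 1 \<alpha> \<longleftrightarrow> vertical_form n \<alpha>"
proof
  assume form: "is_form n 0 1 \<alpha>"
  have "\<exists>i M. gs = [DV i M] \<and> set_mset M \<subseteq> {..<n}" if "\<alpha> gs \<noteq> 0" for gs
  proof -
    from form that have gs: "set gs \<subseteq> gens n" "length (filter is_Dx gs) = 0" "length (filter (\<lambda>g. \<not> is_Dx g) gs) = 1"
      unfolding is_form_def by blast+
    from gs(2,3) have "length gs = 1"
      using sum_length_filter_compl[of is_Dx gs] by simp
    then obtain g where g: "gs = [g]"
      by (metis One_nat_def length_0_conv length_Suc_conv)
    with gs show ?thesis
      by (cases g) (auto simp: gens_def)
  qed
  with form show "vertical_form n \<alpha>"
    unfolding vertical_form_def is_form_def by blast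
next
  assume "vertical_form n \<alpha>"
  note rhs = this[unfolded vertical_form_def]
  show "is_form n 0 1 \<alpha>"
    unfolding is_form_def
  proof (intro conjI allI impI)
    fix gs :: "'a gen list" and i j :: nat
    assume ij: "i < j \<and> j < length gs"
    then have "gs \<noteq> [g]" "gs[i := gs ! j, j := gs ! i] \<noteq> [g]" for g
      by (auto dest!: arg_cong[where f = length])
    with rhs have "\<alpha> gs = 0" "\<alpha> (gs[i := gs ! j, j := gs ! i]) = 0"
      by blast+
    then show "\<alpha> (gs[i := gs ! j, j := gs ! i]) = - \<alpha> gs"
      by simp
  qed (use rhs in \<open>auto simp: gens_def\<close>)
qed

lemma vertical_form_0: "vertical_form n 0"
  by (simp add: vertical_form_def fun_apply local_in_0)

lemma vertical_form_add:
  assumes "vertical_form n \<alpha>" "vertical_form n \<beta>"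
  shows "vertical_form n (\<alpha> + \<beta>)"
proof -
  have "{gs. (\<alpha> + \<beta>) gs \<noteq> 0} \<subseteq> {gs. \<alpha> gs \<noteq> 0} \<union> {gs. \<beta> gs \<noteq> 0}"
    by (auto simp: fun_apply)
  moreover have "finite ({gs. \<alpha> gs \<noteq> 0} \<union> {gs. \<beta> gs \<noteq> 0})"
    using assms by (simp add: vertical_form_def)
  ultimately show ?thesis
    using assms finite_subset unfolding vertical_form_def
    by (auto simp: fun_apply intro: local_in_add)
qed

lemma vertical_form_fscale:
  assumes "local_in (jet_coords n UNIV {..<n}) F" "vertical_form n \<alpha>"
  shows "vertical_form n (fscale F \<alpha>)"
proof -
  have "{gs. fscale F \<alpha> gs \<noteq> 0} \<subseteq> {gs. \<alpha> gs \<noteq> 0}"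
    by (auto simp: fscale_def)
  moreover have "finite {gs. \<alpha> gs \<noteq> 0}"
    using assms by (simp add: vertical_form_def)
  ultimately show ?thesis
    using assms finite_subset unfolding vertical_form_def
    by (auto simp: fscale_def intro: local_in_mult)
qed

lemma vertical_form_uminus: "vertical_form n \<alpha> \<Longrightarrow> vertical_form n (- \<alpha>)"
  using vertical_form_fscale[OF local_in_const[of _ "-1"], of n \<alpha>]
  by (simp add: fscale_def fun_Compl_def times_fun_def)

lemma vertical_form_diff: "vertical_form n \<alpha> \<Longrightarrow> vertical_form n \<beta> \<Longrightarrow> vertical_form n (\<alpha> - \<beta>)"
  using vertical_form_add[OF _ vertical_form_uminus] by (metis add_uminus_conv_diff)

lemma vertical_form_sum: "(\<And>a. a \<in> A \<Longrightarrow> vertical_form n (f a)) \<Longrightarrow> vertical_form n (\<Sum>a\<in>A. f a)"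
  by (induction A rule: infinite_finite_induct) (simp_all add: vertical_form_0 vertical_form_add)

lemma vertical_form_gen_form: "set_mset M \<subseteq> {..<n} \<Longrightarrow> vertical_form n (gen_form (DV i M))"
  by (simp add: vertical_form_def gen_form_def local_in_0 local_in_1)

lemma vertical_form_ftd:
  assumes "vertical_form n \<alpha>" "\<nu> < n"
  shows "vertical_form n (ftd \<nu> \<alpha>)"
proof -
  let ?D = "jet_coords n UNIV {..<n}"
  from assms(1) have loc: "local_in ?D (\<alpha> gs)" and fin: "finite {gs. \<alpha> gs \<noteq> 0}"
    and supp: "\<alpha> gs \<noteq> 0 \<Longrightarrow> \<exists>i M. gs = [DV i M] \<and> set_mset M \<subseteq> {..<n}" for gs
    by (simp_all add: vertical_form_def)
  have single: "ftd \<nu> \<alpha> [g] = td \<nu> (\<alpha> [g]) +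
      (case g of Dx \<mu> \<Rightarrow> 0 | DV i M \<Rightarrow> if \<nu> \<in># M then \<alpha> [DV i (M - {#\<nu>#})] else 0)" for g
    unfolding ftd_def by (cases g) (simp_all add: lessThan_Suc)
  have ftd_supp: "\<exists>i M. gs = [DV i M] \<and> set_mset M \<subseteq> {..<n} \<and>
      (\<alpha> [DV i M] \<noteq> 0 \<or> (\<exists>M'. M = add_mset \<nu> M' \<and> \<alpha> [DV i M'] \<noteq> 0))"
    if nz: "ftd \<nu> \<alpha> gs \<noteq> 0" for gs
  proof -
    have "\<exists>g. gs = [g]"
    proof (rule ccontr)
      assume not: "\<nexists>g. gs = [g]"
      then have "\<alpha> gs = 0" "\<alpha> (gs[k := h]) = 0" for k h
        using supp by (metis, metis length_Suc_conv length_list_update list.size(3) length_0_conv)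
      then have "ftd \<nu> \<alpha> gs = 0"
        unfolding ftd_def by (auto simp: td_0 split: gen.split intro!: sum.neutral)
      with nz show False by simp
    qed
    then obtain g where g: "gs = [g]" by blast
    show ?thesis
    proof (cases g)
      case (Dx \<mu>)
      then have "\<alpha> [g] = 0"
        using supp[of "[g]"] by auto
      with nz show ?thesis
        by (simp add: g single Dx td_0)
    next
      case (DV i M)
      consider "\<alpha> [DV i M] \<noteq> 0" | "\<nu> \<in># M" "\<alpha> [DV i (M - {#\<nu>#})] \<noteq> 0"
        using nz by (cases "\<alpha> [DV i M] = 0") (auto simp: g single DV td_0 split: if_splits)
      then show ?thesis
      proof cases
        case 1
        with supp[OF 1] show ?thesis by (auto simp: g DV)
      next
        case 2
        then obtain M' where M: "M = add_mset \<nu> M'"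
          by (metis insert_DiffM)
        with 2 supp[of "[DV i M']"] assms(2) show ?thesis
          by (auto simp: g DV)
      qed
    qed
  qed
  \<comment> \<open>The support grows at most by prolonging each of its generators with
    \<open>\<nu>\<close>. The value \<open>[]\<close> is only a filler for horizontal
    generators.\<close>
  have "{gs. ftd \<nu> \<alpha> gs \<noteq> 0} \<subseteq> {gs. \<alpha> gs \<noteq> 0} \<union>
      (\<lambda>gs. case hd gs of DV i M \<Rightarrow> [DV i (add_mset \<nu> M)] | _ \<Rightarrow> []) ` {gs. \<alpha> gs \<noteq> 0}"
  proof
    fix gs
    assume "gs \<in> {gs. ftd \<nu> \<alpha> gs \<noteq> 0}"
    then obtain i M where gs: "gs = [DV i M]" "\<alpha> [DV i M] \<noteq> 0 \<or> (\<exists>M'. M = add_mset \<nu> M' \<and> \<alpha> [DV i M'] \<noteq> 0)"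
      using ftd_supp by blast
    then show "gs \<in> {gs. \<alpha> gs \<noteq> 0} \<union>
      (\<lambda>gs. case hd gs of DV i M \<Rightarrow> [DV i (add_mset \<nu> M)] | _ \<Rightarrow> []) ` {gs. \<alpha> gs \<noteq> 0}"
      by (force simp: image_iff)
  qed
  with fin have "finite {gs. ftd \<nu> \<alpha> gs \<noteq> 0}"
    by (metis finite_UnI finite_imageI finite_subset)
  moreover have "local_in ?D (ftd \<nu> \<alpha> gs)" for gs
    unfolding ftd_def
  proof (intro local_in_add local_in_sum local_in_td[OF loc prolonged_jet_coords])
    show "\<nu> \<in> {..<n}" using assms(2) by simp
    show "local_in ?D (case gs ! k of Dx \<mu> \<Rightarrow> 0
       | DV i M \<Rightarrow> if \<nu> \<in># M then \<alpha> (gs[k := DV i (M - {#\<nu>#})]) else 0)" for k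
      by (cases "gs ! k") (simp_all add: loc local_in_0)
  qed
  ultimately show ?thesis
    unfolding vertical_form_def using ftd_supp by blast
qed

lemma vertical_form_ftds: "vertical_form n \<alpha> \<Longrightarrow> set \<nu>s \<subseteq> {..<n} \<Longrightarrow> vertical_form n (ftds \<nu>s \<alpha>)"
  by (induction \<nu>s) (simp_all add: ftds_Nil ftds_Cons vertical_form_ftd)

lemma vertical_form_homotopy_coeff:
  assumes "local_in (jet_coords n UNIV {..<n}) (S \<mu>)"
  shows "vertical_form n (homotopy_coeff n I N S \<mu> \<nu>)"
  unfolding homotopy_coeff_def
  by (intro vertical_form_sum vertical_form_fscale local_in_const vertical_form_ftds local_in_euler[OF assms]
      vertical_form_gen_form) (auto simp: words_def)

text \<open>A component is read off on one vertical generator followed by the horizontal generators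
  other than those of \<mu> and \<nu>. Only the orders (\<mu>, \<nu>) and (\<nu>, \<mu>) survive.
  They contribute equally, since both factors change sign, and so cancel the 1/2! in
  \<open>dxf\<close>.\<close>

lemma components2_unique:
  assumes "components2 n \<omega> k" "components2 n \<omega> k'"
  shows "k = k'"
proof -
  have eval: "\<omega> (DV i M # map Dx r) = l \<mu> \<nu> [DV i M] * (\<lambda>_. levi_civita n (\<mu> # \<nu> # r))"
    if l: "components2 n \<omega> l" and \<mu>\<nu>: "\<mu> < n" "\<nu> < n" "\<mu> \<noteq> \<nu>" and r: "set r = {..<n} - {\<mu>, \<nu>}"
    for l i M \<mu> \<nu> r
  proof -
    from l have form: "vertical_form n (l \<alpha> \<beta>)" and anti: "l \<alpha> \<beta> = - l \<beta> \<alpha>"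
      and \<omega>: "\<omega> = (\<Sum>\<mu><n. \<Sum>\<nu><n. wedge1 (l \<mu> \<nu>) (dxf n [\<mu>, \<nu>]))" for \<alpha> \<beta>
      unfolding components2_def is_form_0_1_iff by blast+
    define f where "f = (\<lambda>(\<alpha>, \<beta>). l \<alpha> \<beta> [DV i M] * (\<lambda>_. levi_civita n (\<alpha> # \<beta> # r) / 2))"
    have "wedge1 (l \<alpha> \<beta>) (dxf n [\<alpha>, \<beta>]) (DV i M # map Dx r) = f (\<alpha>, \<beta>)" for \<alpha> \<beta>
    proof -
      \<comment> \<open>A vertical form vanishes on horizontal generators, so only the first summand
        of the exterior product remains.\<close>
      have "l \<alpha> \<beta> [(DV i M # map Dx r) ! k] = 0" if "0 < k" "k < Suc (length r)" for k
        using form[of \<alpha> \<beta>] that by (auto simp: vertical_form_def nth_Cons')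
      then have "wedge1 (l \<alpha> \<beta>) (dxf n [\<alpha>, \<beta>]) (DV i M # map Dx r) =
          (\<Sum>k\<in>{0}. (\<lambda>_. (- 1) ^ k) * l \<alpha> \<beta> [(DV i M # map Dx r) ! k] *
            dxf n [\<alpha>, \<beta>] (take k (DV i M # map Dx r) @ drop (Suc k) (DV i M # map Dx r)))"
        unfolding wedge1_def by (intro sum.mono_neutral_right) auto
      also have "\<dots> = f (\<alpha>, \<beta>)"
        by (simp add: f_def dxf_def list_all_iff comp_def flip: one_fun_def)
      finally show ?thesis .
    qed
    then have "\<omega> (DV i M # map Dx r) = (\<Sum>\<alpha><n. \<Sum>\<beta><n. f (\<alpha>, \<beta>))"
      unfolding \<omega> by (simp add: sum_fun_apply)
    also have "\<dots> = (\<Sum>x\<in>{..<n} \<times> {..<n}. f x)"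
      by (simp add: sum.cartesian_product)
    also have "\<dots> = (\<Sum>x\<in>{(\<mu>, \<nu>), (\<nu>, \<mu>)}. f x)"
    proof (rule sum.mono_neutral_right)
      show "\<forall>x\<in>{..<n} \<times> {..<n} - {(\<mu>, \<nu>), (\<nu>, \<mu>)}. f x = 0"
      proof
        fix x
        assume x: "x \<in> {..<n} \<times> {..<n} - {(\<mu>, \<nu>), (\<nu>, \<mu>)}"
        obtain \<alpha> \<beta> where \<alpha>\<beta>: "x = (\<alpha>, \<beta>)" by (cases x)
        have "\<not> set (\<alpha> # \<beta> # r) = {..<n}"
        proof
          assume "set (\<alpha> # \<beta> # r) = {..<n}"
          then have "{\<mu>, \<nu>} \<subseteq> {\<alpha>, \<beta>}"
            using \<mu>\<nu> r by auto
          with \<mu>\<nu>(3) have "(\<alpha>, \<beta>) = (\<mu>, \<nu>) \<or> (\<alpha>, \<beta>) = (\<nu>, \<mu>)"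
            by auto
          with x \<alpha>\<beta> show False by auto
        qed
        then show "f x = 0"
          by (simp add: f_def \<alpha>\<beta> levi_civita_def flip: zero_fun_def)
      qed
    qed (use \<mu>\<nu> in auto)
    also have "\<dots> = f (\<mu>, \<nu>) + f (\<nu>, \<mu>)"
      using \<mu>\<nu>(3) by simp
    also have "\<dots> = l \<mu> \<nu> [DV i M] * (\<lambda>_. levi_civita n (\<mu> # \<nu> # r))"
      using anti[of \<nu> \<mu>] levi_civita_swap[of n \<nu> \<mu> r]
      by (simp add: f_def fun_eq_iff fun_apply)
    finally show ?thesis .
  qed
  have zero: "l \<mu> \<nu> = 0" if l: "components2 n \<omega> l" and range: "\<not> (\<mu> < n \<and> \<nu> < n \<and> \<mu> \<noteq> \<nu>)" for l \<mu> \<nu>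
  proof -
    from l have anti: "l \<alpha> \<beta> = - l \<beta> \<alpha>" and out: "n \<le> \<alpha> \<Longrightarrow> l \<alpha> \<beta> = 0" for \<alpha> \<beta>
      unfolding components2_def by blast+
    consider "n \<le> \<mu>" | "n \<le> \<nu>" | "\<mu> = \<nu>"
      using range by (meson not_less)
    then show ?thesis
    proof cases
      case 2
      then show ?thesis using anti[of \<mu> \<nu>] out[of \<nu> \<mu>] by simp
    next
      case 3
      then have "l \<mu> \<nu> gs p = - l \<mu> \<nu> gs p" for gs p
        using anti[of \<mu> \<nu>] by (metis uminus_apply)
      then show ?thesis
        by (simp add: fun_eq_iff fun_apply)
    qed (simp add: out)
  qed
  show "k = k'"
  proof (intro ext)
    fix \<mu> \<nu> gs p
    show "k \<mu> \<nu> gs p = k' \<mu> \<nu> gs p"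
    proof (cases "\<mu> < n \<and> \<nu> < n \<and> \<mu> \<noteq> \<nu> \<and> (\<exists>i M. gs = [DV i M])")
      case True
      then obtain i M where gs: "gs = [DV i M]" by blast
      obtain r where r: "set r = {..<n} - {\<mu>, \<nu>}" "distinct r"
        using finite_distinct_list[of "{..<n} - {\<mu>, \<nu>}"] by auto
      have "distinct (\<mu> # \<nu> # r)" "set (\<mu> # \<nu> # r) = {..<n}"
        using r True by auto
      then have "length (\<mu> # \<nu> # r) = n" "set (\<mu> # \<nu> # r) = {..<n}"
        by (metis card_lessThan distinct_card)+
      then have "levi_civita n (\<mu> # \<nu> # r) \<noteq> 0"
        by (simp add: levi_civita_def sign_def)
      moreover have "k \<mu> \<nu> gs p * levi_civita n (\<mu> # \<nu> # r) = k' \<mu> \<nu> gs p * levi_civita n (\<mu> # \<nu> # r)"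
        using eval[OF assms(1), of \<mu> \<nu> r i M] eval[OF assms(2), of \<mu> \<nu> r i M] True r(1)
        by (auto simp: gs fun_eq_iff fun_apply)
      ultimately show ?thesis by simp
    next
      case False
      have "l \<mu> \<nu> gs = 0" if l: "components2 n \<omega> l" for l
      proof (cases "\<mu> < n \<and> \<nu> < n \<and> \<mu> \<noteq> \<nu>")
        case True
        have "vertical_form n (l \<mu> \<nu>)"
          using l unfolding components2_def is_form_0_1_iff by blast
        with True False show ?thesis
          unfolding vertical_form_def by blast
      next
        case False
        then show ?thesis
          using zero[OF l] by (simp add: fun_apply)
      qed
      with assms show ?thesis by simp
    qed
  qed
qed

section \<open>Surface charges\<close>

lemma sum_fields:
  fixes f :: "('a::finite, 'c::finite) fld \<Rightarrow> 'x::comm_monoid_add"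
  shows "(\<Sum>j\<in>fields. f j) = (\<Sum>A\<in>UNIV. f (Z A)) + (\<Sum>a\<in>UNIV. f (Lam a))"
  unfolding fields_def
  by (subst sum.union_disjoint) (auto simp: sum.reindex inj_def)

lemma finite_fields: "finite (fields :: ('a::finite, 'c::finite) fld set)"
  by (simp add: fields_def)

lemma jet_coords_mono: "I \<subseteq> I' \<Longrightarrow> A \<subseteq> A' \<Longrightarrow> jet_coords n I A \<subseteq> jet_coords n I' A'"
  by (auto simp: jet_coords_def)

lemma euler_cmult:
  assumes "local_in (jet_coords n I A) F" "A \<subseteq> {..<n}"
  shows "euler n i \<mu>s ((\<lambda>_. x) * F) = (\<lambda>_. x) * euler n i \<mu>s F"
proof -
  obtain N where N: "order_le N F"
    using order_le_exists[OF assms(1)] .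
  have loc: "local_in (jet_coords n I A) ((\<lambda>_. x) * F)"
    by (intro local_in_intros assms)
  have N': "order_le N ((\<lambda>_. x) * F)"
    using N unfolding order_le_def by (simp add: pd_cmult local_in_smooth[OF assms(1)])
  have "binomial_sum A (- 1) N (\<lambda>xs. (\<lambda>_. x) * pS i xs F) \<mu>s =
      (\<lambda>_. x) * binomial_sum A (- 1) N (\<lambda>xs. pS i xs F) \<mu>s"
    unfolding binomial_sum_def nabla_power_weighted[OF locals_pS[OF assms(1)], where c = "\<lambda>_. x"] sum_distrib_left
    by (simp add: mult.left_commute)
  then show ?thesis
    by (simp only: euler_eq_binomial_sum[OF assms N] euler_eq_binomial_sum[OF loc assms(2) N']
        pS_cmult[OF local_in_UNIV[OF assms(1)]])
qed

text \<open>The common shape of both orders of the indices: \<open>x m\<close> is - 1 for T^{0i} and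
  1/(m+1) for T^{i0}, with the same family \<open>Y\<close>.\<close>

lemma homotopy_coeff_spatial:
  fixes S :: "nat \<Rightarrow> ('a::finite, 'c::finite) lfun"
  assumes "\<And>j ms. j \<in> fields \<Longrightarrow> euler n j (ms @ [\<nu>]) (S \<mu>) = (case j of
      Z A \<Rightarrow> if set ms \<subseteq> {1..<n} then (\<lambda>_. x (length ms)) * Y A ms else 0 | _ \<Rightarrow> 0)"
    and "\<And>A. locals (Y A)"
  shows "homotopy_coeff n fields N S \<mu> \<nu> = (\<Sum>A\<in>UNIV. \<Sum>m\<le>N. \<Sum>ms\<in>words {1..<n} m.
    fscale (\<lambda>_. (real m + 1) / (real m + 2) * x m) (ftds ms (fscale (Y A ms) (dz A))))"
proof -
  define c where "c m = (real m + 1) / (real m + 2)" for m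
  define w where "w m ms = (\<Sum>A\<in>UNIV. fscale (\<lambda>_. c m * x m) (ftds ms (fscale (Y A ms) (dz A))))" for m ms
  have Y: "local_form (fscale (Y A ms) (dz A))" for A ms
    by (intro local_form_fscale localsD[OF assms(2)] local_form_gen_form)
  have "(\<Sum>j\<in>fields. fscale (euler n j (ms @ [\<nu>]) (S \<mu>)) (gen_form (DV j {#}))) =
      (if set ms \<subseteq> {1..<n} then \<Sum>A\<in>UNIV. fscale (\<lambda>_. x (length ms)) (fscale (Y A ms) (dz A)) else 0)" for ms
  proof -
    have "(\<Sum>j\<in>fields. fscale (euler n j (ms @ [\<nu>]) (S \<mu>)) (gen_form (DV j {#}))) =
        (\<Sum>j\<in>(fields :: ('a, 'c) fld set). case j of Z A \<Rightarrow> if set ms \<subseteq> {1..<n}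
          then fscale (\<lambda>_. x (length ms)) (fscale (Y A ms) (dz A)) else 0 | _ \<Rightarrow> 0)"
      by (intro sum.cong refl)
        (simp add: assms(1) fscale_fscale fscale_0_left split: fld.split)
    then show ?thesis
      by (simp add: sum_fields)
  qed
  moreover have "fscale (\<lambda>_. c m) (ftds ms (\<Sum>A\<in>UNIV. fscale (\<lambda>_. x m) (fscale (Y A ms) (dz A)))) = w m ms" for m ms
  proof -
    have "ftds ms (\<Sum>A\<in>UNIV. fscale (\<lambda>_. x m) (fscale (Y A ms) (dz A))) =
        (\<Sum>A\<in>UNIV. ftds ms (fscale (\<lambda>_. x m) (fscale (Y A ms) (dz A))))"
      by (intro ftds_sum local_form_fscale[OF local_in_const] Y)
    also have "\<dots> = (\<Sum>A\<in>UNIV. fscale (\<lambda>_. x m) (ftds ms (fscale (Y A ms) (dz A))))"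
      by (intro sum.cong refl ftds_cscale Y)
    finally show ?thesis
      by (simp only: w_def fscale_sum_right fscale_fscale times_fun_def)
  qed
  ultimately have inner: "fscale (\<lambda>_. c m) (ftds ms
      (\<Sum>j\<in>fields. fscale (euler n j (ms @ [\<nu>]) (S \<mu>)) (gen_form (DV j {#})))) =
      (if set ms \<subseteq> {1..<n} then w m ms else 0)" if "ms \<in> words {..<n} m" for m ms
    using that by (auto simp: words_def ftds_0 fscale_0_right)
  have "homotopy_coeff n fields N S \<mu> \<nu> =
      (\<Sum>m\<le>N. \<Sum>ms\<in>words {..<n} m. if set ms \<subseteq> {1..<n} then w m ms else 0)"
    unfolding homotopy_coeff_def c_def[symmetric] by (intro sum.cong refl inner)
  also have "\<dots> = (\<Sum>m\<le>N. \<Sum>ms\<in>words {1..<n} m. w m ms)"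
    by (intro sum.cong refl sum.mono_neutral_cong_right finite_words) (auto simp: words_def)
  finally show ?thesis
    unfolding w_def c_def by (simp only: sum.swap[of _ _ UNIV])
qed

lemma local_in_smeared:
  assumes "\<And>a. local_in (z_spatial n) (\<gamma> a)"
  shows "local_in (jet_coords n (range Z \<union> range Par) {1..<n}) (smeared \<gamma>)"
  unfolding smeared_def par_def
  by (intro local_in_intros local_in_coordf local_in_mono[OF assms])
    (auto simp: z_spatial_def jet_coords_def)

lemma local_in_h_ext:
  assumes "local_in (z_spatial n) h" "\<And>a. local_in (z_spatial n) (\<gamma> a)"
  shows "local_in (jet_coords n UNIV {1..<n}) (h_ext h \<gamma>)"
  unfolding h_ext_def lam_def
  by (intro local_in_intros local_in_coordf local_in_mono[OF assms(1)] local_in_mono[OF assms(2)])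
    (auto simp: z_spatial_def jet_coords_def)

text \<open>Each component of the symplectic potential is a coordinate or 0, so
  \<open>sigma_lo\<close> is a constant matrix. Whatever its inverse is, the entries are then
  constant too.\<close>

lemma local_in_sigma_up: "local_in D (sigma_up A B :: ('a::finite, 'c) lfun)"
proof -
  fix q :: "('a, 'c) fld coord \<Rightarrow> real"
  have "\<exists>c. pd d (sympl_pot E) = (\<lambda>_. c)" for d :: "('a, 'c) fld coord" and E :: "'a + 'a"
    using pd_const[of d 0] by (cases E) (auto simp: sympl_pot_def pd_coordf zero_fun_def)
  then have pd: "pd d (sympl_pot E) p = pd d (sympl_pot E) q"
    for d :: "('a, 'c) fld coord" and p and E :: "'a + 'a"
    by metis
  have const: "(sigma_lo D E :: ('a, 'c) lfun) p = sigma_lo D E q" for D E :: "'a + 'a" and p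
    by (simp only: sigma_lo_def minus_apply pd[where p = p])
  have "(sigma_up A B :: ('a, 'c) lfun) = (\<lambda>_. sigma_up A B q)"
  proof
    fix p :: "('a, 'c) fld coord \<Rightarrow> real"
    show "sigma_up A B p = sigma_up A B q"
      unfolding sigma_up_def by (simp only: const[where p = p])
  qed
  then show ?thesis
    by (metis local_in_const)
qed

lemma local_in_bidiff_op:
  assumes "\<And>ms ks. local_in D (P ms ks)" "local_in D u" "local_in D v" "prolonged {1..<n} D"
  shows "local_in D (bidiff_op n P u v)"
  unfolding bidiff_op_def
proof (intro local_in_Sum_any)
  fix b :: "nat list \<times> nat list"
  show "local_in D (if b \<in> lists {1..<n} \<times> lists {1..<n} then case b of (ms, ks) \<Rightarrow> P ms ks * tds ms u * tds ks v else 0)"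
    by (cases b) (auto simp: local_in_0 intro!: local_in_mult assms(1) local_in_tds[OF assms(2,4)] local_in_tds[OF assms(3,4)])
qed

text \<open>With all derivatives moved onto \<open>dz\<close>, the coefficients are local in the
  jets of \<open>z\<close> and of the gauge parameters, and the generators are those of
  \<open>z\<close>.\<close>

lemma bdry_multiplier_free:
  fixes \<gamma> :: "'c \<Rightarrow> ('a::finite, 'c::finite) lfun"
  assumes "\<And>a. local_in (z_spatial n) (\<gamma> a)" "i \<in> {1..<n}"
  shows "multiplier_free (- bdry n i dz (smeared \<gamma>))"
proof -
  let ?D = "jet_coords n (range Z \<union> range Par) {1..<n} :: ('a, 'c) fld coord set"
  note loc = local_in_smeared[where \<gamma> = \<gamma>, OF assms(1)]
  obtain N where N: "order_le N (smeared \<gamma>)"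
    using order_le_exists[OF loc] .
  define G where "G A ms = binomial_sum {1..<n} 1 N (shifted_euler n N (smeared \<gamma>) A i) ms" for A ms
  have G: "local_in ?D (G A ms)" for A ms
    unfolding G_def by (intro local_in_binomial_sum local_in_shifted_euler[OF loc N] prolonged_jet_coords)
  have bdry: "bdry n i dz (smeared \<gamma>) gs = (\<Sum>A\<in>UNIV. \<Sum>m\<le>N. \<Sum>ms\<in>words {1..<n} m.
      G A ms * gen_form (DV (Z A) (mset ms)) gs)" for gs
    unfolding bdry_eq_binomial_sum[where Q = dz, OF loc N assms(2) local_form_gen_form] G_def ftds_gen_form
    by (simp add: sum_fun_apply fscale_def)
  show ?thesis
    unfolding multiplier_free_def
  proof (intro allI conjI impI)
    fix gs
    have "local_in ?D (bdry n i dz (smeared \<gamma>) gs)"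
      unfolding bdry by (intro local_in_intros G) (simp add: gen_form_def local_in_0 local_in_1)
    then have "local_in ?D ((- bdry n i dz (smeared \<gamma>)) gs)"
      by (simp add: uminus_apply local_in_uminus)
    moreover have "?D \<subseteq> - {U (Lam a) M | a M. True}"
      by (auto simp: jet_coords_def)
    ultimately show "depends_on (- {U (Lam a) M | a M. True}) ((- bdry n i dz (smeared \<gamma>)) gs)"
      by (blast intro: depends_on_mono local_in_depends_on)
    assume "\<exists>a M. DV (Lam a) M \<in> set gs"
    then have "gen_form (DV (Z A) M) gs = 0" for A M
      by (auto simp: gen_form_def)
    then have "bdry n i dz (smeared \<gamma>) gs = 0"
      unfolding bdry by simp
    then show "(- bdry n i dz (smeared \<gamma>)) gs = 0"
      by (simp add: uminus_apply)
  qed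
qed

section \<open>Surface charges of multiplier-free forms, and antisymmetrised components\<close>

lemma eval_vertical_multiplier_free:
  assumes "multiplier_free \<omega>" "\<And>i. i \<notin> range Lam \<Longrightarrow> \<phi> i = \<phi>' i \<and> \<psi> i = \<psi>' i"
  shows "eval_vertical \<omega> \<phi> \<psi> x = eval_vertical \<omega> \<phi>' \<psi>' x"
  unfolding eval_vertical_def
proof (rule Sum_any.cong)
  fix y :: "('a, 'b) fld \<times> nat multiset"
  obtain i M where y: "y = (i, M)" by (cases y)
  have "\<omega> [DV i M] (jet \<phi> x) * jet \<psi> x (U i M) = \<omega> [DV i M] (jet \<phi>' x) * jet \<psi>' x (U i M)"
  proof (cases "i \<in> range Lam")
    case True
    then have "\<omega> [DV i M] = 0"
      using assms(1) unfolding multiplier_free_def by (metis imageE list.set_intros(1))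
    then show ?thesis
      by (simp add: zero_fun_apply)
  next
    case False
    have "jet \<phi> x c = jet \<phi>' x c" if "c \<notin> {U (Lam a) M | a M. True}" for c
      using that assms(2) by (cases c) (auto simp: image_iff)
    then have "\<omega> [DV i M] (jet \<phi> x) = \<omega> [DV i M] (jet \<phi>' x)"
      using assms(1) unfolding multiplier_free_def depends_on_def by blast
    with False show ?thesis
      using assms(2) by simp
  qed
  then show "(case y of (i, M) \<Rightarrow> \<omega> [DV i M] (jet \<phi> x) * jet \<psi> x (U i M)) =
      (case y of (i, M) \<Rightarrow> \<omega> [DV i M] (jet \<phi>' x) * jet \<psi>' x (U i M))"
    by (simp add: y)
qed

lemma surface_charge_multiplier_free:
  assumes "\<And>i. i \<in> {1..<n} \<Longrightarrow> multiplier_free (k 0 i)"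
    and "\<And>i. i \<notin> range Lam \<Longrightarrow> \<phi> i = \<phi>' i \<and> \<psi> i = \<psi>' i"
  shows "surface_charge n k \<Sigma> \<phi> \<psi> = surface_charge n k \<Sigma> \<phi>' \<psi>'"
proof -
  \<comment> \<open>The surface element has constant coefficients, so the section enters through
    \<open>eval_vertical\<close> alone.\<close>
  have dsigma: "dsigma n i gs p = dsigma n i gs q" for i gs and p q :: "('a, 'b) fld coord \<Rightarrow> real"
    by (simp add: dsigma_def dxf_def fscale_def fun_apply)
  have "(\<Sum>i=1..<n. eval_vertical (k 0 i) \<phi> \<psi> y * (\<Sum>\<alpha>s\<in>{\<alpha>s \<in> lists {..<n}. length \<alpha>s = n - 2}.
      dsigma n i (map Dx \<alpha>s) (jet \<phi> y) * f \<alpha>s)) =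
    (\<Sum>i=1..<n. eval_vertical (k 0 i) \<phi>' \<psi>' y * (\<Sum>\<alpha>s\<in>{\<alpha>s \<in> lists {..<n}. length \<alpha>s = n - 2}.
      dsigma n i (map Dx \<alpha>s) (jet \<phi>' y) * f \<alpha>s))" for y f
  proof (rule sum.cong[OF refl])
    fix i
    assume "i \<in> {1..<n}"
    from assms(1)[OF this] have "eval_vertical (k 0 i) \<phi> \<psi> y = eval_vertical (k 0 i) \<phi>' \<psi>' y"
      by (rule eval_vertical_multiplier_free) (rule assms(2))
    then show "eval_vertical (k 0 i) \<phi> \<psi> y * (\<Sum>\<alpha>s\<in>{\<alpha>s \<in> lists {..<n}. length \<alpha>s = n - 2}.
        dsigma n i (map Dx \<alpha>s) (jet \<phi> y) * f \<alpha>s) =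
      eval_vertical (k 0 i) \<phi>' \<psi>' y * (\<Sum>\<alpha>s\<in>{\<alpha>s \<in> lists {..<n}. length \<alpha>s = n - 2}.
        dsigma n i (map Dx \<alpha>s) (jet \<phi>' y) * f \<alpha>s)"
      by (simp only: dsigma[of i _ "jet \<phi> y" "jet \<phi>' y"])
  qed
  then show ?thesis
    unfolding surface_charge_def by (simp only:)
qed

text \<open>\<open>dxf\<close> is antisymmetric, so only the antisymmetric part of \<open>T\<close>
  survives, and the factor 2 spreads over the two orders of the indices. The cut-off at
  \<open>n\<close> is the normalisation that \<open>components2\<close> demands.\<close>

lemma components2_antisymmetrize:
  assumes "\<And>\<mu> \<nu>. \<mu> < n \<Longrightarrow> \<nu> < n \<Longrightarrow> vertical_form n (T \<mu> \<nu>)"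
  shows "components2 n (\<Sum>\<mu><n. \<Sum>\<nu><n. wedge1 (T \<mu> \<nu>) (fscale (\<lambda>_. 2) (dxf n [\<mu>, \<nu>])))
    (\<lambda>\<mu> \<nu>. if \<mu> < n \<and> \<nu> < n then T \<mu> \<nu> - T \<nu> \<mu> else 0)"
  unfolding components2_def is_form_0_1_iff
proof (intro conjI allI impI)
  fix \<mu> \<nu>
  show "vertical_form n (if \<mu> < n \<and> \<nu> < n then T \<mu> \<nu> - T \<nu> \<mu> else 0)"
    using assms by (simp add: vertical_form_diff vertical_form_0)
  define W where "W \<mu> \<nu> = wedge1 (T \<mu> \<nu>) (dxf n [\<mu>, \<nu>])" for \<mu> \<nu>
  have double: "W \<mu> \<nu> + W \<mu> \<nu> = wedge1 (T \<mu> \<nu>) (fscale (\<lambda>_. 2) (dxf n [\<mu>, \<nu>]))" for \<mu> \<nu>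
    unfolding W_def wedge1_fscale_right by (simp add: fscale_def fun_eq_iff fun_apply)
  have "wedge1 (T \<nu> \<mu>) (dxf n [\<mu>, \<nu>]) = - W \<nu> \<mu>" for \<mu> \<nu>
    unfolding W_def dxf_swap[of n \<mu> \<nu>] by (rule wedge1_uminus_right)
  then have "wedge1 (T \<mu> \<nu> - T \<nu> \<mu>) (dxf n [\<mu>, \<nu>]) = W \<mu> \<nu> + W \<nu> \<mu>" for \<mu> \<nu>
    by (simp add: wedge1_diff_left W_def)
  then have "(\<Sum>\<mu><n. \<Sum>\<nu><n. wedge1 (if \<mu> < n \<and> \<nu> < n then T \<mu> \<nu> - T \<nu> \<mu> else 0) (dxf n [\<mu>, \<nu>])) =
      (\<Sum>\<mu><n. \<Sum>\<nu><n. W \<mu> \<nu> + W \<nu> \<mu>)"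
    by (intro sum.cong refl) simp
  also have "\<dots> = (\<Sum>\<mu><n. \<Sum>\<nu><n. W \<mu> \<nu>) + (\<Sum>\<mu><n. \<Sum>\<nu><n. W \<nu> \<mu>)"
    by (simp only: sum.distrib)
  also have "(\<Sum>\<mu><n. \<Sum>\<nu><n. W \<nu> \<mu>) = (\<Sum>\<mu><n. \<Sum>\<nu><n. W \<mu> \<nu>)"
    by (rule sum.swap)
  also have "(\<Sum>\<mu><n. \<Sum>\<nu><n. W \<mu> \<nu>) + (\<Sum>\<mu><n. \<Sum>\<nu><n. W \<mu> \<nu>) = (\<Sum>\<mu><n. \<Sum>\<nu><n. W \<mu> \<nu> + W \<mu> \<nu>)"
    by (simp only: sum.distrib)
  also have "\<dots> = (\<Sum>\<mu><n. \<Sum>\<nu><n. wedge1 (T \<mu> \<nu>) (fscale (\<lambda>_. 2) (dxf n [\<mu>, \<nu>])))"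
    by (simp only: double)
  finally show "(\<Sum>\<mu><n. \<Sum>\<nu><n. wedge1 (T \<mu> \<nu>) (fscale (\<lambda>_. 2) (dxf n [\<mu>, \<nu>]))) =
      (\<Sum>\<mu><n. \<Sum>\<nu><n. wedge1 (if \<mu> < n \<and> \<nu> < n then T \<mu> \<nu> - T \<nu> \<mu> else 0) (dxf n [\<mu>, \<nu>]))"
    by (rule sym)
qed auto

theorem proposition14:
  fixes n :: nat
    and h :: "('a::finite, 'c::finite) lfun"
    and \<gamma> :: "'c \<Rightarrow> ('a, 'c) lfun"
    and C :: "'c \<Rightarrow> 'c \<Rightarrow> 'c \<Rightarrow> nat list \<Rightarrow> nat list \<Rightarrow> ('a, 'c) lfun"
    and V :: "'c \<Rightarrow> 'c \<Rightarrow> nat list \<Rightarrow> ('a, 'c) lfun"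
    and J :: "nat \<Rightarrow> 'c \<Rightarrow> 'c \<Rightarrow> nat list \<Rightarrow> nat list \<Rightarrow> ('a, 'c) lfun"
    and S :: "nat \<Rightarrow> ('a, 'c) lfun"
  assumes "2 \<le> n"
    and "local_in (z_spatial n) h"
    and "\<And>a. local_in (z_spatial n) (\<gamma> a)"
    and "\<And>a. pd (X 0) (\<gamma> a) = 0"
    and "irreducible_constraints n \<gamma>"
    and "first_class n h \<gamma> C V"
    and "current_operator n \<gamma> C V J"
    and "weakly_vanishing_current n h \<gamma> C V J S"
  shows "(\<exists>!k. components2 n (charge_form n S) k) \<and>
    (\<forall>k. components2 n (charge_form n S) k \<longrightarrow>
      (\<forall>i\<in>{1..<n}. multiplier_free (k 0 i)) \<and>
      (\<forall>t \<Sigma> \<phi> \<phi>' \<psi> \<psi>'. closed_surface n t \<Sigma> \<and>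
         smooth_section n \<phi> \<and> smooth_section n \<phi>' \<and> smooth_section n \<psi> \<and> smooth_section n \<psi>' \<and>
         (\<forall>i. i \<notin> range Lam \<longrightarrow> \<phi> i = \<phi>' i \<and> \<psi> i = \<psi>' i) \<longrightarrow>
         surface_charge n k \<Sigma> \<phi> \<psi> = surface_charge n k \<Sigma> \<phi>' \<psi>') \<and>
      (\<forall>i\<in>{1..<n}. k 0 i = - bdry n i dz (smeared \<gamma>)) \<and>
      - d_V_z (smeared \<gamma>) =
        - (\<Sum>A\<in>UNIV. fscale (euler n (Z A) [] (smeared \<gamma>)) (dz A)) + (\<Sum>i=1..<n. ftd i (k 0 i)))"
proof -
  define g where "g = smeared \<gamma>"
  let ?Dg = "jet_coords n (range Z \<union> range Par) {1..<n} :: ('a, 'c) fld coord set"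
  let ?Ds = "jet_coords n UNIV {1..<n} :: ('a, 'c) fld coord set"
  let ?D = "jet_coords n UNIV {..<n} :: ('a, 'c) fld coord set"
  have sub: "?Dg \<subseteq> ?Ds" "?Ds \<subseteq> ?D" "?Dg \<subseteq> ?D"
    by (intro jet_coords_mono; auto)+
  have loc_g: "local_in ?Dg g"
    unfolding g_def by (rule local_in_smeared[OF assms(3)])
  \<comment> \<open>The velocities according to the Hamilton equations of \<open>h_ext\<close>. They
    contain no time derivatives and so belong to the remainder of the current.\<close>
  define E where "E B = (\<Sum>A\<in>UNIV. sigma_up B A * euler n (Z A) [] (h_ext h \<gamma>))" for B :: "'a + 'a"
  define K where "K k = (\<Sum>a\<in>UNIV. \<Sum>b\<in>UNIV. bidiff_op n (J k a b) (\<gamma> a) (par b))" for k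
  \<comment> \<open>Written as a constant multiple, the shape that \<open>euler_cmult\<close>
    takes.\<close>
  have S0: "S 0 = (\<lambda>_. - 1) * g"
    using assms(8) unfolding weakly_vanishing_current_def g_def by (simp add: fun_Compl_def times_fun_def)
  have Sk: "S k = bdry n k (\<lambda>B. zero_form (zdot B - E B)) g [] + K k" if "k \<in> {1..<n}" for k
    using assms(8) that unfolding weakly_vanishing_current_def g_def E_def K_def by blast
  have loc_E: "local_in ?Ds (E B)" for B
    unfolding E_def
    by (intro local_in_sum local_in_mult local_in_sigma_up local_in_euler local_in_h_ext assms(2,3)) auto
  have loc_K: "local_in ?Ds (K k)" for k
  proof -
    have "local_in (jet_coords n fields {1..<n}) (J k a b ms ks)" for a b ms ks
      using assms(7) unfolding current_operator_def by blast
    then have "local_in ?Ds (J k a b ms ks)" for a b ms ks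
      by (rule local_in_mono) (intro jet_coords_mono subset_UNIV order_refl)
    moreover have "local_in ?Ds (\<gamma> a)" for a
      using assms(3) unfolding z_spatial_def by (rule local_in_mono) (intro jet_coords_mono subset_UNIV order_refl)
    moreover have "local_in ?Ds (par b)" for b
      unfolding par_def by (rule local_in_coordf) (auto simp: jet_coords_def)
    ultimately show ?thesis
      unfolding K_def by (intro local_in_sum local_in_bidiff_op prolonged_jet_coords)
  qed
  obtain Ng where Ng: "order_le Ng g"
    using order_le_exists[OF loc_g] .
  \<comment> \<open>Kept as functions of the bound: with \<open>Ng\<close> they show that the
    currents are local, and only then is there a bound \<open>NS\<close> for the currents. The
    charge is computed with a bound that serves both \<open>g\<close> and the currents.\<close>
  define velocity where "velocity N k = (\<Sum>A\<in>UNIV. \<Sum>m\<le>N. \<Sum>ms\<in>words {1..<n} m.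
      binomial_sum {1..<n} 1 N (shifted_euler n N g A k) ms * coordf (U (Z A) (add_mset 0 (mset ms))))" for N k
  define rest where "rest N k = K k - (\<Sum>A\<in>UNIV. \<Sum>m\<le>N. \<Sum>ms\<in>words {1..<n} m.
      binomial_sum {1..<n} 1 N (shifted_euler n N g A k) ms * tds ms (E A))" for N k
  have S_eq: "S k = velocity N k + rest N k" if "k \<in> {1..<n}" "order_le N g" for N k
    using bdry_velocity[OF loc_g that(2,1) local_in_UNIV[OF loc_E]]
    unfolding Sk[OF that(1)] velocity_def rest_def by simp
  have loc_G: "local_in ?Dg (binomial_sum {1..<n} 1 N (shifted_euler n N g A k) ms)" if "order_le N g" for N A k ms
    by (intro local_in_binomial_sum local_in_shifted_euler[OF loc_g that] prolonged_jet_coords)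
  have loc_rest: "local_in ?Ds (rest N k)" if "order_le N g" for N k
    unfolding rest_def
    by (intro local_in_diff local_in_sum local_in_mult loc_K local_in_mono[OF loc_G[OF that] sub(1)]
        local_in_tds[OF loc_E prolonged_jet_coords]) (auto simp: words_def)
  have loc_S: "local_in ?D (S \<mu>)" if "\<mu> < n" for \<mu>
  proof (cases "\<mu> = 0")
    case True
    then show ?thesis
      using local_in_mono[OF loc_g sub(3)] by (simp add: S0 local_in_mult local_in_const)
  next
    case False
    with that have \<mu>: "\<mu> \<in> {1..<n}" by simp
    have "local_in ?D (velocity Ng \<mu>)"
      unfolding velocity_def
      by (intro local_in_sum local_in_mult local_in_mono[OF loc_G[OF Ng] sub(3)] local_in_coordf)
        (use that in \<open>auto simp: words_def jet_coords_def\<close>)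
    then show ?thesis
      unfolding S_eq[OF \<mu> Ng] by (intro local_in_add local_in_mono[OF loc_rest[OF Ng] sub(2)])
  qed
  obtain NS where NS: "\<And>\<mu>. \<mu> < n \<Longrightarrow> order_le NS (S \<mu>)"
    using order_le_exists_family[of "{..<n}" "\<lambda>_. ?D" S] loc_S by auto
  define N where "N = max Ng NS"
  have N: "order_le N g" "\<And>\<mu>. \<mu> < n \<Longrightarrow> order_le N (S \<mu>)"
    unfolding N_def by (rule order_le_mono[OF Ng], simp, rule order_le_mono[OF NS], assumption, simp)
  define T where "T = homotopy_coeff n fields N S"
  have charge: "charge_form n S = (\<Sum>\<mu><n. \<Sum>\<nu><n. wedge1 (T \<mu> \<nu>) (fscale (\<lambda>_. 2) (dxf n [\<mu>, \<nu>])))"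
    unfolding charge_form_def T_def
    by (rule homotopy_current_form[OF _ finite_fields loc_S N(2)]) (use assms(1) in auto)
  define k0 where "k0 \<mu> \<nu> = (if \<mu> < n \<and> \<nu> < n then T \<mu> \<nu> - T \<nu> \<mu> else 0)" for \<mu> \<nu>
  have comp: "components2 n (charge_form n S) k0"
    unfolding charge k0_def[abs_def] T_def
    by (intro components2_antisymmetrize vertical_form_homotopy_coeff loc_S)
  have k0: "k0 0 i = - bdry n i dz g" if i: "i \<in> {1..<n}" for i
  proof -
    define Y where "Y A ms = shifted_euler n N g A i ms" for A ms
    have Y: "locals (Y A)" for A
      unfolding Y_def[abs_def] by (rule locals_shifted_euler[OF loc_g N(1)])
    have "T 0 i = (\<Sum>A\<in>UNIV. \<Sum>m\<le>N. \<Sum>ms\<in>words {1..<n} m.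
        fscale (\<lambda>_. (real m + 1) / (real m + 2) * (- 1)) (ftds ms (fscale (Y A ms) (dz A))))"
      unfolding T_def
    proof (rule homotopy_coeff_spatial[OF _ Y])
      fix j :: "('a, 'c) fld" and ms
      assume "j \<in> fields"
      have "euler n j (ms @ [i]) (S 0) = (\<lambda>_. - 1) * euler n j (ms @ [i]) g"
        unfolding S0 by (rule euler_cmult[OF loc_g spatial_subset])
      moreover have "euler n (Lam b) (ms @ [i]) g = 0" for b
        by (rule euler_eq_0[OF loc_g spatial_subset]) auto
      moreover have "euler n (Z A) (ms @ [i]) g = 0" if "\<not> set ms \<subseteq> {1..<n}" for A
        by (rule euler_eq_0[OF loc_g spatial_subset]) (use that in auto)
      moreover have "euler n (Z A) (ms @ [i]) g = Y A ms" for A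
        unfolding Y_def by (rule euler_shifted[OF loc_g N(1)])
      ultimately show "euler n j (ms @ [i]) (S 0) = (case j of
          Z A \<Rightarrow> if set ms \<subseteq> {1..<n} then (\<lambda>_. - 1) * Y A ms else 0 | _ \<Rightarrow> 0)"
        using \<open>j \<in> fields\<close> i by (cases j) (auto simp: fields_def)
    qed
    moreover have "T i 0 = (\<Sum>A\<in>UNIV. \<Sum>m\<le>N. \<Sum>ms\<in>words {1..<n} m.
        fscale (\<lambda>_. (real m + 1) / (real m + 2) * (1 / (real m + 1))) (ftds ms (fscale (Y A ms) (dz A))))"
      unfolding T_def
      by (rule homotopy_coeff_spatial[OF _ Y])
        (unfold Y_def, rule euler_velocity[OF loc_g N(1) S_eq[OF i N(1), unfolded velocity_def] loc_rest[OF N(1)]])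
    moreover have "k0 0 i = T 0 i - T i 0"
      using i by (simp add: k0_def)
    \<comment> \<open>At length \<open>m\<close> the boundary term is shared between the two orders
      of the indices: (m+1)/(m+2) of it comes from S^0 and 1/(m+2) from S^i.\<close>
    moreover have "fscale (\<lambda>_. (real m + 1) / (real m + 2) * (- 1)) v -
        fscale (\<lambda>_. (real m + 1) / (real m + 2) * (1 / (real m + 1))) v = - v" for m and v :: "('a, 'c) lform"
    proof -
      have "(real m + 1) / (real m + 2) * (- 1) * y - (real m + 1) / (real m + 2) * (1 / (real m + 1)) * y = - y" for y
      proof -
        have "real m + 1 \<noteq> 0" "real m + 2 \<noteq> 0"
          by linarith+
        then have "(real m + 1) / (real m + 2) + (real m + 1) / (real m + 2) * (1 / (real m + 1)) = 1"
          by (simp flip: add_divide_distrib)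
        moreover have "c * (- 1) * y - d * y = - ((c + d) * y)" for c d :: real
          by (simp add: algebra_simps)
        ultimately show ?thesis
          by (simp only: mult_1)
      qed
      then show ?thesis
        by (simp add: fscale_def fun_eq_iff fun_apply)
    qed
    ultimately have "k0 0 i = (\<Sum>A\<in>UNIV. \<Sum>m\<le>N. \<Sum>ms\<in>words {1..<n} m. - ftds ms (fscale (Y A ms) (dz A)))"
      by (simp only: sum_subtractf[symmetric])
    then show ?thesis
      unfolding bdry_eq_sum_words[OF loc_g N(1) i] Y_def by (simp only: sum_negf)
  qed
  have variation: "- d_V_z g = - (\<Sum>A\<in>UNIV. fscale (euler n (Z A) [] g) (dz A)) + (\<Sum>i=1..<n. ftd i (k0 0 i))"
  proof -
    have "ftd i (k0 0 i) = - ftd i (bdry n i dz g)" if "i \<in> {1..<n}" for i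
    proof -
      have "local_form (bdry n i dz g)"
        unfolding bdry_eq_sum_words[OF loc_g N(1) that]
        by (intro local_form_sum local_form_ftds local_form_fscale local_form_gen_form
            localsD[OF locals_shifted_euler[OF loc_g N(1)]])
      then have "ftd i (fscale (\<lambda>_. - 1) (bdry n i dz g)) = fscale (\<lambda>_. - 1) (ftd i (bdry n i dz g))"
        by (rule ftd_cscale)
      moreover have "fscale (\<lambda>_. - 1) v = - v" for v :: "('a, 'c) lform"
        by (simp add: fscale_def fun_eq_iff fun_apply)
      ultimately show ?thesis
        by (simp only: k0[OF that])
    qed
    then have "(\<Sum>i=1..<n. ftd i (k0 0 i)) = - (\<Sum>i=1..<n. ftd i (bdry n i dz g))"
      by (simp add: sum_negf)
    then show ?thesis
      unfolding d_V_z_eq_euler_plus_bdry[OF loc_g N(1)] by simp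
  qed
  have free: "multiplier_free (k0 0 i)" if "i \<in> {1..<n}" for i
    unfolding k0[OF that] g_def by (rule bdry_multiplier_free[OF assms(3) that])
  show ?thesis
  proof (intro conjI allI impI)
    show "\<exists>!k. components2 n (charge_form n S) k"
      using comp components2_unique by blast
  next
    fix k
    assume "components2 n (charge_form n S) k"
    then have k: "k = k0"
      using comp components2_unique by blast
    show "\<forall>i\<in>{1..<n}. multiplier_free (k 0 i)"
      unfolding k using free by blast
    show "\<forall>i\<in>{1..<n}. k 0 i = - bdry n i dz (smeared \<gamma>)"
      unfolding k using k0 by (simp add: g_def)
    show "- d_V_z (smeared \<gamma>) =
        - (\<Sum>A\<in>UNIV. fscale (euler n (Z A) [] (smeared \<gamma>)) (dz A)) + (\<Sum>i=1..<n. ftd i (k 0 i))"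
      using variation unfolding k g_def .
    fix t \<Sigma> and \<phi> \<phi>' \<psi> \<psi>' :: "('a, 'c) fld \<Rightarrow> (nat \<Rightarrow> real) \<Rightarrow> real"
    assume *: "closed_surface n t \<Sigma> \<and>
         smooth_section n \<phi> \<and> smooth_section n \<phi>' \<and> smooth_section n \<psi> \<and> smooth_section n \<psi>' \<and>
         (\<forall>i. i \<notin> range Lam \<longrightarrow> \<phi> i = \<phi>' i \<and> \<psi> i = \<psi>' i)"
    show "surface_charge n k \<Sigma> \<phi> \<psi> = surface_charge n k \<Sigma> \<phi>' \<psi>'"
      unfolding k by (rule surface_charge_multiplier_free) (use free * in blast)+
  qed
qed

end
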